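(* Let $p\in(0,1]$ and, for each integer $n\ge 1$, let $\mathcal{T}_{n,p}$ be the $p$-percolated uniform temporal tree. Then $$\mathbf{E}|\mathcal{T}_{n,p}| = e^{np}\quad\text{for every } n\ge 1,$$ and $$\frac{|\mathcal{T}_{n,p}|}{e^{np}} \to E \quad\text{in distribution as } n\to\infty,$$ where $E$ is an exponential$(1)$ random variable. Moreover, for $1\le i\le n$ let $v_i$ be the child of the root of $\mathcal{T}_{n,p}$ with the $i$-th largest label. Then for every fixed integer $m\ge 1$, $$\left(\frac{|\mathcal{T}_{n,p}(v_1)|}{e^{np}},\ldots,\frac{|\mathcal{T}_{n,p}(v_m)|}{e^{np}}\right)\to \left(E_1U_1,\; E_2U_1U_2,\;\ldots,\; E_mU_1\cdots U_m\right)\quad\text{in distribution as } n\to\infty,$$ where $(E_k)_{k\ge 1}$ is a sequence of independent exponential$(1)$ random variables and $(U_k)_{k\ge 1}$ is a sequence of independent uniform $[0,1]$ random variables, independent of $(E_k)_{k\ge1}$.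
   Context: For a positive integer $n$, let $T_n$ be the rooted infinite complete $n$-ary tree (every vertex has exactly $n$ children). To each edge $e$ of $T_n$ assign an independent random variable $U_e$ uniformly distributed on $[0,1]$. The label $\ell_v$ of a non-root vertex $v$ is $U_e$, where $e$ is the edge joining $v$ to its parent. For $p\in(0,1]$, assign the root the label $p$. The $p$-percolated uniform temporal tree $\mathcal{T}_{n,p}$ is the random rooted tree obtained from $T_n$ by deleting all vertices $v$ for which the vertex labels along the path from the root to $v$ are not decreasing. (Thus a vertex $v$ of $T_n$ is kept exactly when the labels read along the path from the root to $v$, starting with the label $p$ of the root, are decreasing.) The tree is almost surely finite. For a rooted tree $T$, $|T|$ denotes its number of vertices, and $T(v)$ denotes the subtree rooted at the vertex $v$, consisting of $v$ and all its descendants in $T$. If the root of $\mathcal{T}_{n,p}$ has fewer than $i$ children, then $\mathcal{T}_{n,p}(v_i)$ is taken to be empty, so $|\mathcal{T}_{n,p}(v_i)|=0$. *)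

theory Defs
  imports "HOL-Probability.Probability" "HOL-Library.Sublist"
begin

text \<open>
  A vertex of the complete \<open>n\<close>-ary tree is the list of child indices (each below \<open>n\<close>) read along
  the path from the root, so \<open>[]\<close> is the root and the parent of a non-root vertex \<open>v\<close> is
  \<open>butlast v\<close>. The edge joining \<open>v\<close> to its parent is identified with its lower endpoint \<open>v\<close>.
\<close>

definition tree_vertices :: "nat \<Rightarrow> nat list set" where
  "tree_vertices n = lists {..<n}"

definition tree_edges :: "nat \<Rightarrow> nat list set" where
  "tree_edges n = tree_vertices n - {[]}"

definition uniform_edge_variables ::
    "'a measure \<Rightarrow> nat \<Rightarrow> (nat list \<Rightarrow> 'a \<Rightarrow> real) \<Rightarrow> bool" where
  "uniform_edge_variables M n U \<longleftrightarrow>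
     prob_space M \<and>
     prob_space.indep_vars M (\<lambda>_. borel) U (tree_edges n) \<and>
     (\<forall>e\<in>tree_edges n. distr M borel (U e) = uniform_measure lborel {0..1})"

text \<open>In the deterministic definitions below, \<open>u\<close> is a realisation of the edge variables.\<close>

definition vertex_label :: "real \<Rightarrow> (nat list \<Rightarrow> real) \<Rightarrow> nat list \<Rightarrow> real" where
  "vertex_label p u v = (if v = [] then p else u v)"

text \<open>
  The vertices on the path from the root to \<open>v\<close> are \<open>take k v\<close> for \<open>k = 0, \<dots>, length v\<close>.
\<close>

definition temporal_tree :: "nat \<Rightarrow> real \<Rightarrow> (nat list \<Rightarrow> real) \<Rightarrow> nat list set" where
  "temporal_tree n p u =
     {v \<in> tree_vertices n.
        \<forall>k<length v. vertex_label p u (take (Suc k) v) < vertex_label p u (take k v)}"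

definition subtree_at :: "nat list set \<Rightarrow> nat list \<Rightarrow> nat list set" where
  "subtree_at T v = {w \<in> T. prefix v w}"

definition root_children :: "nat list set \<Rightarrow> nat list set" where
  "root_children T = {v \<in> T. length v = 1}"

text \<open>
  The child of the root with the \<open>i\<close>-th largest label (\<open>i \<ge> 1\<close>). It is uniquely determined
  whenever \<open>i \<le> card (root_children T)\<close> and the labels of the children are pairwise distinct;
  ties have probability zero under \<open>uniform_edge_variables\<close>.
\<close>

definition ranked_child :: "nat list set \<Rightarrow> (nat list \<Rightarrow> real) \<Rightarrow> nat \<Rightarrow> nat list" where
  "ranked_child T u i =
     (THE v. v \<in> root_children T \<and> card {w \<in> root_children T. u v \<le> u w} = i)"

definition ranked_subtree :: "nat list set \<Rightarrow> (nat list \<Rightarrow> real) \<Rightarrow> nat \<Rightarrow> nat list set" where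
  "ranked_subtree T u i =
     (if i \<le> card (root_children T) then subtree_at T (ranked_child T u i) else {})"

text \<open>
  Weak convergence of measures on the Borel sets of a topological space: convergence of the
  integrals of all bounded continuous functions. For laws on the real line the library provides
  \<open>weak_conv_m\<close>; this version is used for laws on the finite power \<open>powertop_real I\<close>
  of the real line, whose points are the extensional functions on \<open>I\<close>.
\<close>

definition weak_conv_in ::
    "'a topology \<Rightarrow> (nat \<Rightarrow> 'a measure) \<Rightarrow> 'a measure \<Rightarrow> bool" where
  "weak_conv_in X \<mu> \<nu> \<longleftrightarrow>
     (\<forall>f. continuous_map X euclideanreal f \<and> bounded (f ` topspace X) \<longrightarrow>
        (\<lambda>n. \<integral>x. f x \<partial>\<mu> n) \<longlonglongrightarrow> (\<integral>x. f x \<partial>\<nu>))"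

definition exponential_uniform_family ::
    "'b measure \<Rightarrow> (nat \<Rightarrow> 'b \<Rightarrow> real) \<Rightarrow> (nat \<Rightarrow> 'b \<Rightarrow> real) \<Rightarrow> bool" where
  "exponential_uniform_family N E V \<longleftrightarrow>
     prob_space N \<and>
     prob_space.indep_vars N (\<lambda>_. borel) (case_sum E V) ({1..} <+> {1..}) \<and>
     (\<forall>k\<ge>1. distr N borel (E k) = density lborel (exponential_density 1)) \<and>
     (\<forall>k\<ge>1. distr N borel (V k) = uniform_measure lborel {0..1})"

end

theory Submission
  imports Defs
begin

text \<open>
  The proof rests on the self-similarity of the tree. The \<open>n\<close> branches at the root are
  independent and identically distributed. A branch whose top label is \<open>x < p\<close> contributes a copy
  of the tree started from the label \<open>x\<close>, and a branch whose top label is at least \<open>p\<close> is cut off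
  (\<open>temporal_tree_decompose\<close>, \<open>distr_branches\<close>, \<open>nn_integral_marked_vertex_tree\<close>).

  \<^bold>\<open>Mean.\<close> By self-similarity, the probability that a vertex at depth \<open>k\<close> is kept is the integral
  over \<open>x \<in> [0, p]\<close> of the same probability at depth \<open>k - 1\<close> with \<open>x\<close> in place of \<open>p\<close>; hence it
  is \<open>p ^ k / k!\<close>. There are \<open>n ^ k\<close> such vertices, and the exponential series appears
  (\<open>mean_size_temporal_tree\<close>).

  \<^bold>\<open>Size.\<close> Let \<open>\<phi> x\<close> be the expectation of \<open>exp (- s \<sigma>)\<close>, where \<open>\<sigma>\<close> is the size of the tree started
  from \<open>x\<close>. Independence of the branches gives \<open>\<phi> x = exp (- s) * F x ^ n\<close>, where \<open>1 - F x\<close> is the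
  integral of \<open>1 - \<phi>\<close> over \<open>[0, x]\<close> (\<open>mean_weight_recursion\<close>). Differentiation shows that the odds
  \<open>R = (1 - \<phi>) / \<phi>\<close> satisfy \<open>R' = n R / F\<close>. If \<open>F\<close> were equal to 1, this would be the logistic
  equation of the Yule process and \<open>R x\<close> would be \<open>(exp s - 1) exp (n x)\<close>. The mean gives
  \<open>1 - \<phi> x \<le> s exp (n x)\<close>, hence \<open>1 - F x \<le> s exp (n x) / n\<close>, so that the error is of
  relative order \<open>1 / n\<close> as long as \<open>s exp (n x)\<close> stays bounded (\<open>logistic_odds_bounds\<close>). For
  \<open>s = \<lambda> exp (- n p)\<close> and \<open>x = p\<close> the odds tend to \<open>\<lambda>\<close>, and \<open>\<phi> p\<close> tends to \<open>1 / (1 + \<lambda>)\<close>, the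
  Laplace transform of the exponential law.

  \<^bold>\<open>Ranked subtrees.\<close> Rotating the labels modulo 1 so that \<open>p\<close> is moved to 1 preserves the uniform
  law and the order of the labels below \<open>p\<close>, and ranks the cut branches, whose size counts as 0,
  below all the others. The sizes are then the marks of the largest among \<open>n\<close> independent uniform
  labels. The largest of \<open>k\<close> uniform labels on \<open>[0, a]\<close> is distributed as \<open>a V powr (1 / k)\<close> with
  \<open>V\<close> uniform, and the other labels are again uniform below it. Removing one label after another
  gives a recursion for the joint Laplace transform of the marks (\<open>nn_integral_top_product\<close>). Since
  \<open>n (1 - V powr (1 / n))\<close> tends to \<open>- ln V\<close>, and lowering a label by \<open>t / n\<close> multiplies the size
  of the tree by \<open>exp (- t)\<close>, each removal yields one independent uniform factor in the limit
  (\<open>top_marks_limit\<close>); the transform of the limit vector satisfies the limiting recursion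
  (\<open>laplace_weighted_sum\<close>).

  Convergence of Laplace transforms at integer arguments is turned into weak convergence by the
  Stone-Weierstrass theorem in the variables \<open>exp (- y\<^sub>i)\<close>, with bounded means controlling the
  tails (\<open>laplace_transforms_imp_weak_convergence\<close>).
\<close>

section \<open>Laplace transforms and weak convergence\<close>

text \<open>
  Points of a finite power of the real line are extensional functions on \<open>I\<close>. Filling up with
  zeros embeds this power into the type of all functions, where the type class topology and the
  Stone-Weierstrass theorem apply.
\<close>

definition zero_extend :: "'i set \<Rightarrow> ('i \<Rightarrow> real) \<Rightarrow> 'i \<Rightarrow> real" where
  "zero_extend I x = (\<lambda>i. if i \<in> I then x i else 0)"

text \<open>
  The monomials \<open>\<Prod>i\<in>I. x i ^ k i\<close> become the functions \<open>exp (- \<Sum>i\<in>I. k i * y i)\<close> under the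
  substitution \<open>x i = exp (- y i)\<close>. Closure under addition only is built in, because convergence of
  expectations passes to sums but not to products; \<open>polynomials_on_mult\<close> supplies the algebra.
\<close>

inductive_set polynomials_on :: "nat set \<Rightarrow> ((nat \<Rightarrow> real) \<Rightarrow> real) set" for I where
  monomial: "(\<lambda>x. c * (\<Prod>i\<in>I. x i ^ k i)) \<in> polynomials_on I"
| add: "f \<in> polynomials_on I \<Longrightarrow> g \<in> polynomials_on I \<Longrightarrow> (\<lambda>x. f x + g x) \<in> polynomials_on I"

lemma polynomials_on_mult:
  assumes "f \<in> polynomials_on I" "g \<in> polynomials_on I"
  shows "(\<lambda>x. f x * g x) \<in> polynomials_on I"
  using assms
proof (induction f rule: polynomials_on.induct)
  case (monomial c k)
  from monomial show ?case
  proof (induction g rule: polynomials_on.induct)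
    case (monomial d l)
    have *: "(\<lambda>x. (c * (\<Prod>i\<in>I. x i ^ k i)) * (d * (\<Prod>i\<in>I. x i ^ l i))) =
        (\<lambda>x. (c * d) * (\<Prod>i\<in>I. x i ^ (k i + l i)))"
      by (simp add: power_add prod.distrib mult_ac)
    show ?case unfolding * by (rule polynomials_on.monomial)
  next
    case (add f g)
    then show ?case by (simp add: distrib_left polynomials_on.add)
  qed
next
  case (add f g)
  then show ?case by (simp add: distrib_right polynomials_on.add)
qed

lemma polynomials_on_continuous:
  assumes "f \<in> polynomials_on I"
  shows "continuous_on UNIV f"
  using assms
proof (induction rule: polynomials_on.induct)
  case (monomial c k)
  have "continuous_on UNIV (\<lambda>x :: nat \<Rightarrow> real. x i ^ k i)" for i
    by (rule continuous_on_power, rule continuous_on_product_coordinates)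
  then have "continuous_on UNIV (\<lambda>x :: nat \<Rightarrow> real. \<Prod>i\<in>I. x i ^ k i)"
    by (rule continuous_on_prod)
  then show ?case
    by (rule continuous_on_mult_left)
next
  case (add f g)
  from add.IH show ?case by (rule continuous_on_add)
qed

definition unit_cube :: "nat set \<Rightarrow> (nat \<Rightarrow> real) set" where
  "unit_cube I = (\<Pi>\<^sub>E i\<in>UNIV. if i \<in> I then {0..1} else {0})"

lemma zero_extend_in_unit_cube:
  "(\<And>i. i \<in> I \<Longrightarrow> 0 \<le> x i \<and> x i \<le> 1) \<Longrightarrow> zero_extend I x \<in> unit_cube I"
  unfolding unit_cube_def zero_extend_def by (rule PiE_I) simp_all

lemma compact_unit_cube: "compact (unit_cube I)"
proof -
  have "compactin euclidean (if i \<in> I then {0..1} else {0 :: real})" for i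
    by (simp add: compactin_euclidean_iff)
  then have "compactin (product_topology (\<lambda>i. euclidean) UNIV) (unit_cube I)"
    unfolding unit_cube_def compactin_PiE by blast
  then show ?thesis unfolding euclidean_product_topology compactin_euclidean_iff .
qed

lemma polynomial_approximation_on_unit_cube:
  assumes "finite I" "continuous_on UNIV h" "e > 0"
  shows "\<exists>g\<in>polynomials_on I. \<forall>x\<in>unit_cube I. \<bar>h x - g x\<bar> < e"
proof -
  interpret function_ring_on "polynomials_on I" "unit_cube I"
  proof
    show "compact (unit_cube I)" by (rule compact_unit_cube)
    show "continuous_on (unit_cube I) f" if "f \<in> polynomials_on I" for f
      using polynomials_on_continuous[OF that] continuous_on_subset by blast
    show "(\<lambda>_. c) \<in> polynomials_on I" for c
      using polynomials_on.monomial[of c "\<lambda>_. 0" I] by simp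
    show "\<exists>f\<in>polynomials_on I. f x \<noteq> f y"
      if xy: "x \<in> unit_cube I" "y \<in> unit_cube I" "x \<noteq> y" for x y
    proof -
      obtain i where i: "x i \<noteq> y i" using xy(3) by auto
      have "x i = y i" if "i \<notin> I" for i
        using xy(1,2)[unfolded unit_cube_def, THEN PiE_mem, of i] that by simp
      then have "i \<in> I" using i by auto
      have *: "(\<Prod>j\<in>I. z j ^ (if j = i then 1 else 0)) = z i" for z :: "nat \<Rightarrow> real"
        using \<open>i \<in> I\<close> \<open>finite I\<close> by (subst prod.remove[of _ i]) auto
      have "(\<lambda>z. 1 * (\<Prod>j\<in>I. z j ^ (if j = i then 1 else 0))) \<in> polynomials_on I"
        by (rule polynomials_on.monomial)
      then show ?thesis
        by (rule bexI[rotated]) (simp only: * mult_1 i not_False_eq_True)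
    qed
  qed (fact polynomials_on.add polynomials_on_mult)+
  show ?thesis
    using Stone_Weierstrass_basic[of h e] assms continuous_on_subset by blast
qed

lemma borel_measurable_zero_extend:
  fixes f :: "(nat \<Rightarrow> real) \<Rightarrow> real"
  assumes "continuous_on UNIV f" "\<And>i. i \<in> I \<Longrightarrow> (\<lambda>\<omega>. Y \<omega> i) \<in> borel_measurable M"
  shows "(\<lambda>\<omega>. f (zero_extend I (Y \<omega>))) \<in> borel_measurable M"
proof -
  have "(\<lambda>\<omega>. zero_extend I (Y \<omega>)) \<in> M \<rightarrow>\<^sub>M PiM UNIV (\<lambda>i::nat. borel::real measure)"
  proof (rule measurable_PiM_single')
    show "(\<lambda>\<omega>. zero_extend I (Y \<omega>) i) \<in> borel_measurable M" for i
      using assms(2)[of i] by (cases "i \<in> I") (simp_all add: zero_extend_def)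
  qed (simp add: space_PiM)
  then have "(\<lambda>\<omega>. zero_extend I (Y \<omega>)) \<in> M \<rightarrow>\<^sub>M borel"
    by (subst (asm) measurable_cong_sets[OF refl sets_PiM_equal_borel])
  then show ?thesis
    using borel_measurable_continuous_onI[OF assms(1)] measurable_compose by blast
qed

text \<open>
  The function \<open>y \<mapsto> f (min y K)\<close> is a continuous function of the variables \<open>exp (- y i)\<close> on
  the whole closed cube, since truncation at \<open>K\<close> keeps the logarithm away from 0; it can therefore be
  approximated by a polynomial \<open>g\<close> in these variables. Truncation is felt only if some \<open>Y i\<close> exceeds
  \<open>K\<close>, and on that event the sum of the \<open>Y i\<close> is at least \<open>K\<close>, which bounds its contribution by the
  means.
\<close>

lemma (in prob_space) laplace_truncation_error:
  fixes f :: "(nat \<Rightarrow> real) \<Rightarrow> real" and Y :: "'a \<Rightarrow> nat \<Rightarrow> real"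
  assumes I: "finite I"
    and meas: "\<And>i. i \<in> I \<Longrightarrow> (\<lambda>\<omega>. Y \<omega> i) \<in> borel_measurable M"
    and nonneg: "\<And>i. i \<in> I \<Longrightarrow> AE \<omega> in M. 0 \<le> Y \<omega> i"
    and mean: "\<And>i. i \<in> I \<Longrightarrow> (\<integral>\<^sup>+\<omega>. ennreal (Y \<omega> i) \<partial>M) \<le> ennreal C"
    and f: "continuous_on UNIV f" "\<And>x. \<bar>f x\<bar> \<le> B"
    and g: "g \<in> polynomials_on I" and K: "K > 0" and C: "C \<ge> 0"
    and approx: "\<And>z. z \<in> unit_cube I \<Longrightarrow>
          \<bar>f (zero_extend I (\<lambda>i. - ln (max (z i) (exp (- K))))) - g z\<bar> \<le> e"
  shows "\<bar>(\<integral>\<omega>. f (zero_extend I (Y \<omega>)) \<partial>M) -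
          (\<integral>\<omega>. g (zero_extend I (\<lambda>i. exp (- Y \<omega> i))) \<partial>M)\<bar> \<le> 2 * B * real (card I) * C / K + e"
proof -
  let ?Z = "\<lambda>\<omega>. zero_extend I (\<lambda>i. exp (- Y \<omega> i))"
  have B: "B \<ge> 0" using f(2)[of undefined] by linarith
  have AE_nonneg: "AE \<omega> in M. \<forall>i\<in>I. 0 \<le> Y \<omega> i"
    using nonneg I by (simp add: AE_finite_all)
  have int_Y: "integrable M (\<lambda>\<omega>. Y \<omega> i)" and mean_Y: "expectation (\<lambda>\<omega>. Y \<omega> i) \<le> C"
    if "i \<in> I" for i
  proof -
    have "(\<integral>\<^sup>+\<omega>. ennreal (Y \<omega> i) \<partial>M) < \<infinity>"
      using mean[OF that] by (simp add: order_le_less_trans)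
    then show *: "integrable M (\<lambda>\<omega>. Y \<omega> i)"
      by (intro integrableI_nonneg meas nonneg that) auto
    have "ennreal (expectation (\<lambda>\<omega>. Y \<omega> i)) \<le> ennreal C"
      using mean[OF that] nn_integral_eq_integral[OF * nonneg[OF that]] by simp
    then show "expectation (\<lambda>\<omega>. Y \<omega> i) \<le> C" using C by simp
  qed
  have measf: "(\<lambda>\<omega>. f (zero_extend I (Y \<omega>))) \<in> borel_measurable M"
    by (rule borel_measurable_zero_extend[OF f(1) meas])
  have measg: "(\<lambda>\<omega>. g (?Z \<omega>)) \<in> borel_measurable M"
    by (rule borel_measurable_zero_extend[OF polynomials_on_continuous[OF g]])
       (use meas in measurable)
  have bound: "AE \<omega> in M. \<bar>f (zero_extend I (Y \<omega>)) - g (?Z \<omega>)\<bar> \<le> 2 * B / K * (\<Sum>i\<in>I. Y \<omega> i) + e"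
    using AE_nonneg
  proof eventually_elim
    case (elim \<omega>)
    have cube: "?Z \<omega> \<in> unit_cube I"
      by (rule zero_extend_in_unit_cube) (use elim in auto)
    have eq: "zero_extend I (\<lambda>i. - ln (max (?Z \<omega> i) (exp (- K)))) =
        zero_extend I (\<lambda>i. min (Y \<omega> i) K)"
      by (auto simp: zero_extend_def fun_eq_iff max_def min_def)
    have *: "\<bar>f (zero_extend I (\<lambda>i. min (Y \<omega> i) K)) - g (?Z \<omega>)\<bar> \<le> e"
      using approx[OF cube] unfolding eq .
    have "\<bar>f (zero_extend I (Y \<omega>)) - f (zero_extend I (\<lambda>i. min (Y \<omega> i) K))\<bar>
        \<le> 2 * B / K * (\<Sum>i\<in>I. Y \<omega> i)"
    proof (cases "\<forall>i\<in>I. Y \<omega> i \<le> K")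
      case True
      then have "zero_extend I (\<lambda>i. min (Y \<omega> i) K) = zero_extend I (Y \<omega>)"
        by (auto simp: zero_extend_def fun_eq_iff)
      then show ?thesis using elim B K by (auto intro!: divide_nonneg_nonneg mult_nonneg_nonneg sum_nonneg)
    next
      case False
      then obtain i where i: "i \<in> I" "K \<le> Y \<omega> i" by auto
      have "K \<le> (\<Sum>i\<in>I. Y \<omega> i)"
        using i(2) member_le_sum[OF i(1), of "Y \<omega>"] I elim by force
      then have "2 * B * 1 \<le> 2 * B * ((\<Sum>i\<in>I. Y \<omega> i) / K)"
        using B K by (intro mult_left_mono) auto
      moreover have "\<bar>f (zero_extend I (Y \<omega>)) - f (zero_extend I (\<lambda>i. min (Y \<omega> i) K))\<bar> \<le> 2 * B"
        using f(2)[of "zero_extend I (Y \<omega>)"] f(2)[of "zero_extend I (\<lambda>i. min (Y \<omega> i) K)"] by linarith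
      ultimately show ?thesis by simp
    qed
    with * show ?case by linarith
  qed
  have intf: "integrable M (\<lambda>\<omega>. f (zero_extend I (Y \<omega>)))"
    by (rule integrable_const_bound[of _ B]) (use f measf in auto)
  have intS: "integrable M (\<lambda>\<omega>. 2 * B / K * (\<Sum>i\<in>I. Y \<omega> i) + e)"
    using int_Y by auto
  have intd: "integrable M (\<lambda>\<omega>. f (zero_extend I (Y \<omega>)) - g (?Z \<omega>))"
    by (rule Bochner_Integration.integrable_bound[OF intS])
       (use measf measg bound in auto)
  then have intg: "integrable M (\<lambda>\<omega>. g (?Z \<omega>))"
    using Bochner_Integration.integrable_diff[OF intf intd] by simp
  have "\<bar>(\<integral>\<omega>. f (zero_extend I (Y \<omega>)) \<partial>M) - (\<integral>\<omega>. g (?Z \<omega>) \<partial>M)\<bar> =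
      \<bar>(\<integral>\<omega>. f (zero_extend I (Y \<omega>)) - g (?Z \<omega>) \<partial>M)\<bar>"
    using intf intg by simp
  also have "\<dots> \<le> (\<integral>\<omega>. \<bar>f (zero_extend I (Y \<omega>)) - g (?Z \<omega>)\<bar> \<partial>M)"
    by (rule integral_abs_bound)
  also have "\<dots> \<le> (\<integral>\<omega>. 2 * B / K * (\<Sum>i\<in>I. Y \<omega> i) + e \<partial>M)"
    by (intro integral_mono_AE intS bound integrable_abs intd)
  also have "\<dots> = 2 * B / K * (\<Sum>i\<in>I. \<integral>\<omega>. Y \<omega> i \<partial>M) + e"
    using int_Y by (simp add: Bochner_Integration.integral_sum prob_space)
  also have "\<dots> \<le> 2 * B / K * (\<Sum>i\<in>I. C) + e"
    by (intro add_right_mono mult_left_mono sum_mono mean_Y) (use B K in auto)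
  finally show ?thesis by (simp add: mult.assoc)
qed

lemma (in prob_space) integrable_laplace:
  fixes Y :: "'a \<Rightarrow> 'i \<Rightarrow> real"
  assumes "finite I" and meas: "\<And>i. i \<in> I \<Longrightarrow> (\<lambda>\<omega>. Y \<omega> i) \<in> borel_measurable M"
    and nonneg: "\<And>i. i \<in> I \<Longrightarrow> AE \<omega> in M. 0 \<le> Y \<omega> i"
  shows "integrable M (\<lambda>\<omega>. exp (- (\<Sum>i\<in>I. real (k i) * Y \<omega> i)))"
proof -
  have "AE \<omega> in M. \<forall>i\<in>I. 0 \<le> Y \<omega> i"
    using nonneg assms(1) by (simp add: AE_finite_all)
  then have "AE \<omega> in M. norm (exp (- (\<Sum>i\<in>I. real (k i) * Y \<omega> i))) \<le> 1"
    by eventually_elim (auto intro!: sum_nonneg)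
  then show ?thesis
    by (rule integrable_const_bound) (use meas in measurable)
qed

text \<open>
  One polynomial approximation serves all \<open>M n\<close> and \<open>N\<close> at the same time, because the error bound of
  \<open>laplace_truncation_error\<close> involves nothing but the common bound \<open>C\<close> on the means.
\<close>

theorem laplace_transforms_imp_weak_convergence:
  fixes M :: "nat \<Rightarrow> 'a measure" and N :: "'b measure"
    and Y :: "nat \<Rightarrow> 'a \<Rightarrow> nat \<Rightarrow> real" and Y' :: "'b \<Rightarrow> nat \<Rightarrow> real"
    and f :: "(nat \<Rightarrow> real) \<Rightarrow> real"
  assumes I: "finite I" and prob: "\<And>n. prob_space (M n)" "prob_space N"
    and meas: "\<And>n i. i \<in> I \<Longrightarrow> (\<lambda>\<omega>. Y n \<omega> i) \<in> borel_measurable (M n)"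
      "\<And>i. i \<in> I \<Longrightarrow> (\<lambda>\<omega>. Y' \<omega> i) \<in> borel_measurable N"
    and nonneg: "\<And>n i. i \<in> I \<Longrightarrow> AE \<omega> in M n. 0 \<le> Y n \<omega> i"
      "\<And>i. i \<in> I \<Longrightarrow> AE \<omega> in N. 0 \<le> Y' \<omega> i"
    and mean: "\<And>n i. i \<in> I \<Longrightarrow> (\<integral>\<^sup>+\<omega>. ennreal (Y n \<omega> i) \<partial>M n) \<le> ennreal C"
      "\<And>i. i \<in> I \<Longrightarrow> (\<integral>\<^sup>+\<omega>. ennreal (Y' \<omega> i) \<partial>N) \<le> ennreal C"
    and laplace: "\<And>k. (\<lambda>n. \<integral>\<omega>. exp (- (\<Sum>i\<in>I. real (k i) * Y n \<omega> i)) \<partial>M n)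
        \<longlonglongrightarrow> (\<integral>\<omega>. exp (- (\<Sum>i\<in>I. real (k i) * Y' \<omega> i)) \<partial>N)"
    and f: "continuous_on UNIV f" "bounded (range f)" and C: "C \<ge> 0"
  shows "(\<lambda>n. \<integral>\<omega>. f (zero_extend I (Y n \<omega>)) \<partial>M n) \<longlonglongrightarrow> (\<integral>\<omega>. f (zero_extend I (Y' \<omega>)) \<partial>N)"
proof -
  obtain B where B: "\<And>x. \<bar>f x\<bar> \<le> B" "B > 0"
    using f(2) unfolding bounded_pos by auto
  have polyconv: "integrable N (\<lambda>\<omega>. g (zero_extend I (\<lambda>i. exp (- Y' \<omega> i)))) \<and>
     (\<forall>n. integrable (M n) (\<lambda>\<omega>. g (zero_extend I (\<lambda>i. exp (- Y n \<omega> i))))) \<and>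
     (\<lambda>n. \<integral>\<omega>. g (zero_extend I (\<lambda>i. exp (- Y n \<omega> i))) \<partial>M n)
        \<longlonglongrightarrow> (\<integral>\<omega>. g (zero_extend I (\<lambda>i. exp (- Y' \<omega> i))) \<partial>N)"
    if "g \<in> polynomials_on I" for g
    using that
  proof induction
    case (monomial c k)
    have *: "(\<Prod>i\<in>I. zero_extend I (\<lambda>i. exp (- y i)) i ^ k i) = exp (- (\<Sum>i\<in>I. real (k i) * y i))"
      for y :: "nat \<Rightarrow> real"
    proof -
      have "(\<Prod>i\<in>I. zero_extend I (\<lambda>i. exp (- y i)) i ^ k i) = (\<Prod>i\<in>I. exp (real (k i) * - y i))"
        by (intro prod.cong refl) (simp only: zero_extend_def exp_of_nat_mult if_True)
      also have "\<dots> = exp (\<Sum>i\<in>I. real (k i) * - y i)" by (simp only: exp_sum[OF I])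
      finally show ?thesis by (simp add: sum_negf)
    qed
    show ?case unfolding *
      using prob_space.integrable_laplace[OF prob(1) I meas(1) nonneg(1)]
        prob_space.integrable_laplace[OF prob(2) I meas(2) nonneg(2)]
      by (auto intro!: tendsto_mult_left laplace)
  next
    case (add f g)
    then show ?case by (auto intro!: tendsto_add)
  qed
  show ?thesis
  proof (rule LIMSEQ_I)
    fix r :: real assume r: "r > 0"
    (* This choice makes the tail term 2 B |I| C / K at most r / 8. *)
    define K where "K = 1 + 16 * B * real (card I) * C / r"
    have K: "K > 0" unfolding K_def using B r C by (auto intro!: add_pos_nonneg)
    have Ke: "2 * B * real (card I) * C / K \<le> r / 8"
      using K r B C unfolding K_def by (simp add: field_simps)
    define h where "h z = f (zero_extend I (\<lambda>i. - ln (max (z i) (exp (- K)))))" for z :: "nat \<Rightarrow> real"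
    have max_exp_nonzero: "max x (exp (- K)) \<noteq> 0" for x :: real
      using exp_gt_zero[of "- K"] by (auto simp: max_def)
    have "continuous_on UNIV (\<lambda>z i. zero_extend I (\<lambda>i. - ln (max (z i) (exp (- K)))) i)"
    proof (rule continuous_on_coordinatewise_then_product)
      fix i
      have "continuous_on UNIV (\<lambda>z :: nat \<Rightarrow> real. - ln (max (z i) (exp (- K))))"
        by (intro continuous_on_minus continuous_on_ln continuous_on_max continuous_on_const)
           (simp_all add: max_exp_nonzero continuous_on_product_coordinates)
      then show "continuous_on UNIV (\<lambda>z. zero_extend I (\<lambda>i. - ln (max (z i) (exp (- K)))) i)"
        by (cases "i \<in> I") (simp_all add: zero_extend_def)
    qed
    then have "continuous_on UNIV h"
      unfolding h_def by (auto intro: continuous_on_compose2[OF f(1)])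
    then obtain g where g: "g \<in> polynomials_on I" "\<And>z. z \<in> unit_cube I \<Longrightarrow> \<bar>h z - g z\<bar> < r / 8"
      using polynomial_approximation_on_unit_cube[OF I, of h "r / 8"] r by auto
    have approx: "\<bar>f (zero_extend I (\<lambda>i. - ln (max (z i) (exp (- K))))) - g z\<bar> \<le> r / 8"
      if "z \<in> unit_cube I" for z
      using g(2)[OF that] unfolding h_def by simp
    have "\<bar>(\<integral>\<omega>. f (zero_extend I (Y n \<omega>)) \<partial>M n) -
          (\<integral>\<omega>. g (zero_extend I (\<lambda>i. exp (- Y n \<omega> i))) \<partial>M n)\<bar>
        \<le> 2 * B * real (card I) * C / K + r / 8" for n
      by (rule prob_space.laplace_truncation_error
          [OF prob(1) I meas(1) nonneg(1) mean(1) f(1) B(1) g(1) K C approx])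
    then have err: "\<bar>(\<integral>\<omega>. f (zero_extend I (Y n \<omega>)) \<partial>M n) -
          (\<integral>\<omega>. g (zero_extend I (\<lambda>i. exp (- Y n \<omega> i))) \<partial>M n)\<bar> \<le> r / 4" for n
      by (rule order_trans) (use Ke in linarith)
    have "\<bar>(\<integral>\<omega>. f (zero_extend I (Y' \<omega>)) \<partial>N) -
          (\<integral>\<omega>. g (zero_extend I (\<lambda>i. exp (- Y' \<omega> i))) \<partial>N)\<bar>
        \<le> 2 * B * real (card I) * C / K + r / 8"
      by (rule prob_space.laplace_truncation_error
          [OF prob(2) I meas(2) nonneg(2) mean(2) f(1) B(1) g(1) K C approx])
    with Ke have err': "\<bar>(\<integral>\<omega>. f (zero_extend I (Y' \<omega>)) \<partial>N) -
          (\<integral>\<omega>. g (zero_extend I (\<lambda>i. exp (- Y' \<omega> i))) \<partial>N)\<bar> \<le> r / 4"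
      by linarith
    obtain n0 where n0: "\<And>n. n \<ge> n0 \<Longrightarrow>
        \<bar>(\<integral>\<omega>. g (zero_extend I (\<lambda>i. exp (- Y n \<omega> i))) \<partial>M n)
          - (\<integral>\<omega>. g (zero_extend I (\<lambda>i. exp (- Y' \<omega> i))) \<partial>N)\<bar> < r / 4"
      using LIMSEQ_D[OF polyconv[OF g(1), THEN conjunct2, THEN conjunct2], of "r / 4"] r by auto
    show "\<exists>no. \<forall>n\<ge>no. norm ((\<integral>\<omega>. f (zero_extend I (Y n \<omega>)) \<partial>M n)
        - (\<integral>\<omega>. f (zero_extend I (Y' \<omega>)) \<partial>N)) < r"
    proof (intro exI allI impI)
      fix n assume "n \<ge> n0"
      from n0[OF this] err[of n] err' r
      show "norm ((\<integral>\<omega>. f (zero_extend I (Y n \<omega>)) \<partial>M n)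
        - (\<integral>\<omega>. f (zero_extend I (Y' \<omega>)) \<partial>N)) < r" unfolding real_norm_def by linarith
    qed
  qed
qed

section \<open>Order statistics of marked uniform variables\<close>

abbreviation unif :: "real measure" where
  "unif \<equiv> uniform_measure lborel {0..1}"

lemma prob_space_unif: "prob_space unif"
  by (rule prob_space_uniform_measure) auto

lemma nn_integral_unif:
  assumes "f \<in> borel_measurable borel"
  shows "(\<integral>\<^sup>+x. f x \<partial>unif) = (\<integral>\<^sup>+x. f x * indicator {0..1} x \<partial>lborel)"
  using assms by (subst nn_integral_uniform_measure) (auto simp: divide_ennreal_def)

text \<open>
  The same unique description as in \<open>ranked_child\<close>, for an arbitrary finite set of labelled points.
\<close>

definition ranked :: "'i set \<Rightarrow> ('i \<Rightarrow> real) \<Rightarrow> nat \<Rightarrow> 'i" where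
  "ranked A x i = (THE v. v \<in> A \<and> card {w \<in> A. x v \<le> x w} = i)"

lemma ranked_cong:
  assumes "\<And>v. v \<in> A \<Longrightarrow> x v = y v"
  shows "ranked A x i = ranked A y i"
proof -
  have "(v \<in> A \<and> card {w \<in> A. x v \<le> x w} = i) \<longleftrightarrow> (v \<in> A \<and> card {w \<in> A. y v \<le> y w} = i)" for v
    using assms by (auto intro!: arg_cong[where f = card])
  then show ?thesis unfolding ranked_def by presburger
qed

lemma ranked_first:
  assumes "j \<in> A" "\<And>v. v \<in> A \<Longrightarrow> v \<noteq> j \<Longrightarrow> x v < x j" "finite A"
  shows "ranked A x (Suc 0) = j"
  unfolding ranked_def
proof (rule the_equality)
  have "{w \<in> A. x j \<le> x w} = {j}" using assms(1,2) by force
  then show "j \<in> A \<and> card {w \<in> A. x j \<le> x w} = Suc 0" using assms(1) by simp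
next
  fix v assume v: "v \<in> A \<and> card {w \<in> A. x v \<le> x w} = Suc 0"
  then obtain b where "{w \<in> A. x v \<le> x w} = {b}" by (auto simp: card_Suc_eq)
  moreover have "v \<in> {w \<in> A. x v \<le> x w}" "j \<in> {w \<in> A. x v \<le> x w}"
    using v assms(1) assms(2)[of v] by (auto, cases "v = j") (auto simp: less_imp_le)
  ultimately show "v = j" by auto
qed

lemma ranked_remove_first:
  assumes "j \<in> A" "\<And>v. v \<in> A \<Longrightarrow> v \<noteq> j \<Longrightarrow> x v < x j" "finite A" "i \<ge> 1"
  shows "ranked A x (Suc i) = ranked (A - {j}) x i"
proof -
  have "(v \<in> A \<and> card {w \<in> A. x v \<le> x w} = Suc i) \<longleftrightarrow>
      (v \<in> A - {j} \<and> card {w \<in> A - {j}. x v \<le> x w} = i)" for v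
  proof (cases "v \<in> A \<and> v \<noteq> j")
    case True
    then have "{w \<in> A. x v \<le> x w} = insert j {w \<in> A - {j}. x v \<le> x w}"
      using assms(1,2) by force
    then show ?thesis using True assms(3) by simp
  next
    case False
    moreover have "{w \<in> A. x j \<le> x w} = {j}" using assms(1,2) by force
    ultimately show ?thesis using assms(4) by auto
  qed
  then show ?thesis unfolding ranked_def by presburger
qed

text \<open>
  The number of points with label at least \<open>x v\<close> is strictly decreasing in \<open>x v\<close>, so it maps \<open>A\<close>
  injectively into \<open>{1..card A}\<close>, and by counting onto it.
\<close>

lemma ranked_exists1:
  fixes x :: "'i \<Rightarrow> real"
  assumes "finite A" "inj_on x A" "1 \<le> i" "i \<le> card A"
  shows "\<exists>!v. v \<in> A \<and> card {w \<in> A. x v \<le> x w} = i"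
proof -
  let ?c = "\<lambda>v. card {w \<in> A. x v \<le> x w}"
  have less: "?c v < ?c v'" if "v \<in> A" "v' \<in> A" "x v' < x v" for v v'
  proof (rule psubset_card_mono)
    show "{w \<in> A. x v \<le> x w} \<subset> {w \<in> A. x v' \<le> x w}"
      using that by (intro psubsetI subsetI) force+
  qed (use assms(1) in simp)
  have inj: "inj_on ?c A"
  proof (rule inj_onI)
    fix v v' assume v: "v \<in> A" "v' \<in> A" and c: "?c v = ?c v'"
    have "x v = x v'"
      using less[OF v] less[OF v(2,1)] c by (metis less_irrefl linorder_less_linear)
    then show "v = v'" using assms(2) v by (simp add: inj_on_def)
  qed
  have "?c ` A \<subseteq> {1..card A}"
  proof safe
    fix v assume v: "v \<in> A"
    have "{v} \<subseteq> {w \<in> A. x v \<le> x w}" "{w \<in> A. x v \<le> x w} \<subseteq> A" using v by auto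
    then show "?c v \<in> {1..card A}"
      using card_mono[of A "{w \<in> A. x v \<le> x w}"] card_mono[of "{w \<in> A. x v \<le> x w}" "{v}"] assms(1)
      by auto
  qed
  then have "?c ` A = {1..card A}"
    by (rule card_subset_eq[rotated]) (simp_all add: card_image[OF inj])
  then obtain v where "v \<in> A" "?c v = i" using assms(3,4) by (metis (no_types, lifting) atLeastAtMost_iff imageE)
  then show ?thesis using inj by (auto simp: inj_on_def)
qed

lemma ranked_properties:
  assumes "finite A" "inj_on x A" "1 \<le> i" "i \<le> card A"
  shows "ranked A x i \<in> A" "card {w \<in> A. x (ranked A x i) \<le> x w} = i"
  using theI'[OF ranked_exists1[OF assms]] unfolding ranked_def by auto

text \<open>
  Ranks are defined by a definite description, which takes an unspecified value when labels are tied.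
  That value, too, is a function of the finite pattern of comparisons between the labels, and any
  function of a random subset of a finite set is measurable.
\<close>

lemma measurable_finite_pattern:
  assumes "finite A" "\<And>v. v \<in> A \<Longrightarrow> Measurable.pred M (P v)"
  shows "(\<lambda>\<omega>. F {v \<in> A. P v \<omega>}) \<in> measurable M (count_space UNIV)"
proof -
  have "(\<lambda>\<omega>. {v \<in> A. P v \<omega>}) \<in> measurable M (count_space (Pow A))"
  proof (subst measurable_count_space_eq2)
    have "(\<lambda>\<omega>. {v \<in> A. P v \<omega>}) -` {S} \<inter> space M \<in> sets M" if "S \<subseteq> A" for S
    proof -
      have "(\<lambda>\<omega>. {v \<in> A. P v \<omega>}) -` {S} \<inter> space M = {\<omega> \<in> space M. \<forall>v\<in>A. P v \<omega> \<longleftrightarrow> v \<in> S}"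
        using that by auto
      also have "\<dots> \<in> sets M"
        using assms by (intro predE pred_intros_finite pred_intros_logic) auto
      finally show ?thesis .
    qed
    then show "(\<lambda>\<omega>. {v \<in> A. P v \<omega>}) \<in> space M \<rightarrow> Pow A \<and>
        (\<forall>S\<in>Pow A. (\<lambda>\<omega>. {v \<in> A. P v \<omega>}) -` {S} \<inter> space M \<in> sets M)" by auto
  qed (use assms in auto)
  then show ?thesis by (rule measurable_compose) simp
qed

lemma measurable_ranked:
  assumes "finite A" "\<And>v. v \<in> A \<Longrightarrow> (\<lambda>\<omega>. x \<omega> v) \<in> borel_measurable M"
  shows "(\<lambda>\<omega>. ranked A (x \<omega>) i) \<in> measurable M (count_space UNIV)"
proof -
  let ?F = "\<lambda>R. THE v. v \<in> A \<and> card {w \<in> A. (v, w) \<in> R} = i"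
  have "(\<lambda>\<omega>. ?F {r \<in> A \<times> A. x \<omega> (fst r) \<le> x \<omega> (snd r)}) \<in> measurable M (count_space UNIV)"
    by (rule measurable_finite_pattern) (use assms in auto)
  moreover have "?F {r \<in> A \<times> A. x \<omega> (fst r) \<le> x \<omega> (snd r)} = ranked A (x \<omega>) i" for \<omega>
    unfolding ranked_def by (rule arg_cong[where f = The]) (auto simp: fun_eq_iff cong: conj_cong)
  ultimately show ?thesis by simp
qed

text \<open>
  This is the expected product of the marks of the \<open>length ls\<close> largest among \<open>k\<close> independent
  uniform labels on \<open>[0, a]\<close>, where \<open>\<psi> l x\<close> is the conditional mean of the mark of type \<open>l\<close> given
  that its label is \<open>x\<close>. The largest label is distributed as \<open>a * root k v\<close> for a uniform \<open>v\<close>.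
\<close>

primrec top_marks :: "('l \<Rightarrow> real \<Rightarrow> ennreal) \<Rightarrow> 'l list \<Rightarrow> nat \<Rightarrow> real \<Rightarrow> ennreal" where
  "top_marks \<psi> [] k a = 1"
| "top_marks \<psi> (l # ls) k a =
     (\<integral>\<^sup>+v. \<psi> l (a * root k v) * top_marks \<psi> ls (k - 1) (a * root k v) \<partial>unif)"

lemma measurable_root[measurable]: "root k \<in> borel_measurable borel"
  by (rule borel_measurable_continuous_onI) (intro continuous_intros continuous_on_id)

lemma measurable_top_marks[measurable]:
  assumes [measurable]: "\<And>l. \<psi> l \<in> borel_measurable borel"
  shows "top_marks \<psi> ls k \<in> borel_measurable borel"
proof (induction ls arbitrary: k)
  case (Cons l ls)
  interpret prob_space unif by (rule prob_space_unif)
  note Cons[measurable]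
  have "(\<lambda>a. \<integral>\<^sup>+v. \<psi> l (a * root k v) * top_marks \<psi> ls (k - 1) (a * root k v) \<partial>unif)
      \<in> borel_measurable borel"
    by measurable
  moreover have "top_marks \<psi> (l # ls) k =
      (\<lambda>a. \<integral>\<^sup>+v. \<psi> l (a * root k v) * top_marks \<psi> ls (k - 1) (a * root k v) \<partial>unif)"
    by (rule ext) simp
  ultimately show ?case by simp
next
  case Nil
  have "top_marks \<psi> [] k = (\<lambda>_. 1)" by (rule ext) simp
  then show ?case by simp
qed

text \<open>
  The substitution \<open>v = (x / a) ^ k\<close> by the distribution function of the maximum of \<open>k\<close> uniform
  variables on \<open>[0, a]\<close>. The factor \<open>x ^ (k - 1)\<close> is the probability that the other \<open>k - 1\<close> labels
  lie below \<open>x\<close>.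
\<close>

lemma substitute_maximum_of_uniforms:
  fixes f :: "real \<Rightarrow> ennreal"
  assumes f[measurable]: "f \<in> borel_measurable borel" and a: "0 < a" "a \<le> 1" and k: "k \<ge> 1"
  shows "of_nat k * (\<integral>\<^sup>+x. indicator {..<a} x * ennreal (x ^ (k - 1)) * f x \<partial>unif) =
    ennreal (a ^ k) * (\<integral>\<^sup>+v. f (a * root k v) \<partial>unif)"
proof -
  have "(\<integral>\<^sup>+v. f (a * root k v) \<partial>unif)
      = (\<integral>\<^sup>+v. f (a * root k v) * indicator {(0 / a) ^ k..(a / a) ^ k} v \<partial>lborel)"
    using a k by (subst nn_integral_unif) (auto simp: power_0_left)
  also have "\<dots> = (\<integral>\<^sup>+x. f (a * root k ((x / a) ^ k)) * ennreal (real k * (x / a) ^ (k - 1) * (1 / a))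
      * indicator {0..a} x \<partial>lborel)"
    by (rule nn_integral_substitution_aux[of "\<lambda>v. f (a * root k v)" 0 a "\<lambda>x. (x / a) ^ k"])
      (use a in \<open>auto intro!: derivative_eq_intros continuous_intros\<close>)
  also have "\<dots> = (\<integral>\<^sup>+x. ennreal (real k / a ^ k) * (ennreal (x ^ (k - 1)) * f x * indicator {0..a} x) \<partial>lborel)"
  proof (intro nn_integral_cong)
    fix x :: real
    show "f (a * root k ((x / a) ^ k)) * ennreal (real k * (x / a) ^ (k - 1) * (1 / a)) * indicator {0..a} x
        = ennreal (real k / a ^ k) * (ennreal (x ^ (k - 1)) * f x * indicator {0..a} x)"
    proof (cases "x \<in> {0..a}")
      case True
      have "a ^ k = a ^ (k - 1) * a" using k by (cases k) auto
      then have "real k * (x / a) ^ (k - 1) * (1 / a) = real k / a ^ k * x ^ (k - 1)"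
        using a by (simp add: power_divide field_simps)
      moreover have "ennreal (real k / a ^ k * x ^ (k - 1)) = ennreal (real k / a ^ k) * ennreal (x ^ (k - 1))"
        using True a by (intro ennreal_mult) auto
      ultimately have "ennreal (real k * (x / a) ^ (k - 1) * (1 / a)) =
          ennreal (real k / a ^ k) * ennreal (x ^ (k - 1))" by simp
      moreover have "a * root k ((x / a) ^ k) = x"
        using True a k by (simp add: real_root_power_cancel)
      ultimately show ?thesis by (simp only: mult_ac)
    qed auto
  qed
  also have "\<dots> = ennreal (real k / a ^ k) * (\<integral>\<^sup>+x. ennreal (x ^ (k - 1)) * f x * indicator {0..a} x \<partial>lborel)"
    by (rule nn_integral_cmult) measurable
  also have "(\<integral>\<^sup>+x. ennreal (x ^ (k - 1)) * f x * indicator {0..a} x \<partial>lborel) =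
      (\<integral>\<^sup>+x. (indicator {..<a} x * ennreal (x ^ (k - 1)) * f x) * indicator {0..1} x \<partial>lborel)"
  proof (rule nn_integral_cong_AE)
    have "AE x in lborel. x \<noteq> a" by (rule AE_lborel_singleton)
    then show "AE x in lborel. ennreal (x ^ (k - 1)) * f x * indicator {0..a} x =
        indicator {..<a} x * ennreal (x ^ (k - 1)) * f x * indicator {0..1} x"
      by eventually_elim (use a in \<open>auto simp: indicator_def\<close>)
  qed
  also have "\<dots> = (\<integral>\<^sup>+x. indicator {..<a} x * ennreal (x ^ (k - 1)) * f x \<partial>unif)"
    by (rule nn_integral_unif[symmetric]) measurable
  finally have "ennreal (a ^ k) * (\<integral>\<^sup>+v. f (a * root k v) \<partial>unif) =
      (ennreal (a ^ k) * ennreal (real k / a ^ k)) *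
      (\<integral>\<^sup>+x. indicator {..<a} x * ennreal (x ^ (k - 1)) * f x \<partial>unif)"
    by (simp add: mult.assoc)
  also have "ennreal (a ^ k) * ennreal (real k / a ^ k) = of_nat k"
    using a by (simp add: ennreal_mult[symmetric] ennreal_of_nat_eq_real_of_nat)
  finally show ?thesis by simp
qed

text \<open>
  A space of labelled objects with uniform label \<open>X\<close> and several types \<open>l\<close> of nonnegative marks
  \<open>g l\<close>; the last assumption says that \<open>\<psi> l\<close> is the conditional mean of the mark given the label.
\<close>

locale marked_uniforms = prob_space K for K :: "'w measure" +
  fixes X :: "'w \<Rightarrow> real" and g :: "'l \<Rightarrow> 'w \<Rightarrow> ennreal" and \<psi> :: "'l \<Rightarrow> real \<Rightarrow> ennreal"
  assumes measurable_label[measurable]: "X \<in> borel_measurable K"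
    and measurable_mark[measurable]: "\<And>l. g l \<in> borel_measurable K"
    and measurable_conditional[measurable]: "\<And>l. \<psi> l \<in> borel_measurable borel"
    and label_distribution: "distr K borel X = unif"
    and conditional_mark: "\<And>h l. h \<in> borel_measurable borel \<Longrightarrow>
      (\<integral>\<^sup>+\<omega>. h (X \<omega>) * g l \<omega> \<partial>K) = (\<integral>\<^sup>+x. h x * \<psi> l x \<partial>unif)"
begin

sublocale product: product_sigma_finite "\<lambda>_ :: nat. K"
  by standard

lemma AE_label_neq: "AE \<omega> in K. X \<omega> \<noteq> c"
proof -
  have "AE x in unif. x \<noteq> c"
  proof (rule AE_uniform_measureI)
    show "AE x in lborel. x \<in> {0..1} \<longrightarrow> x \<noteq> c"
      using AE_lborel_singleton[of c] by eventually_elim simp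
  qed simp
  then show ?thesis
    unfolding label_distribution[symmetric] by (rule AE_distrD[rotated]) simp
qed

lemma AE_label_unit_interval: "AE \<omega> in K. X \<omega> \<in> {0<..1}"
proof -
  have "AE x in unif. x \<in> {0..1}"
    by (rule AE_uniform_measureI) simp_all
  then have "AE \<omega> in K. X \<omega> \<in> {0..1}"
    unfolding label_distribution[symmetric] by (rule AE_distrD[rotated]) simp
  with AE_label_neq[of 0] show ?thesis by eventually_elim auto
qed

lemma AE_labels_distinct:
  fixes I :: "nat set"
  assumes I: "finite I"
  shows "AE \<omega> in PiM I (\<lambda>_. K). inj_on (\<lambda>j. X (\<omega> j)) I"
proof -
  have "AE \<omega> in PiM I (\<lambda>_. K). X (\<omega> i) \<noteq> X (\<omega> j)" if ij: "i \<in> I" "j \<in> I" "i \<noteq> j" for i j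
  proof -
    let ?f = "\<lambda>\<omega>. indicator {0} (X (\<omega> i) - X (\<omega> j)) :: ennreal"
    have I_eq: "insert j (I - {j}) = I" using ij by auto
    have meas_f: "?f \<in> borel_measurable (PiM I (\<lambda>_. K))" using ij by measurable
    have "(\<integral>\<^sup>+\<omega>. ?f \<omega> \<partial>PiM (insert j (I - {j})) (\<lambda>_. K)) =
        (\<integral>\<^sup>+x. \<integral>\<^sup>+y. ?f (x(j := y)) \<partial>K \<partial>PiM (I - {j}) (\<lambda>_. K))"
      using product.product_nn_integral_insert[of "I - {j}" j ?f] I ij meas_f I_eq by simp
    also have "\<dots> = (\<integral>\<^sup>+x. 0 \<partial>PiM (I - {j}) (\<lambda>_. K))"
    proof (intro nn_integral_cong)
      fix x
      have "(\<integral>\<^sup>+y. ?f (x(j := y)) \<partial>K) = (\<integral>\<^sup>+y. 0 \<partial>K)"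
        using AE_label_neq[of "X (x i)"]
        by (intro nn_integral_cong_AE, eventually_elim) (use ij in auto)
      then show "(\<integral>\<^sup>+y. ?f (x(j := y)) \<partial>K) = 0" by simp
    qed
    finally have "(\<integral>\<^sup>+\<omega>. ?f \<omega> \<partial>PiM I (\<lambda>_. K)) = 0" unfolding I_eq by simp
    then have "AE \<omega> in PiM I (\<lambda>_. K). ?f \<omega> = 0"
      by (subst (asm) nn_integral_0_iff_AE) (use ij in measurable)
    then show ?thesis by eventually_elim (auto simp: indicator_def split: if_splits)
  qed
  then have "AE \<omega> in PiM I (\<lambda>_. K). \<forall>i\<in>I. \<forall>j\<in>I. i \<noteq> j \<longrightarrow> X (\<omega> i) \<noteq> X (\<omega> j)"
    using I by (auto intro!: AE_finite_allI)
  then show ?thesis by eventually_elim (auto simp: inj_on_def)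
qed

text \<open>
  The labels are required to lie below \<open>a\<close> so that the quantity left after removal of the largest
  label \<open>x\<close> is of the same form, with \<open>x\<close> in place of \<open>a\<close>.
\<close>

definition top_product :: "nat set \<Rightarrow> 'l list \<Rightarrow> real \<Rightarrow> (nat \<Rightarrow> 'w) \<Rightarrow> ennreal" where
  "top_product I ls a \<omega> = (\<Prod>j\<in>I. indicator {..<a} (X (\<omega> j))) *
     (\<Prod>i<length ls. g (ls ! i) (\<omega> (ranked I (\<lambda>j. X (\<omega> j)) (Suc i))))"

lemma top_product_cong:
  assumes "\<And>j. j \<in> I \<Longrightarrow> \<omega> j = \<omega>' j" "inj_on (\<lambda>j. X (\<omega> j)) I" "length ls \<le> card I" "finite I"
  shows "top_product I ls a \<omega> = top_product I ls a \<omega>'"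
proof -
  have r: "ranked I (\<lambda>j. X (\<omega> j)) i = ranked I (\<lambda>j. X (\<omega>' j)) i" for i
    by (rule ranked_cong) (simp add: assms(1))
  have "ranked I (\<lambda>j. X (\<omega> j)) (Suc i) \<in> I" if "i < length ls" for i
    using ranked_properties(1)[OF assms(4,2), of "Suc i"] that assms(3) by auto
  then show ?thesis
    unfolding top_product_def using assms(1) by (auto simp: r intro!: arg_cong2[where f = "(*)"] prod.cong)
qed

lemma measurable_top_product:
  assumes I: "finite I" "I \<subseteq> J" and [measurable]: "c \<in> borel_measurable (PiM J (\<lambda>_. K))"
  shows "(\<lambda>\<omega>. top_product I ls (c \<omega>) \<omega>) \<in> borel_measurable (PiM J (\<lambda>_. K))"
proof -
  let ?P = "PiM J (\<lambda>_. K)"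
  have X': "(\<lambda>\<omega>. X (\<omega> j)) \<in> borel_measurable ?P" if "j \<in> I" for j
    using that I by (intro measurable_compose[OF _ measurable_label] measurable_component_singleton) auto
  have "(\<lambda>\<omega>. g l (\<omega> (ranked I (\<lambda>j. X (\<omega> j)) i))) \<in> borel_measurable ?P" for l i
  proof (rule measurable_compose_countable'[where I = UNIV and f = "\<lambda>j \<omega>. g l (\<omega> j)"])
    show "(\<lambda>\<omega>. ranked I (\<lambda>j. X (\<omega> j)) i) \<in> measurable ?P (count_space UNIV)"
      by (rule measurable_ranked) (use I X' in auto)
    show "(\<lambda>\<omega>. g l (\<omega> j)) \<in> borel_measurable ?P" for j
    proof (cases "j \<in> J")
      case False
      then have "g l (\<omega> j) = g l undefined" if "\<omega> \<in> space ?P" for \<omega>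
        using that by (simp add: space_PiM PiE_def extensional_def)
      then show ?thesis by (subst measurable_cong) auto
    next
      case True
      then show ?thesis
        by (intro measurable_compose[OF _ measurable_mark] measurable_component_singleton)
    qed
  qed simp
  moreover have "(\<lambda>\<omega>. indicator {..<c \<omega>} (X (\<omega> j)) :: ennreal) \<in> borel_measurable ?P" if "j \<in> I" for j
  proof -
    have "(\<lambda>\<omega>. indicator {0<..} (c \<omega> - X (\<omega> j)) :: ennreal) \<in> borel_measurable ?P"
      using X'[OF that] by measurable
    moreover have "indicator {0<..} (c \<omega> - X (\<omega> j)) = (indicator {..<c \<omega>} (X (\<omega> j)) :: ennreal)" for \<omega>
      by (auto simp: indicator_def)
    ultimately show ?thesis by simp
  qed
  ultimately show ?thesis
    unfolding top_product_def by (intro borel_measurable_times_ennreal borel_measurable_prod_ennreal) auto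
qed

text \<open>
  The summand of \<open>j\<close> vanishes unless all other labels lie below that of \<open>j\<close>, so only the index of
  the largest label contributes. This spares a case distinction on the random position of the maximum
  when integrating.
\<close>

lemma top_product_decompose:
  assumes I: "finite I" and inj: "inj_on (\<lambda>j. X (\<omega> j)) I" and len: "length (l # ls) \<le> card I"
  shows "top_product I (l # ls) a \<omega> =
    (\<Sum>j\<in>I. indicator {..<a} (X (\<omega> j)) * g l (\<omega> j) * top_product (I - {j}) ls (X (\<omega> j)) \<omega>)"
proof -
  let ?x = "\<lambda>j. X (\<omega> j)"
  have "I \<noteq> {}" using len by auto
  then have "Max (?x ` I) \<in> ?x ` I" using I by (intro Max_in) auto
  then obtain j where j: "j \<in> I" "?x j = Max (?x ` I)" by auto
  have max: "?x v < ?x j" if "v \<in> I" "v \<noteq> j" for v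
  proof -
    have "?x v \<le> ?x j" using that I j by simp
    moreover have "?x v \<noteq> ?x j" using inj that j(1) by (auto simp: inj_on_def)
    ultimately show ?thesis by simp
  qed
  have zero: "top_product (I - {i}) ls (?x i) \<omega> = 0" if "i \<in> I - {j}" for i
  proof -
    have "(\<Prod>v\<in>I - {i}. indicator {..<?x i} (?x v) :: ennreal) = 0"
      using that j(1) max[of i] I by (intro prod_zero bexI[of _ j]) (auto simp: indicator_def)
    then show ?thesis by (simp add: top_product_def)
  qed
  have ind: "(\<Prod>v\<in>I. indicator {..<a} (?x v) :: ennreal) =
      indicator {..<a} (?x j) * (\<Prod>v\<in>I - {j}. indicator {..<?x j} (?x v))"
  proof -
    have "(\<Prod>v\<in>I. indicator {..<a} (?x v) :: ennreal) =
        indicator {..<a} (?x j) * (\<Prod>v\<in>I - {j}. indicator {..<a} (?x v))"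
      using I j(1) by (rule prod.remove)
    also have "\<dots> = indicator {..<a} (?x j) * (\<Prod>v\<in>I - {j}. indicator {..<?x j} (?x v))"
    proof (cases "?x j < a")
      case True
      have "(\<Prod>v\<in>I - {j}. indicator {..<a} (?x v) :: ennreal) = (\<Prod>v\<in>I - {j}. indicator {..<?x j} (?x v))"
        by (intro prod.cong refl) (use max True in \<open>force simp: indicator_def\<close>)
      then show ?thesis by simp
    qed simp
    finally show ?thesis .
  qed
  have marks: "(\<Prod>i<length (l # ls). g ((l # ls) ! i) (\<omega> (ranked I ?x (Suc i)))) =
      g l (\<omega> j) * (\<Prod>i<length ls. g (ls ! i) (\<omega> (ranked (I - {j}) ?x (Suc i))))"
  proof -
    have "ranked I ?x (Suc 0) = j"
      by (rule ranked_first) (use j I max in auto)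
    moreover have "ranked I ?x (Suc (Suc i)) = ranked (I - {j}) ?x (Suc i)" for i
      by (rule ranked_remove_first) (use j I max in auto)
    ultimately show ?thesis by (simp add: prod.lessThan_Suc_shift del: prod.lessThan_Suc)
  qed
  have "(\<Sum>i\<in>I. indicator {..<a} (?x i) * g l (\<omega> i) * top_product (I - {i}) ls (?x i) \<omega>) =
      indicator {..<a} (?x j) * g l (\<omega> j) * top_product (I - {j}) ls (?x j) \<omega>"
    using I j(1) by (subst sum.remove) (auto simp: zero)
  also have "\<dots> = top_product I (l # ls) a \<omega>"
    unfolding top_product_def ind marks by (simp only: mult_ac)
  finally show ?thesis by simp
qed

text \<open>
  Integration over the label and mark of \<open>j\<close> last, after all the others, gives the same value for each
  of the \<open>k\<close> summands of the decomposition; \<open>substitute_maximum_of_uniforms\<close> turns \<open>k\<close> times this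
  value into one step of the recursion.
\<close>

theorem nn_integral_top_product:
  assumes "finite I" "length ls \<le> card I" "0 < a" "a \<le> 1"
  shows "(\<integral>\<^sup>+\<omega>. top_product I ls a \<omega> \<partial>PiM I (\<lambda>_. K)) =
    ennreal (a ^ card I) * top_marks \<psi> ls (card I) a"
  using assms
proof (induction ls arbitrary: I a)
  case Nil
  have "(\<integral>\<^sup>+\<omega>. indicator {..<a} (X \<omega>) \<partial>K) = (\<integral>\<^sup>+x. indicator {..<a} x \<partial>unif)"
    unfolding label_distribution[symmetric] by (subst nn_integral_distr) auto
  also have "\<dots> = emeasure unif {..<a}" by simp
  also have "\<dots> = emeasure lborel ({0..1} \<inter> {..<a})"
    by (subst emeasure_uniform_measure) (simp_all add: divide_ennreal_def)
  also have "{0..1} \<inter> {..<a} = {0..<a}" using Nil.prems by auto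
  finally have 1: "(\<integral>\<^sup>+\<omega>. indicator {..<a} (X \<omega>) \<partial>K) = ennreal a" using Nil.prems by simp
  have "(\<integral>\<^sup>+\<omega>. (\<Prod>j\<in>I. indicator {..<a} (X (\<omega> j))) \<partial>PiM I (\<lambda>_. K)) =
      (\<Prod>j\<in>I. \<integral>\<^sup>+\<omega>. indicator {..<a} (X \<omega>) \<partial>K)"
    by (rule product.product_nn_integral_prod) (use Nil.prems in auto)
  then show ?case
    using Nil.prems by (simp add: top_product_def 1 ennreal_power)
next
  case (Cons l ls)
  let ?P = "\<lambda>J. PiM J (\<lambda>_. K)"
  let ?k = "card I"
  note I = Cons.prems(1)
  have k: "?k \<ge> 1" "length ls \<le> ?k - 1" using Cons.prems by auto
  let ?h = "\<lambda>x. indicator {..<a} x * (ennreal (x ^ (?k - 1)) * top_marks \<psi> ls (?k - 1) x)"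
  have meas: "(\<lambda>\<omega>. indicator {..<a} (X (\<omega> j)) * g l (\<omega> j) * top_product (I - {j}) ls (X (\<omega> j)) \<omega>)
      \<in> borel_measurable (?P I)" if "j \<in> I" for j
  proof -
    have comp: "(\<lambda>\<omega>. \<omega> j) \<in> measurable (?P I) K"
      using measurable_component_singleton[OF that, of "\<lambda>_. K"] .
    note [measurable] = measurable_compose[OF comp measurable_label]
      measurable_compose[OF comp measurable_mark]
    show ?thesis
      using I by (intro borel_measurable_times_ennreal measurable_top_product) auto
  qed
  have summand: "(\<integral>\<^sup>+\<omega>. indicator {..<a} (X (\<omega> j)) * g l (\<omega> j) * top_product (I - {j}) ls (X (\<omega> j)) \<omega> \<partial>?P I)
      = (\<integral>\<^sup>+x. ?h x * \<psi> l x \<partial>unif)" if j: "j \<in> I" for j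
  proof -
    let ?J = "I - {j}"
    have ins: "insert j ?J = I" using j by auto
    have J: "finite ?J" "j \<notin> ?J" "card ?J = ?k - 1" using I j by auto
    have inner: "(\<integral>\<^sup>+x. top_product ?J ls c (x(j := y)) \<partial>?P ?J) = ennreal (c ^ (?k - 1)) * top_marks \<psi> ls (?k - 1) c"
      if c: "c \<in> {0<..1}" for c y
    proof -
      have "(\<integral>\<^sup>+x. top_product ?J ls c (x(j := y)) \<partial>?P ?J) = (\<integral>\<^sup>+x. top_product ?J ls c x \<partial>?P ?J)"
        using AE_labels_distinct[OF J(1)]
      proof (intro nn_integral_cong_AE, eventually_elim)
        case (elim x)
        show ?case
          by (rule top_product_cong[symmetric]) (use elim J k in auto)
      qed
      also have "\<dots> = ennreal (c ^ card ?J) * top_marks \<psi> ls (card ?J) c"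
        by (rule Cons.IH) (use J k c in auto)
      finally show ?thesis using J by simp
    qed
    have "(\<integral>\<^sup>+\<omega>. indicator {..<a} (X (\<omega> j)) * g l (\<omega> j) * top_product ?J ls (X (\<omega> j)) \<omega> \<partial>?P (insert j ?J)) =
       (\<integral>\<^sup>+y. \<integral>\<^sup>+x. indicator {..<a} (X y) * g l y * top_product ?J ls (X y) (x(j := y)) \<partial>?P ?J \<partial>K)"
      using meas[OF j] ins by (subst product.product_nn_integral_insert_rev[OF J(1,2)]) auto
    also have "\<dots> = (\<integral>\<^sup>+y. ?h (X y) * g l y \<partial>K)"
    proof (rule nn_integral_cong_AE)
      show "AE y in K. (\<integral>\<^sup>+x. indicator {..<a} (X y) * g l y * top_product ?J ls (X y) (x(j := y)) \<partial>?P ?J)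
          = ?h (X y) * g l y"
      using AE_label_unit_interval AE_space[of K]
    proof eventually_elim
      case (elim y)
      have upd: "(\<lambda>x. x(j := y)) \<in> measurable (?P ?J) (?P (insert j ?J))"
        using elim(2) J by (intro measurable_fun_upd[where J = ?J]) auto
      have "(\<lambda>x. top_product ?J ls (X y) (x(j := y))) \<in> borel_measurable (?P ?J)"
        by (rule measurable_compose[OF upd]) (rule measurable_top_product, use J in auto)
      then have "(\<integral>\<^sup>+x. indicator {..<a} (X y) * g l y * top_product ?J ls (X y) (x(j := y)) \<partial>?P ?J) =
        indicator {..<a} (X y) * g l y * (\<integral>\<^sup>+x. top_product ?J ls (X y) (x(j := y)) \<partial>?P ?J)"
        by (rule nn_integral_cmult)
      then show ?case using inner[OF elim(1)] by (simp only: mult_ac)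
    qed
    qed
    also have "\<dots> = (\<integral>\<^sup>+x. ?h x * \<psi> l x \<partial>unif)"
      by (rule conditional_mark) measurable
    finally show ?thesis unfolding ins .
  qed
  have "(\<integral>\<^sup>+\<omega>. top_product I (l # ls) a \<omega> \<partial>?P I) =
      (\<integral>\<^sup>+\<omega>. (\<Sum>j\<in>I. indicator {..<a} (X (\<omega> j)) * g l (\<omega> j) * top_product (I - {j}) ls (X (\<omega> j)) \<omega>) \<partial>?P I)"
    using AE_labels_distinct[OF I]
    by (intro nn_integral_cong_AE, eventually_elim)
       (rule top_product_decompose[OF I _ Cons.prems(2)])
  also have "\<dots> = (\<Sum>j\<in>I. \<integral>\<^sup>+\<omega>. indicator {..<a} (X (\<omega> j)) * g l (\<omega> j) * top_product (I - {j}) ls (X (\<omega> j)) \<omega> \<partial>?P I)"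
    by (rule nn_integral_sum) (rule meas)
  also have "\<dots> = of_nat ?k * (\<integral>\<^sup>+x. ?h x * \<psi> l x \<partial>unif)"
    by (simp add: summand)
  also have "\<dots> = of_nat ?k * (\<integral>\<^sup>+x. indicator {..<a} x * ennreal (x ^ (?k - 1)) *
      (\<psi> l x * top_marks \<psi> ls (?k - 1) x) \<partial>unif)"
    by (simp only: mult_ac)
  also have "\<dots> = ennreal (a ^ ?k) * (\<integral>\<^sup>+v. \<psi> l (a * root ?k v) * top_marks \<psi> ls (?k - 1) (a * root ?k v) \<partial>unif)"
    by (rule substitute_maximum_of_uniforms) (use Cons.prems k in auto)
  finally show ?case by simp
qed

end

section \<open>Recursive structure of the temporal tree\<close>

lemma temporal_tree_Nil[simp]: "[] \<in> temporal_tree n p u"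
  by (simp add: temporal_tree_def tree_vertices_def)

text \<open>
  Self-similarity of the tree: the label of the child \<open>j\<close> of the root plays the part of \<open>p\<close> in the
  subtree at \<open>j\<close>.
\<close>

lemma temporal_tree_Cons:
  "j # v \<in> temporal_tree n p u \<longleftrightarrow>
     j < n \<and> u [j] < p \<and> v \<in> temporal_tree n (u [j]) (\<lambda>w. u (j # w))"
proof -
  have "vertex_label p u (take (Suc k) (j # v)) = vertex_label (u [j]) (\<lambda>w. u (j # w)) (take k v)" for k
    by (cases "take k v") (auto simp: vertex_label_def)
  then show ?thesis
    by (auto simp: temporal_tree_def tree_vertices_def All_less_Suc2 simp del: take_Suc_Cons)
       (auto simp: vertex_label_def)
qed

lemma temporal_tree_subset: "temporal_tree n p u \<subseteq> tree_vertices n"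
  by (auto simp: temporal_tree_def)

lemma Cons_in_tree_edges: "j < n \<Longrightarrow> v \<in> tree_vertices n \<Longrightarrow> j # v \<in> tree_edges n"
  by (auto simp: tree_edges_def tree_vertices_def)

lemma Nil_in_tree_vertices: "[] \<in> tree_vertices n"
  by (auto simp: tree_vertices_def)

lemma tree_vertices_eq: "tree_vertices n = insert [] (tree_edges n)"
  by (auto simp: tree_edges_def tree_vertices_def)

lemma temporal_tree_cong:
  assumes "\<And>e. e \<in> tree_edges n \<Longrightarrow> u e = u' e"
  shows "temporal_tree n p u = temporal_tree n p u'"
proof -
  have "vertex_label p u (take k v) = vertex_label p u' (take k v)" if "v \<in> tree_vertices n" for k v
    using that assms[of "take k v"]
    by (auto simp: vertex_label_def tree_edges_def tree_vertices_def dest: in_set_takeD)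
  then show ?thesis by (auto simp: temporal_tree_def)
qed

lemma temporal_tree_decompose:
  "temporal_tree n p u =
     insert [] (\<Union>j\<in>{j. j < n \<and> u [j] < p}. (#) j ` temporal_tree n (u [j]) (\<lambda>w. u (j # w)))"
  (is "?l = ?r")
proof (rule set_eqI)
  fix v show "v \<in> ?l \<longleftrightarrow> v \<in> ?r"
    by (cases v) (auto simp: temporal_tree_Cons)
qed

text \<open>
  The random variable \<open>exp (- s * \<sigma>)\<close> for the true size \<open>\<sigma>\<close>, read as 0 for an infinite tree,
  to which \<open>card\<close> would assign the size 0. With this convention the product formula
  \<open>tree_weight_decompose\<close> holds for all realisations.
\<close>

definition tree_weight :: "real \<Rightarrow> nat list set \<Rightarrow> real" where
  "tree_weight s T = (if finite T then exp (- s * real (card T)) else 0)"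

lemma tree_weight_nonneg: "0 \<le> tree_weight s T"
  by (simp add: tree_weight_def)

lemma tree_weight_le_1: "0 \<le> s \<Longrightarrow> tree_weight s T \<le> 1"
  by (simp add: tree_weight_def)

lemma tree_weight_decompose:
  "tree_weight s (temporal_tree n p u) = exp (- s) *
     (\<Prod>j<n. if u [j] < p then tree_weight s (temporal_tree n (u [j]) (\<lambda>w. u (j # w))) else 1)"
proof -
  let ?A = "{j. j < n \<and> u [j] < p}" and ?T = "\<lambda>j. temporal_tree n (u [j]) (\<lambda>w. u (j # w))"
  have A: "finite ?A" by simp
  have prod: "(\<Prod>j<n. if u [j] < p then tree_weight s (?T j) else 1) = (\<Prod>j\<in>?A. tree_weight s (?T j))"
    by (subst prod.inter_filter[symmetric]) (auto intro!: prod.cong)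
  have fin: "finite (temporal_tree n p u) \<longleftrightarrow> (\<forall>j\<in>?A. finite (?T j))"
    by (subst temporal_tree_decompose) (auto simp: finite_image_iff)
  show ?thesis
  proof (cases "\<forall>j\<in>?A. finite (?T j)")
    case True
    have "card (temporal_tree n p u) = Suc (card (\<Union>j\<in>?A. (#) j ` ?T j))"
      by (subst temporal_tree_decompose, subst card_insert_disjoint) (use True in auto)
    also have "card (\<Union>j\<in>?A. (#) j ` ?T j) = (\<Sum>j\<in>?A. card ((#) j ` ?T j))"
      by (rule card_UN_disjoint) (use True in auto)
    also have "\<dots> = (\<Sum>j\<in>?A. card (?T j))"
      by (intro sum.cong refl card_image) simp
    finally have "real (card (temporal_tree n p u)) = 1 + (\<Sum>j\<in>?A. real (card (?T j)))" by simp
    then have "tree_weight s (temporal_tree n p u) = exp (- s) * exp (\<Sum>j\<in>?A. - s * real (card (?T j)))"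
      using fin True by (simp add: tree_weight_def distrib_left sum_distrib_left sum_negf flip: exp_add)
    also have "exp (\<Sum>j\<in>?A. - s * real (card (?T j))) = (\<Prod>j\<in>?A. tree_weight s (?T j))"
      using True by (subst exp_sum) (auto simp: tree_weight_def)
    finally show ?thesis using prod by simp
  next
    case False
    then have "(\<Prod>j\<in>?A. tree_weight s (?T j)) = 0"
      by (intro prod_zero) (auto simp: tree_weight_def)
    moreover have "tree_weight s (temporal_tree n p u) = 0"
      using False fin by (simp add: tree_weight_def)
    ultimately show ?thesis by (simp add: prod)
  qed
qed

section \<open>Measurability of functionals of random vertex sets\<close>

lemma pred_in_temporal_tree:
  assumes "p \<in> borel_measurable M" "\<And>e. e \<in> tree_edges n \<Longrightarrow> (\<lambda>\<omega>. u \<omega> e) \<in> borel_measurable M"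
  shows "Measurable.pred M (\<lambda>\<omega>. v \<in> temporal_tree n (p \<omega>) (u \<omega>))"
  using assms
proof (induction v arbitrary: p u)
  case (Cons j v)
  show ?case
  proof (cases "j < n")
    case True
    have [measurable]: "(\<lambda>\<omega>. u \<omega> [j]) \<in> borel_measurable M"
      using Cons_in_tree_edges[OF True Nil_in_tree_vertices] Cons.prems(2) by simp
    note Cons.prems(1)[measurable]
    have [measurable]: "Measurable.pred M (\<lambda>\<omega>. v \<in> temporal_tree n (u \<omega> [j]) (\<lambda>w. u \<omega> (j # w)))"
      by (rule Cons.IH) (use Cons.prems(2) Cons_in_tree_edges[OF True] in \<open>auto simp: tree_edges_def\<close>)
    show ?thesis unfolding temporal_tree_Cons by measurable
  qed (simp add: temporal_tree_Cons)
qed simp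

lemma borel_measurable_indicator_of_member:
  assumes "Measurable.pred M (\<lambda>\<omega>. v \<in> T \<omega>)"
  shows "(\<lambda>\<omega>. indicator (T \<omega>) v :: ennreal) \<in> borel_measurable M"
proof -
  have "(\<lambda>\<omega>. indicator (T \<omega>) v :: ennreal) = (\<lambda>\<omega>. if v \<in> T \<omega> then 1 else 0)"
    by (auto simp: indicator_def)
  then show ?thesis using assms by simp
qed

lemma borel_measurable_size:
  fixes T :: "'a \<Rightarrow> 'v :: countable set"
  assumes "\<And>v. Measurable.pred M (\<lambda>\<omega>. v \<in> T \<omega>)"
  shows "(\<lambda>\<omega>. emeasure (count_space UNIV) (T \<omega>)) \<in> borel_measurable M"
proof -
  interpret sigma_finite_measure "count_space (UNIV :: 'v set)"
    by (rule sigma_finite_measure_count_space)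
  note ind = borel_measurable_indicator_of_member[OF assms]
  have [measurable]: "(\<lambda>z. indicator (T (fst z)) (snd z) :: ennreal)
      \<in> borel_measurable (M \<Otimes>\<^sub>M count_space UNIV)"
    by (rule measurable_compose_countable[of "\<lambda>v z. indicator (T (fst z)) v"])
       (auto intro: measurable_compose[OF measurable_fst ind] simp del: indicator_simps)
  have "(\<lambda>\<omega>. \<integral>\<^sup>+v. indicator (T \<omega>) v \<partial>count_space UNIV) \<in> borel_measurable M"
    by (rule borel_measurable_nn_integral) (simp add: case_prod_beta')
  then show ?thesis by simp
qed

lemma real_card_eq_size: "real (card T) = enn2real (emeasure (count_space UNIV) T)"
  by (cases "finite T") (simp_all add: ennreal_of_nat_eq_real_of_nat)

lemma borel_measurable_card:
  fixes T :: "'a \<Rightarrow> 'v :: countable set"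
  assumes "\<And>v. Measurable.pred M (\<lambda>\<omega>. v \<in> T \<omega>)"
  shows "(\<lambda>\<omega>. real (card (T \<omega>))) \<in> borel_measurable M"
  unfolding real_card_eq_size
  by (rule measurable_compose[OF borel_measurable_size[OF assms]]) measurable

lemma pred_finite:
  fixes T :: "'a \<Rightarrow> 'v :: countable set"
  assumes "\<And>v. Measurable.pred M (\<lambda>\<omega>. v \<in> T \<omega>)"
  shows "Measurable.pred M (\<lambda>\<omega>. finite (T \<omega>))"
proof -
  have eq: "finite (T \<omega>) \<longleftrightarrow> emeasure (count_space UNIV) (T \<omega>) < \<infinity>" for \<omega>
    by (cases "finite (T \<omega>)") (auto simp: of_nat_less_top)
  note [measurable] = borel_measurable_size[OF assms]
  show ?thesis unfolding eq by measurable
qed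

lemma borel_measurable_tree_weight:
  assumes "\<And>v. Measurable.pred M (\<lambda>\<omega>. v \<in> T \<omega>)"
  shows "(\<lambda>\<omega>. tree_weight s (T \<omega>)) \<in> borel_measurable M"
proof -
  have "(\<lambda>\<omega>. exp (- s * real (card (T \<omega>)))) \<in> borel_measurable M"
    by (rule measurable_compose[OF borel_measurable_card[OF assms]]) measurable
  then show ?thesis
    unfolding tree_weight_def using pred_finite[OF assms] by (intro measurable_If) auto
qed

section \<open>Independence of the branches\<close>

definition edge_space :: "nat \<Rightarrow> (nat list \<Rightarrow> real) measure" where
  "edge_space n = PiM (tree_edges n) (\<lambda>_. unif)"

text \<open>
  A branch consists of a labelled root together with everything below it, so its labels are indexed by
  all vertices, including the root.
\<close>

definition vertex_space :: "nat \<Rightarrow> (nat list \<Rightarrow> real) measure" where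
  "vertex_space n = PiM (tree_vertices n) (\<lambda>_. unif)"

text \<open>
  The labels of the subtree at the child \<open>j\<close> of the root, re-indexed as a full tree.
\<close>

definition branch :: "nat \<Rightarrow> (nat list \<Rightarrow> real) \<Rightarrow> nat \<Rightarrow> nat list \<Rightarrow> real" where
  "branch n u j = (\<lambda>v\<in>tree_vertices n. u (j # v))"

lemma measurable_into_unif: "measurable M unif = borel_measurable M"
  by (rule measurable_cong_sets) simp_all

lemma prob_space_edge_space: "prob_space (edge_space n)"
  unfolding edge_space_def by (rule prob_space_PiM) (rule prob_space_unif)

lemma prob_space_vertex_space: "prob_space (vertex_space n)"
  unfolding vertex_space_def by (rule prob_space_PiM) (rule prob_space_unif)

lemma uniform_edge_variables_measurable:
  assumes "uniform_edge_variables M n U" "e \<in> tree_edges n"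
  shows "U e \<in> borel_measurable M"
proof -
  interpret prob_space M using assms(1) by (simp add: uniform_edge_variables_def)
  show ?thesis
    using assms by (auto simp: uniform_edge_variables_def indep_vars_def)
qed

lemma distr_restrict_indep_uniform:
  assumes "prob_space M" "prob_space.indep_vars M (\<lambda>_. borel) X I" "I \<noteq> {}"
    "\<And>i. i \<in> I \<Longrightarrow> distr M borel (X i) = unif"
  shows "distr M (PiM I (\<lambda>_. unif)) (\<lambda>\<omega>. \<lambda>i\<in>I. X i \<omega>) = PiM I (\<lambda>_. unif)"
proof -
  interpret prob_space M by fact
  have rv: "random_variable borel (X i)" if "i \<in> I" for i
    using assms(2) that by (auto simp: indep_vars_def)
  have "distr M (PiM I (\<lambda>_. unif)) (\<lambda>\<omega>. \<lambda>i\<in>I. X i \<omega>) = distr M (PiM I (\<lambda>_. borel)) (\<lambda>\<omega>. \<lambda>i\<in>I. X i \<omega>)"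
    by (intro distr_cong refl sets_PiM_cong) simp
  also have "\<dots> = PiM I (\<lambda>i. distr M borel (X i))"
    using indep_vars_iff_distr_eq_PiM'[of I X "\<lambda>_. borel"] assms(2,3) rv by simp
  also have "\<dots> = PiM I (\<lambda>_. unif)"
    by (intro PiM_cong refl assms(4))
  finally show ?thesis .
qed

lemma measurable_edge_labels:
  assumes "uniform_edge_variables M n U"
  shows "(\<lambda>\<omega>. \<lambda>e\<in>tree_edges n. U e \<omega>) \<in> measurable M (edge_space n)"
  unfolding edge_space_def
  by (rule measurable_restrict)
    (use uniform_edge_variables_measurable[OF assms] in \<open>simp add: measurable_into_unif\<close>)

lemma tree_edges_nonempty: "n \<ge> 1 \<Longrightarrow> tree_edges n \<noteq> {}"
  using Cons_in_tree_edges[of 0 n "[]"] Nil_in_tree_vertices by auto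

lemma distr_edge_space:
  assumes "uniform_edge_variables M n U" "n \<ge> 1"
  shows "distr M (edge_space n) (\<lambda>\<omega>. \<lambda>e\<in>tree_edges n. U e \<omega>) = edge_space n"
  unfolding edge_space_def
  by (rule distr_restrict_indep_uniform)
    (use assms tree_edges_nonempty in \<open>auto simp: uniform_edge_variables_def\<close>)

lemma nn_integral_temporal_tree:
  assumes "uniform_edge_variables M n U" "n \<ge> 1"
    and W: "(\<lambda>u. W (temporal_tree n x u)) \<in> borel_measurable (edge_space n)"
  shows "(\<integral>\<^sup>+\<omega>. W (temporal_tree n x (\<lambda>e. U e \<omega>)) \<partial>M) =
    (\<integral>\<^sup>+u. W (temporal_tree n x u) \<partial>edge_space n)"
proof -
  let ?R = "\<lambda>\<omega>. \<lambda>e\<in>tree_edges n. U e \<omega>"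
  have "temporal_tree n x (?R \<omega>) = temporal_tree n x (\<lambda>e. U e \<omega>)" for \<omega>
    by (rule temporal_tree_cong) simp
  moreover have "(\<integral>\<^sup>+u. W (temporal_tree n x u) \<partial>distr M (edge_space n) ?R) =
      (\<integral>\<^sup>+\<omega>. W (temporal_tree n x (?R \<omega>)) \<partial>M)"
    by (rule nn_integral_distr[OF measurable_edge_labels[OF assms(1)]]) (use W in simp)
  ultimately show ?thesis
    unfolding distr_edge_space[OF assms(1,2)] by simp
qed

text \<open>
  The coordinate variables of the product space are themselves an instance of the model. Laws of
  functionals of the tree can therefore be computed on this one space.
\<close>

lemma uniform_edge_variables_edge_space:
  assumes "n \<ge> 1"
  shows "uniform_edge_variables (edge_space n) n (\<lambda>e u. u e)"
proof -
  interpret prob_space "edge_space n" by (rule prob_space_edge_space)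
  have comp: "distr (edge_space n) borel (\<lambda>u. u e) = unif" if "e \<in> tree_edges n" for e
  proof -
    have "distr (edge_space n) borel (\<lambda>u. u e) = distr (edge_space n) unif (\<lambda>u. u e)"
      by (rule distr_cong) simp_all
    then show ?thesis
      unfolding edge_space_def
      using distr_PiM_component[of "tree_edges n" "\<lambda>_. unif", OF prob_space_unif that] by simp
  qed
  have rv: "random_variable borel (\<lambda>u. u e)" if "e \<in> tree_edges n" for e
    using measurable_component_singleton[OF that, of "\<lambda>_. unif"]
    unfolding edge_space_def measurable_into_unif .
  have "distr (edge_space n) (PiM (tree_edges n) (\<lambda>_. borel)) (\<lambda>u. \<lambda>e\<in>tree_edges n. u e) =
      distr (edge_space n) (edge_space n) (\<lambda>u. u)"
    unfolding edge_space_def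
    by (intro distr_cong refl sets_PiM_cong) (auto simp: space_PiM PiE_def extensional_def fun_eq_iff)
  also have "\<dots> = PiM (tree_edges n) (\<lambda>e. distr (edge_space n) borel (\<lambda>u. u e))"
    by (simp add: comp edge_space_def[symmetric] distr_id cong: PiM_cong)
  finally have "indep_vars (\<lambda>_. borel) (\<lambda>e u. u e) (tree_edges n)"
    using indep_vars_iff_distr_eq_PiM'[of "tree_edges n" "\<lambda>e u. u e" "\<lambda>_. borel"]
      tree_edges_nonempty[OF assms] rv by simp
  then show ?thesis
    using comp by (simp add: uniform_edge_variables_def prob_space_axioms)
qed

text \<open>
  The branches are functions of disjoint blocks of edge variables, hence independent, and each block is
  a re-indexed family of independent uniform variables.
\<close>

lemma distr_branches:
  assumes U: "uniform_edge_variables M n U" and n: "n \<ge> 1"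
  shows "distr M (PiM {..<n} (\<lambda>_. vertex_space n)) (\<lambda>\<omega>. \<lambda>j\<in>{..<n}. branch n (\<lambda>e. U e \<omega>) j) =
    PiM {..<n} (\<lambda>_. vertex_space n)"
proof -
  interpret prob_space M using U by (simp add: uniform_edge_variables_def)
  let ?V = "tree_vertices n"
  let ?K = "\<lambda>j. (#) j ` ?V"
  have indep: "indep_vars (\<lambda>_. borel) U (tree_edges n)"
    and law: "\<And>e. e \<in> tree_edges n \<Longrightarrow> distr M borel (U e) = unif"
    using U by (auto simp: uniform_edge_variables_def)
  have K: "?K j \<subseteq> tree_edges n" if "j \<in> {..<n}" for j
    using that Cons_in_tree_edges by auto
  have "indep_vars (\<lambda>j. PiM (?K j) (\<lambda>_. borel)) (\<lambda>j \<omega>. restrict (\<lambda>i. U i \<omega>) (?K j)) {..<n}"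
    by (rule indep_vars_restrict[OF indep K]) (auto simp: disjoint_family_on_def)
  then have "indep_vars (\<lambda>_. vertex_space n)
      (\<lambda>j \<omega>. (\<lambda>f. \<lambda>v\<in>?V. f (j # v)) (restrict (\<lambda>i. U i \<omega>) (?K j))) {..<n}"
  proof (rule indep_vars_compose2)
    fix j
    show "(\<lambda>f. \<lambda>v\<in>?V. f (j # v)) \<in> PiM (?K j) (\<lambda>_. borel) \<rightarrow>\<^sub>M vertex_space n"
      unfolding vertex_space_def by (rule measurable_restrict) auto
  qed
  also have "(\<lambda>j \<omega>. (\<lambda>f. \<lambda>v\<in>?V. f (j # v)) (restrict (\<lambda>i. U i \<omega>) (?K j))) =
      (\<lambda>j \<omega>. branch n (\<lambda>e. U e \<omega>) j)"
    by (auto simp: fun_eq_iff branch_def)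
  finally have ind: "indep_vars (\<lambda>_. vertex_space n) (\<lambda>j \<omega>. branch n (\<lambda>e. U e \<omega>) j) {..<n}" .
  have law_branch: "distr M (vertex_space n) (\<lambda>\<omega>. branch n (\<lambda>e. U e \<omega>) j) = vertex_space n"
    if j: "j \<in> {..<n}" for j
  proof -
    let ?R = "\<lambda>\<omega>. \<lambda>e\<in>tree_edges n. U e \<omega>" and ?B = "\<lambda>u. \<lambda>v\<in>?V. u (j # v)"
    have edges: "j # v \<in> tree_edges n" if "v \<in> ?V" for v
      using that j Cons_in_tree_edges by simp
    note R = measurable_edge_labels[OF U]
    have B: "?B \<in> measurable (edge_space n) (vertex_space n)"
      unfolding edge_space_def vertex_space_def
      by (rule measurable_restrict) (use edges in simp)
    have "vertex_space n = distr (edge_space n) (vertex_space n) ?B"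
      unfolding edge_space_def vertex_space_def
      by (rule distr_PiM_reindex[symmetric]) (use edges prob_space_unif in \<open>auto simp: inj_on_def\<close>)
    also have "\<dots> = distr (distr M (edge_space n) ?R) (vertex_space n) ?B"
      by (simp only: distr_edge_space[OF U n])
    also have "\<dots> = distr M (vertex_space n) (?B \<circ> ?R)"
      by (rule distr_distr[OF B R])
    also have "?B \<circ> ?R = (\<lambda>\<omega>. branch n (\<lambda>e. U e \<omega>) j)"
      using edges by (auto simp: fun_eq_iff branch_def)
    finally show ?thesis by simp
  qed
  have "distr M (PiM {..<n} (\<lambda>_. vertex_space n)) (\<lambda>\<omega>. \<lambda>j\<in>{..<n}. branch n (\<lambda>e. U e \<omega>) j) =
    PiM {..<n} (\<lambda>j. distr M (vertex_space n) (\<lambda>\<omega>. branch n (\<lambda>e. U e \<omega>) j))"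
  proof (rule indep_vars_iff_distr_eq_PiM'[THEN iffD1])
    show "{..<n} \<noteq> {}" using n by (auto simp: lessThan_empty_iff)
  qed (use ind in \<open>auto simp: indep_vars_def\<close>)
  also have "\<dots> = PiM {..<n} (\<lambda>_. vertex_space n)"
    by (intro PiM_cong refl law_branch)
  finally show ?thesis .
qed

lemma measurable_branch:
  assumes U: "uniform_edge_variables M n U" and j: "j < n"
  shows "(\<lambda>\<omega>. branch n (\<lambda>e. U e \<omega>) j) \<in> measurable M (vertex_space n)"
  unfolding branch_def vertex_space_def
  by (rule measurable_restrict)
    (use uniform_edge_variables_measurable[OF U] Cons_in_tree_edges[OF j] in \<open>simp add: measurable_into_unif\<close>)

lemma measurable_branches:
  assumes U: "uniform_edge_variables M n U"
  shows "(\<lambda>\<omega>. \<lambda>j\<in>{..<n}. branch n (\<lambda>e. U e \<omega>) j) \<in> measurable M (PiM {..<n} (\<lambda>_. vertex_space n))"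
  by (rule measurable_restrict) (use measurable_branch[OF U] in simp)

lemma nn_integral_branches:
  assumes "uniform_edge_variables M n U" "n \<ge> 1"
    "F \<in> borel_measurable (PiM {..<n} (\<lambda>_. vertex_space n))"
  shows "(\<integral>\<^sup>+\<omega>. F (\<lambda>j\<in>{..<n}. branch n (\<lambda>e. U e \<omega>) j) \<partial>M) =
    (\<integral>\<^sup>+w. F w \<partial>PiM {..<n} (\<lambda>_. vertex_space n))"
  using nn_integral_distr[OF measurable_branches[OF assms(1)], of F] assms(3)
  unfolding distr_branches[OF assms(1,2)] by simp

lemma nn_integral_branch:
  assumes U: "uniform_edge_variables M n U" and j: "j < n"
    and f: "f \<in> borel_measurable (vertex_space n)"
  shows "(\<integral>\<^sup>+\<omega>. f (branch n (\<lambda>e. U e \<omega>) j) \<partial>M) = (\<integral>\<^sup>+l. f l \<partial>vertex_space n)"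
proof -
  let ?P = "PiM {..<n} (\<lambda>_. vertex_space n)"
  have comp: "(\<lambda>w. w j) \<in> measurable ?P (vertex_space n)"
    using measurable_component_singleton[of j "{..<n}" "\<lambda>_. vertex_space n"] j by simp
  have "(\<integral>\<^sup>+\<omega>. f ((\<lambda>j\<in>{..<n}. branch n (\<lambda>e. U e \<omega>) j) j) \<partial>M) = (\<integral>\<^sup>+w. f (w j) \<partial>?P)"
    by (rule nn_integral_branches[OF U, of "\<lambda>w. f (w j)"])
       (use j measurable_compose[OF comp f] in auto)
  also have "\<dots> = (\<integral>\<^sup>+l. f l \<partial>distr ?P (vertex_space n) (\<lambda>w. w j))"
    by (rule nn_integral_distr[symmetric]) (use comp f in auto)
  also have "distr ?P (vertex_space n) (\<lambda>w. w j) = vertex_space n"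
    using distr_PiM_component[of "{..<n}" "\<lambda>_. vertex_space n" j] j prob_space_vertex_space by simp
  finally show ?thesis using j by simp
qed

text \<open>
  In a branch the label at the root is independent of the labels below it, so the two can be
  integrated one after the other.
\<close>

lemma nn_integral_vertex_space:
  fixes F :: "real \<Rightarrow> (nat list \<Rightarrow> real) \<Rightarrow> ennreal"
  assumes F: "case_prod F \<in> borel_measurable (borel \<Otimes>\<^sub>M edge_space n)"
    and F': "(\<lambda>l. F (l []) l) \<in> borel_measurable (vertex_space n)"
    and root: "\<And>x y u. F x (u([] := y)) = F x u"
  shows "(\<integral>\<^sup>+l. F (l []) l \<partial>vertex_space n) = (\<integral>\<^sup>+x. \<integral>\<^sup>+u. F x u \<partial>edge_space n \<partial>unif)"
proof -
  interpret E: prob_space "edge_space n" by (rule prob_space_edge_space)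
  let ?P = "unif \<Otimes>\<^sub>M edge_space n" and ?ins = "\<lambda>(x, u). u([] := x)"
  have meas: "?ins \<in> measurable ?P (vertex_space n)"
    unfolding vertex_space_def tree_vertices_eq edge_space_def case_prod_beta'
    by (rule measurable_fun_upd[where J = "tree_edges n"]) auto
  have "vertex_space n = distr ?P (vertex_space n) ?ins"
    unfolding vertex_space_def tree_vertices_eq edge_space_def
    by (rule distr_pair_PiM_eq_PiM[symmetric]) (rule prob_space_unif)+
  then have "(\<integral>\<^sup>+l. F (l []) l \<partial>vertex_space n) = (\<integral>\<^sup>+l. F (l []) l \<partial>distr ?P (vertex_space n) ?ins)"
    by simp
  also have "\<dots> = (\<integral>\<^sup>+z. F (fst z) (snd z) \<partial>?P)"
    by (subst nn_integral_distr[OF meas]) (simp_all add: F' case_prod_beta' root)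
  also have "\<dots> = (\<integral>\<^sup>+x. \<integral>\<^sup>+u. F x u \<partial>edge_space n \<partial>unif)"
  proof (subst E.nn_integral_fst[symmetric])
    have "measurable ?P borel = measurable (borel \<Otimes>\<^sub>M edge_space n) (borel :: ennreal measure)"
      by (rule measurable_cong_sets) (auto intro: sets_pair_measure_cong)
    then show "(\<lambda>z. F (fst z) (snd z)) \<in> borel_measurable ?P"
      using F by (simp add: case_prod_beta')
  qed simp
  finally show ?thesis .
qed

text \<open>
  The temporal tree of a branch, started from the label of the root of the branch.
\<close>

definition vertex_tree :: "nat \<Rightarrow> (nat list \<Rightarrow> real) \<Rightarrow> nat list set" where
  "vertex_tree n l = temporal_tree n (l []) l"

lemma branch_Nil: "branch n u j [] = u [j]"
  by (simp add: branch_def Nil_in_tree_vertices)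

lemma vertex_tree_branch: "temporal_tree n (u [j]) (\<lambda>w. u (j # w)) = vertex_tree n (branch n u j)"
  unfolding vertex_tree_def branch_Nil
  by (rule temporal_tree_cong) (simp add: branch_def tree_edges_def)

lemma temporal_tree_upd_root: "temporal_tree n p (u([] := y)) = temporal_tree n p u"
  by (rule temporal_tree_cong) (auto simp: tree_edges_def)

lemma measurable_vertex_space_component:
  "v \<in> tree_vertices n \<Longrightarrow> (\<lambda>l. l v) \<in> borel_measurable (vertex_space n)"
  using measurable_component_singleton[of v "tree_vertices n" "\<lambda>_. unif"]
  unfolding vertex_space_def measurable_into_unif .

lemma measurable_edge_space_component:
  "e \<in> tree_edges n \<Longrightarrow> (\<lambda>u. u e) \<in> borel_measurable (edge_space n)"
  using measurable_component_singleton[of e "tree_edges n" "\<lambda>_. unif"]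
  unfolding edge_space_def measurable_into_unif .

lemma pred_in_vertex_tree: "Measurable.pred (vertex_space n) (\<lambda>l. v \<in> vertex_tree n l)"
  unfolding vertex_tree_def
  by (rule pred_in_temporal_tree)
    (auto intro!: measurable_vertex_space_component simp: Nil_in_tree_vertices tree_edges_def)

lemma pred_in_pair_tree:
  "Measurable.pred (borel \<Otimes>\<^sub>M edge_space n) (\<lambda>z. v \<in> temporal_tree n (fst z) (snd z))"
  by (rule pred_in_temporal_tree)
    (auto intro: measurable_compose[OF measurable_snd measurable_edge_space_component])

lemma pred_in_edge_tree: "Measurable.pred (edge_space n) (\<lambda>u. v \<in> temporal_tree n x u)"
  by (rule pred_in_temporal_tree) (auto intro: measurable_edge_space_component)

lemma measurable_root_label: "(\<lambda>l. l []) \<in> borel_measurable (vertex_space n)"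
  by (rule measurable_vertex_space_component) (rule Nil_in_tree_vertices)

lemma nn_integral_vertex_tree:
  fixes W :: "nat list set \<Rightarrow> ennreal"
  assumes h[measurable]: "h \<in> borel_measurable borel"
    and W: "\<And>(M :: (nat list \<Rightarrow> real) measure) T. (\<And>v. Measurable.pred M (\<lambda>\<omega>. v \<in> T \<omega>)) \<Longrightarrow>
        (\<lambda>\<omega>. W (T \<omega>)) \<in> borel_measurable M"
      "\<And>(M :: (real \<times> (nat list \<Rightarrow> real)) measure) T. (\<And>v. Measurable.pred M (\<lambda>\<omega>. v \<in> T \<omega>)) \<Longrightarrow>
        (\<lambda>\<omega>. W (T \<omega>)) \<in> borel_measurable M"
  shows "(\<integral>\<^sup>+l. h (l []) * W (vertex_tree n l) \<partial>vertex_space n) =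
    (\<integral>\<^sup>+x. h x * (\<integral>\<^sup>+u. W (temporal_tree n x u) \<partial>edge_space n) \<partial>unif)"
proof -
  have "(\<integral>\<^sup>+l. h (l []) * W (temporal_tree n (l []) l) \<partial>vertex_space n) =
    (\<integral>\<^sup>+x. \<integral>\<^sup>+u. h x * W (temporal_tree n x u) \<partial>edge_space n \<partial>unif)"
  proof (rule nn_integral_vertex_space)
    show "(\<lambda>(x, u). h x * W (temporal_tree n x u)) \<in> borel_measurable (borel \<Otimes>\<^sub>M edge_space n)"
      using W(2)[OF pred_in_pair_tree] by (auto simp: case_prod_beta' intro!: borel_measurable_times_ennreal)
    show "(\<lambda>l. h (l []) * W (temporal_tree n (l []) l)) \<in> borel_measurable (vertex_space n)"
      using W(1)[OF pred_in_vertex_tree] measurable_compose[OF measurable_root_label h]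
      by (auto simp: vertex_tree_def intro!: borel_measurable_times_ennreal)
  qed (simp add: temporal_tree_upd_root)
  also have "\<dots> = (\<integral>\<^sup>+x. h x * (\<integral>\<^sup>+u. W (temporal_tree n x u) \<partial>edge_space n) \<partial>unif)"
    by (intro nn_integral_cong nn_integral_cmult W(1) pred_in_edge_tree)
  finally show ?thesis by (simp add: vertex_tree_def)
qed

definition mean_weight :: "nat \<Rightarrow> real \<Rightarrow> real \<Rightarrow> ennreal" where
  "mean_weight n s x = (\<integral>\<^sup>+u. ennreal (tree_weight s (temporal_tree n x u)) \<partial>edge_space n)"

lemma borel_measurable_mean_weight[measurable]: "mean_weight n s \<in> borel_measurable borel"
proof -
  interpret prob_space "edge_space n" by (rule prob_space_edge_space)
  have "(\<lambda>(x, u). ennreal (tree_weight s (temporal_tree n x u))) \<in> borel_measurable (borel \<Otimes>\<^sub>M edge_space n)"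
    using borel_measurable_tree_weight[OF pred_in_pair_tree] by (simp add: case_prod_beta')
  then have "(\<lambda>x. \<integral>\<^sup>+u. ennreal (tree_weight s (temporal_tree n x u)) \<partial>edge_space n) \<in> borel_measurable borel"
    by (rule borel_measurable_nn_integral)
  then show ?thesis unfolding mean_weight_def[abs_def] .
qed

lemma mean_weight_le_1: "0 \<le> s \<Longrightarrow> mean_weight n s x \<le> 1"
proof -
  assume s: "0 \<le> s"
  interpret prob_space "edge_space n" by (rule prob_space_edge_space)
  have "mean_weight n s x \<le> (\<integral>\<^sup>+u. 1 \<partial>edge_space n)"
    unfolding mean_weight_def by (intro nn_integral_mono) (use tree_weight_le_1[OF s] in simp)
  then show ?thesis by (simp add: emeasure_space_1)
qed

lemma mean_weight_eq_integral:
  assumes "uniform_edge_variables M n U" "n \<ge> 1"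
  shows "(\<integral>\<^sup>+\<omega>. ennreal (tree_weight s (temporal_tree n x (\<lambda>e. U e \<omega>))) \<partial>M) = mean_weight n s x"
  unfolding mean_weight_def
  by (rule nn_integral_temporal_tree[OF assms],
      rule measurable_compose[OF borel_measurable_tree_weight[OF pred_in_edge_tree] measurable_ennreal])

text \<open>
  The conditional mean of the weight of a branch given its top label \<open>y\<close>: a branch with \<open>y \<ge> x\<close> is
  cut off when the tree starts from \<open>x\<close>, and then contributes the neutral factor 1.
\<close>

lemma nn_integral_marked_vertex_tree:
  assumes h[measurable]: "h \<in> borel_measurable borel"
  shows "(\<integral>\<^sup>+l. h (l []) * ennreal (if l [] < x then tree_weight s (vertex_tree n l) else 1) \<partial>vertex_space n) =
    (\<integral>\<^sup>+y. h y * (if y < x then mean_weight n s y else 1) \<partial>unif)"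
proof -
  let ?V = "vertex_space n"
  let ?h = "\<lambda>y. indicator {..<x} y * h y" and ?h' = "\<lambda>y. indicator {x..} y * h y"
  interpret E: prob_space "edge_space n" by (rule prob_space_edge_space)
  have h'[measurable]: "?h \<in> borel_measurable borel" "?h' \<in> borel_measurable borel" by measurable
  note [measurable] = borel_measurable_tree_weight[OF pred_in_vertex_tree]
    measurable_compose[OF measurable_root_label h'(1)] measurable_compose[OF measurable_root_label h'(2)]
  have "(\<integral>\<^sup>+l. h (l []) * ennreal (if l [] < x then tree_weight s (vertex_tree n l) else 1) \<partial>?V) =
      (\<integral>\<^sup>+l. ?h (l []) * ennreal (tree_weight s (vertex_tree n l)) + ?h' (l []) * 1 \<partial>?V)"
    by (intro nn_integral_cong) (auto simp: indicator_def)
  also have "\<dots> = (\<integral>\<^sup>+l. ?h (l []) * ennreal (tree_weight s (vertex_tree n l)) \<partial>?V) + (\<integral>\<^sup>+l. ?h' (l []) * 1 \<partial>?V)"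
    by (rule nn_integral_add) measurable
  also have "(\<integral>\<^sup>+l. ?h (l []) * ennreal (tree_weight s (vertex_tree n l)) \<partial>?V) = (\<integral>\<^sup>+y. ?h y * mean_weight n s y \<partial>unif)"
    unfolding mean_weight_def
    by (rule nn_integral_vertex_tree[OF h'(1)];
        rule measurable_compose[OF borel_measurable_tree_weight measurable_ennreal]; simp)
  also have "(\<integral>\<^sup>+l. ?h' (l []) * 1 \<partial>?V) = (\<integral>\<^sup>+y. ?h' y * (\<integral>\<^sup>+u. 1 \<partial>edge_space n) \<partial>unif)"
    by (rule nn_integral_vertex_tree[OF h'(2), of "\<lambda>_. 1"]) auto
  also have "(\<integral>\<^sup>+y. ?h y * mean_weight n s y \<partial>unif) + \<dots> =
      (\<integral>\<^sup>+y. ?h y * mean_weight n s y + ?h' y * (\<integral>\<^sup>+u. 1 \<partial>edge_space n) \<partial>unif)"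
    by (rule nn_integral_add[symmetric]) measurable
  also have "\<dots> = (\<integral>\<^sup>+y. h y * (if y < x then mean_weight n s y else 1) \<partial>unif)"
    by (intro nn_integral_cong) (auto simp: indicator_def E.emeasure_space_1)
  finally show ?thesis .
qed

text \<open>
  The weight is a product over the branches, which are independent and identically distributed, so its
  mean is a power.
\<close>

lemma mean_weight_recursion:
  assumes n: "n \<ge> 1" 
  shows "mean_weight n s x =
    ennreal (exp (- s)) * (\<integral>\<^sup>+y. (if y < x then mean_weight n s y else 1) \<partial>unif) ^ n"
proof -
  let ?V = "vertex_space n"
  interpret V: prob_space ?V by (rule prob_space_vertex_space)
  interpret P: product_sigma_finite "\<lambda>_ :: nat. ?V" ..
  let ?G = "\<lambda>l. ennreal (if l [] < x then tree_weight s (vertex_tree n l) else 1)"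
  have G[measurable]: "?G \<in> borel_measurable ?V"
    using borel_measurable_tree_weight[OF pred_in_vertex_tree] measurable_root_label by simp
  have "mean_weight n s x = (\<integral>\<^sup>+u. ennreal (exp (- s)) * (\<Prod>j<n. ?G (branch n u j)) \<partial>edge_space n)"
    unfolding mean_weight_def
  proof (intro nn_integral_cong)
    fix u :: "nat list \<Rightarrow> real"
    have "temporal_tree n (u [j]) (\<lambda>w. u (j # w)) = vertex_tree n (branch n u j)" for j
      by (rule vertex_tree_branch)
    then show "ennreal (tree_weight s (temporal_tree n x u)) =
        ennreal (exp (- s)) * (\<Prod>j<n. ?G (branch n u j))"
      by (subst tree_weight_decompose)
        (simp add: branch_Nil ennreal_mult'' prod_nonneg tree_weight_nonneg prod_ennreal cong: if_cong)
  qed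
  also have "\<dots> = (\<integral>\<^sup>+u. ennreal (exp (- s)) *
      (\<Prod>j<n. ?G ((\<lambda>j\<in>{..<n}. branch n u j) j)) \<partial>edge_space n)"
    by (intro nn_integral_cong arg_cong2[where f = "(*)"] prod.cong refl) simp
  also have "\<dots> = (\<integral>\<^sup>+w. ennreal (exp (- s)) * (\<Prod>j<n. ?G (w j)) \<partial>PiM {..<n} (\<lambda>_. ?V))"
    by (rule nn_integral_branches[OF uniform_edge_variables_edge_space[OF n] n,
        of "\<lambda>w. ennreal (exp (- s)) * (\<Prod>j<n. ?G (w j))"]) measurable
  also have "\<dots> = ennreal (exp (- s)) * (\<integral>\<^sup>+w. (\<Prod>j<n. ?G (w j)) \<partial>PiM {..<n} (\<lambda>_. ?V))"
    by (rule nn_integral_cmult) measurable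
  also have "(\<integral>\<^sup>+w. (\<Prod>j<n. ?G (w j)) \<partial>PiM {..<n} (\<lambda>_. ?V)) = (\<Prod>j<n. \<integral>\<^sup>+l. ?G l \<partial>?V)"
    by (rule P.product_nn_integral_prod) measurable
  also have "\<dots> = (\<integral>\<^sup>+l. ?G l \<partial>?V) ^ n" by simp
  also have "(\<integral>\<^sup>+l. ?G l \<partial>?V) = (\<integral>\<^sup>+y. (if y < x then mean_weight n s y else 1) \<partial>unif)"
    using nn_integral_marked_vertex_tree[of "\<lambda>_. 1" n x s] by simp
  finally show ?thesis .
qed

section \<open>Expected size\<close>

text \<open>
  The labels on the path to \<open>v\<close> are \<open>length v\<close> independent uniform variables which have to be
  decreasing and below \<open>x\<close>. Conditioning on the first of them, \<open>y\<close>, reduces the length by one and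
  replaces \<open>x\<close> by \<open>y\<close>.
\<close>

lemma prob_in_temporal_tree:
  assumes n: "n \<ge> 1" and x: "0 \<le> x" "x \<le> 1" and v: "v \<in> tree_vertices n"
  shows "(\<integral>\<^sup>+u. indicator (temporal_tree n x u) v \<partial>edge_space n) = ennreal (x ^ length v / fact (length v))"
  using x v
proof (induction v arbitrary: x)
  case Nil
  interpret prob_space "edge_space n" by (rule prob_space_edge_space)
  show ?case by (simp add: emeasure_space_1)
next
  case (Cons j v)
  let ?V = "vertex_space n" and ?k = "length v"
  have j: "j < n" and v: "v \<in> tree_vertices n" using Cons.prems by (auto simp: tree_vertices_def)
  interpret E: prob_space "edge_space n" by (rule prob_space_edge_space)
  have "(\<lambda>z. if v \<in> temporal_tree n (fst z) (snd z) then 1 else 0 :: ennreal)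
      \<in> borel_measurable (borel \<Otimes>\<^sub>M edge_space n)"
    using pred_in_pair_tree by (intro measurable_If) auto
  then have [measurable]: "(\<lambda>y. \<integral>\<^sup>+u. (if v \<in> temporal_tree n y u then 1 else 0) \<partial>edge_space n) \<in> borel_measurable borel"
    by (intro E.borel_measurable_nn_integral) (simp add: case_prod_beta')
  let ?f = "\<lambda>l. indicator {..<x} (l []) * (if v \<in> vertex_tree n l then 1 else 0) :: ennreal"
  have "(\<integral>\<^sup>+u. indicator (temporal_tree n x u) (j # v) \<partial>edge_space n) =
      (\<integral>\<^sup>+u. ?f (branch n u j) \<partial>edge_space n)"
    using j by (intro nn_integral_cong)
      (auto simp: temporal_tree_Cons vertex_tree_branch branch_Nil indicator_def)
  also have "\<dots> = (\<integral>\<^sup>+l. ?f l \<partial>?V)"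
    by (rule nn_integral_branch[OF uniform_edge_variables_edge_space[OF n] j])
       (use pred_in_vertex_tree measurable_compose[OF measurable_root_label, of "indicator {..<x}" borel]
        in \<open>auto intro!: borel_measurable_times_ennreal measurable_If\<close>)
  also have "\<dots> = (\<integral>\<^sup>+y. indicator {..<x} y * (\<integral>\<^sup>+u. (if v \<in> temporal_tree n y u then 1 else 0) \<partial>edge_space n) \<partial>unif)"
    by (rule nn_integral_vertex_tree[of _ "\<lambda>T. if v \<in> T then 1 else 0"]) auto
  also have "\<dots> = (\<integral>\<^sup>+y. indicator {..<x} y * (\<integral>\<^sup>+u. (if v \<in> temporal_tree n y u then 1 else 0) \<partial>edge_space n) * indicator {0..1} y \<partial>lborel)"
    by (rule nn_integral_unif) measurable
  also have "\<dots> = (\<integral>\<^sup>+y. ennreal (y ^ ?k / fact ?k) * indicator {0..x} y \<partial>lborel)"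
  proof (rule nn_integral_cong_AE)
    have "AE y in lborel. y \<noteq> x" by (rule AE_lborel_singleton)
    then show "AE y in lborel. indicator {..<x} y * (\<integral>\<^sup>+u. (if v \<in> temporal_tree n y u then 1 else 0) \<partial>edge_space n) * indicator {0..1} y =
        ennreal (y ^ ?k / fact ?k) * indicator {0..x} y"
    proof eventually_elim
      case (elim y)
      have "(\<integral>\<^sup>+u. (if v \<in> temporal_tree n y u then 1 else 0) \<partial>edge_space n) = ennreal (y ^ ?k / fact ?k)"
        if "0 \<le> y" "y \<le> 1"
        using Cons.IH[OF that v] by (simp add: indicator_def of_bool_def)
      then show ?case using elim Cons.prems by (auto simp: indicator_def)
    qed
  qed
  also have "\<dots> = ennreal (x ^ Suc ?k / fact (Suc ?k) - 0 ^ Suc ?k / fact (Suc ?k))"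
  proof (rule nn_integral_FTC_Icc[where F = "\<lambda>y. y ^ Suc ?k / fact (Suc ?k)"])
    fix y :: real
    have "((\<lambda>y. y ^ Suc ?k / fact (Suc ?k)) has_real_derivative
        (real (Suc ?k) * y ^ (Suc ?k - Suc 0)) / fact (Suc ?k)) (at y)"
      by (rule DERIV_cdivide[OF DERIV_pow])
    moreover have "(real (Suc ?k) * y ^ (Suc ?k - Suc 0)) / fact (Suc ?k) = y ^ ?k / fact ?k"
      by (simp only: fact_Suc diff_Suc_Suc diff_zero) simp
    ultimately show "((\<lambda>y. y ^ Suc ?k / fact (Suc ?k)) has_real_derivative y ^ ?k / fact ?k) (at y)"
      by (simp only:)
  next
    show "0 \<le> y ^ ?k / fact ?k" if "y \<in> {0..x}" for y :: real
      using that by simp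
    show "0 \<le> x" by (rule Cons.prems)
  qed measurable
  finally show ?case by simp
qed

text \<open>
  Each level of the full tree is finite, so expectations can be taken level by level.
\<close>

lemma size_by_levels:
  assumes T: "T \<subseteq> tree_vertices n"
  shows "emeasure (count_space UNIV) T =
    (\<Sum>k. \<Sum>v\<in>{v \<in> tree_vertices n. length v = k}. indicator T v)"
proof -
  let ?L = "\<lambda>k. {v \<in> tree_vertices n. length v = k}"
  have fin: "finite (?L k)" for k
    using finite_lists_length_eq[of "{..<n}" k] by (simp add: tree_vertices_def lists_eq_set)
  have "(\<Sum>k. emeasure (count_space UNIV) (T \<inter> ?L k)) = emeasure (count_space UNIV) (\<Union>k. T \<inter> ?L k)"
    by (rule suminf_emeasure) (auto simp: disjoint_family_on_def)
  also have "(\<Union>k. T \<inter> ?L k) = T" using T by auto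
  finally have "emeasure (count_space UNIV) T = (\<Sum>k. emeasure (count_space UNIV) (T \<inter> ?L k))" ..
  also have "\<dots> = (\<Sum>k. \<Sum>v\<in>?L k. indicator T v)"
  proof (rule suminf_cong)
    fix k
    have "(\<Sum>v\<in>?L k. indicator T v :: ennreal) = of_nat (card (T \<inter> ?L k))"
      using fin[of k] by (simp add: indicator_def sum.If_cases Int_commute)
    then show "emeasure (count_space UNIV) (T \<inter> ?L k) = (\<Sum>v\<in>?L k. indicator T v)"
      using fin[of k] by simp
  qed
  finally show ?thesis .
qed

theorem mean_size_temporal_tree:
  assumes U: "uniform_edge_variables M n U" and n: "n \<ge> 1" and x: "0 \<le> x" "x \<le> 1"
  shows "(\<integral>\<^sup>+\<omega>. emeasure (count_space UNIV) (temporal_tree n x (\<lambda>e. U e \<omega>)) \<partial>M) = ennreal (exp (real n * x))"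
proof -
  let ?L = "\<lambda>k. {v \<in> tree_vertices n. length v = k}"
  have L: "finite (?L k)" "card (?L k) = n ^ k" for k
    using finite_lists_length_eq[of "{..<n}" k] card_lists_length_eq[of "{..<n}" k]
    by (simp_all add: tree_vertices_def lists_eq_set)
  have ind: "(\<lambda>u. indicator (temporal_tree n x u) v :: ennreal) \<in> borel_measurable (edge_space n)" for v
    by (rule borel_measurable_indicator_of_member[OF pred_in_edge_tree])
  have "(\<integral>\<^sup>+\<omega>. emeasure (count_space UNIV) (temporal_tree n x (\<lambda>e. U e \<omega>)) \<partial>M) =
      (\<integral>\<^sup>+u. emeasure (count_space UNIV) (temporal_tree n x u) \<partial>edge_space n)"
    by (rule nn_integral_temporal_tree[OF U n borel_measurable_size[OF pred_in_edge_tree]])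
  also have "\<dots> = (\<integral>\<^sup>+u. (\<Sum>k. \<Sum>v\<in>?L k. indicator (temporal_tree n x u) v) \<partial>edge_space n)"
    by (simp only: size_by_levels[OF temporal_tree_subset])
  also have "\<dots> = (\<Sum>k. \<integral>\<^sup>+u. (\<Sum>v\<in>?L k. indicator (temporal_tree n x u) v) \<partial>edge_space n)"
    by (rule nn_integral_suminf) (intro borel_measurable_sum ind)
  also have "\<dots> = (\<Sum>k. \<Sum>v\<in>?L k. \<integral>\<^sup>+u. indicator (temporal_tree n x u) v \<partial>edge_space n)"
    by (subst nn_integral_sum) (rule ind refl)+
  also have "\<dots> = (\<Sum>k. \<Sum>v\<in>?L k. ennreal (x ^ k / fact k))"
    by (intro suminf_cong sum.cong refl) (auto simp: prob_in_temporal_tree[OF n x])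
  also have "\<dots> = (\<Sum>k. ennreal ((real n * x) ^ k / fact k))"
  proof (rule suminf_cong)
    fix k
    have "(\<Sum>v\<in>?L k. ennreal (x ^ k / fact k)) = of_nat (n ^ k) * ennreal (x ^ k / fact k)"
      by (simp add: L)
    also have "\<dots> = ennreal (real (n ^ k) * (x ^ k / fact k))"
      using x by (subst ennreal_mult) (auto simp: ennreal_of_nat_eq_real_of_nat)
    finally show "(\<Sum>v\<in>?L k. ennreal (x ^ k / fact k)) = ennreal ((real n * x) ^ k / fact k)"
      by (simp add: power_mult_distrib)
  qed
  also have "\<dots> = ennreal (exp (real n * x))"
    using exp_converges[of "real n * x"] x
    by (intro suminf_ennreal_eq) (auto simp: scaleR_conv_of_real divide_inverse mult.commute)
  finally show ?thesis .
qed

lemma AE_finite_temporal_tree: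
  assumes U: "uniform_edge_variables M n U" and n: "n \<ge> 1" and x: "0 \<le> x" "x \<le> 1"
  shows "AE \<omega> in M. finite (temporal_tree n x (\<lambda>e. U e \<omega>))"
proof -
  have meas: "(\<lambda>\<omega>. emeasure (count_space UNIV) (temporal_tree n x (\<lambda>e. U e \<omega>))) \<in> borel_measurable M"
    by (intro borel_measurable_size pred_in_temporal_tree uniform_edge_variables_measurable[OF U]) auto
  have "AE \<omega> in M. emeasure (count_space UNIV) (temporal_tree n x (\<lambda>e. U e \<omega>)) \<noteq> \<infinity>"
    by (rule nn_integral_PInf_AE[OF meas]) (simp add: mean_size_temporal_tree[OF assms])
  then show ?thesis by eventually_elim (auto simp: emeasure_count_space split: if_splits)
qed

section \<open>Logistic asymptotics of the Laplace transform\<close>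

text \<open>
  With \<open>F y = 1 - integral {0..y} (\<lambda>t. 1 - \<Phi> t)\<close> one has \<open>\<Phi> = exp (- s) * F ^ n\<close> and
  \<open>F' = \<Phi> - 1\<close>, so the odds \<open>R = (1 - \<Phi>) / \<Phi>\<close> satisfy \<open>R' = n * R / F\<close>. From \<open>F \<le> 1\<close> it follows
  that \<open>R y * exp (- n * y)\<close> increases, which is the lower bound. The hypothesis on the defect
  \<open>1 - \<Phi>\<close> yields \<open>1 - F y \<le> s * exp (n * y) / n\<close>, hence an upper bound on \<open>1 / F\<close>, and a corrected
  exponential factor makes the product decrease. Both are compared with \<open>R 0 = exp s - 1\<close>, which lies
  between \<open>s\<close> and \<open>s * exp s\<close>.
\<close>

lemma logistic_odds_bounds:
  fixes \<Phi> :: "real \<Rightarrow> real"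
  assumes n: "n \<ge> 1" and s: "0 \<le> s" and x: "0 \<le> x" "x \<le> 1" and q: "s * exp (real n * x) < real n"
    and int: "\<Phi> integrable_on {0..1}" and range: "\<And>y. 0 \<le> \<Phi> y" "\<And>y. \<Phi> y \<le> 1"
    and fixpoint: "\<And>y. 0 \<le> y \<Longrightarrow> y \<le> 1 \<Longrightarrow> \<Phi> y = exp (- s) * (1 - integral {0..y} (\<lambda>t. 1 - \<Phi> t)) ^ n"
    and defect: "\<And>y. 0 \<le> y \<Longrightarrow> y \<le> 1 \<Longrightarrow> 1 - \<Phi> y \<le> s * exp (real n * y)"
  defines "r \<equiv> s * exp (real n * x) / real n"
  shows "0 < \<Phi> x" "s * exp (real n * x) \<le> (1 - \<Phi> x) / \<Phi> x"
    "(1 - \<Phi> x) / \<Phi> x \<le> s * exp (real n * x) * exp (s + r / (1 - r))"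
proof -
  define F where "F y = 1 - integral {0..y} (\<lambda>t. 1 - \<Phi> t)" for y
  have int1: "(\<lambda>t. 1 - \<Phi> t) integrable_on {0..1}"
    using int by (intro integrable_diff) auto
  have contF: "continuous_on {0..1} F"
    unfolding F_def using indefinite_integral_continuous_1[OF int1] by (intro continuous_intros) auto
  have \<Phi>F: "\<Phi> y = exp (- s) * F y ^ n" if "y \<in> {0..1}" for y
    using fixpoint[of y] that by (simp add: F_def)
  have "continuous_on {0..1} (\<lambda>y. exp (- s) * F y ^ n)"
    by (intro continuous_intros contF)
  then have cont\<Phi>: "continuous_on {0..1} \<Phi>"
    by (rule continuous_on_eq) (simp add: \<Phi>F)
  have r: "0 \<le> r" "r < 1" unfolding r_def using s q n by (auto simp: field_simps)
  have F_lower: "1 - s * exp (real n * y) / real n \<le> F y" if "y \<in> {0..1}" for y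
  proof -
    have "((\<lambda>t. s * exp (real n * t)) has_integral s * exp (real n * y) / real n - s * exp (real n * 0) / real n) {0..y}"
    proof (rule fundamental_theorem_of_calculus)
      fix t
      have "((\<lambda>t. s * exp (real n * t) / real n) has_real_derivative s * exp (real n * t)) (at t within {0..y})"
        using n by (auto intro!: derivative_eq_intros)
      then show "((\<lambda>t. s * exp (real n * t) / real n) has_vector_derivative s * exp (real n * t)) (at t within {0..y})"
        by (simp add: has_real_derivative_iff_has_vector_derivative)
    qed (use that in simp)
    moreover have "(\<lambda>t. 1 - \<Phi> t) integrable_on {0..y}"
      by (rule integrable_on_subinterval[OF int1]) (use that in auto)
    ultimately have "integral {0..y} (\<lambda>t. 1 - \<Phi> t) \<le> s * exp (real n * y) / real n - s * exp (real n * 0) / real n"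
      by (intro has_integral_le[OF integrable_integral]) (use defect that in auto)
    moreover have "0 \<le> s / real n" using s by simp
    ultimately show ?thesis unfolding F_def by simp
  qed
  have F_le_1: "F y \<le> 1" if "y \<in> {0..1}" for y
  proof -
    have "0 \<le> integral {0..y} (\<lambda>t. 1 - \<Phi> t)"
    proof (rule Henstock_Kurzweil_Integration.integral_nonneg)
      show "(\<lambda>t. 1 - \<Phi> t) integrable_on {0..y}"
        by (rule integrable_on_subinterval[OF int1]) (use that in auto)
    qed (simp add: range)
    then show ?thesis unfolding F_def by simp
  qed
  have F_pos: "1 - r \<le> F y" "0 < F y" if "y \<in> {0..x}" for y
  proof -
    have "s * exp (real n * y) / real n \<le> r"
      unfolding r_def using that s n by (intro divide_right_mono mult_left_mono) auto
    then show "1 - r \<le> F y" using F_lower[of y] that x by auto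
    then show "0 < F y" using r by linarith
  qed
  have pos: "0 < \<Phi> y" if "y \<in> {0..x}" for y
    using \<Phi>F[of y] F_pos[OF that] that x by simp
  define R where "R y = 1 / \<Phi> y - 1" for y
  have R_eq: "R y = (1 - \<Phi> y) / \<Phi> y" if "y \<in> {0..x}" for y
    using pos[OF that] by (simp add: R_def diff_divide_distrib)
  have R_nonneg: "0 \<le> R y" if "y \<in> {0..x}" for y
    using pos[OF that] range(2)[of y] R_eq[OF that] by simp
  have R0: "R 0 = exp s - 1"
    using \<Phi>F[of 0] by (simp add: R_def F_def exp_minus inverse_eq_divide)
  have contR: "continuous_on {0..x} R"
    unfolding R_def
  proof (intro continuous_intros)
    show "continuous_on {0..x} \<Phi>"
      by (rule continuous_on_subset[OF cont\<Phi>]) (use x in auto)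
    show "\<forall>y\<in>{0..x}. \<Phi> y \<noteq> 0"
      using pos less_imp_neq by fastforce
  qed
  have derivR: "(R has_real_derivative real n * R y / F y) (at y)" if y: "0 < y" "y < x" for y :: real
  proof -
    have nb: "at y within {0..1} = at y"
      using y x by (intro at_within_Icc_at) linarith+
    have "((\<lambda>y. integral {0..y} (\<lambda>t. 1 - \<Phi> t)) has_real_derivative (1 - \<Phi> y)) (at y within {0..1})"
      by (rule integral_has_real_derivative) (use y x cont\<Phi> in \<open>auto intro!: continuous_intros\<close>)
    then have dF: "(F has_real_derivative (\<Phi> y - 1)) (at y)"
      unfolding nb F_def by (auto intro!: derivative_eq_intros)
    have yx: "y \<in> {0..x}" "y \<in> {0..1}" using y x by auto
    have F0: "F y \<noteq> 0" using F_pos(2)[OF yx(1)] by simp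
    have "((\<lambda>y. 1 / (exp (- s) * F y ^ n) - 1) has_real_derivative
        - (exp (- s) * (real n * F y ^ (n - 1) * (\<Phi> y - 1))) / (exp (- s) * F y ^ n)\<^sup>2) (at y)"
      using F0 by (auto intro!: derivative_eq_intros dF simp: power2_eq_square)
    also have "- (exp (- s) * (real n * F y ^ (n - 1) * (\<Phi> y - 1))) / (exp (- s) * F y ^ n)\<^sup>2 =
        real n * R y / F y"
    proof -
      have "F y ^ n = F y * F y ^ (n - 1)" using n by (cases n) auto
      then have "exp (- s) * F y ^ (n - 1) = \<Phi> y / F y"
        using \<Phi>F[OF yx(2)] F0 by (simp add: field_simps)
      then have num: "- (exp (- s) * (real n * F y ^ (n - 1) * (\<Phi> y - 1))) = real n * (1 - \<Phi> y) * (\<Phi> y / F y)"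
        by (simp add: algebra_simps)
      then show ?thesis
        unfolding \<Phi>F[OF yx(2), symmetric] R_eq[OF yx(1)] num using pos[OF yx(1)] F0
        by (simp add: power2_eq_square)
    qed
    finally have d: "((\<lambda>y. 1 / (exp (- s) * F y ^ n) - 1) has_real_derivative real n * R y / F y) (at y)" .
    have "eventually (\<lambda>z. z \<in> {0<..<x}) (nhds y)"
      using y by (intro eventually_nhds_in_open) auto
    then have "eventually (\<lambda>z. R z = 1 / (exp (- s) * F z ^ n) - 1) (nhds y)"
      by eventually_elim (use \<Phi>F x in \<open>auto simp: R_def\<close>)
    then show ?thesis using d by (subst DERIV_cong_ev) auto
  qed
  have exp_s: "s \<le> exp s - 1" "exp s - 1 \<le> s * exp s"
  proof -
    show "s \<le> exp s - 1" using exp_ge_add_one_self[of s] by linarith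
    have "(1 - s) * exp s \<le> exp (- s) * exp s"
      using exp_ge_add_one_self[of "- s"] by (intro mult_right_mono) auto
    moreover have "exp (- s) * exp s = 1" by (simp add: exp_minus)
    ultimately show "exp s - 1 \<le> s * exp s" by (simp add: algebra_simps)
  qed
  have lower: "R 0 * exp (- (real n * 0)) \<le> R x * exp (- (real n * x))"
  proof (cases "x = 0")
    case False
    show ?thesis
    proof (rule DERIV_nonneg_imp_increasing_open[of 0 x "\<lambda>y. R y * exp (- (real n * y))"])
      fix y assume y: "0 < y" "y < x"
      have "((\<lambda>y. R y * exp (- (real n * y))) has_real_derivative
          exp (- (real n * y)) * (real n * R y * (1 / F y - 1))) (at y)"
        by (auto intro!: derivative_eq_intros derivR[OF y] simp: algebra_simps)
      moreover have "0 \<le> exp (- (real n * y)) * (real n * R y * (1 / F y - 1))"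
        using F_pos(2)[of y] F_le_1[of y] R_nonneg[of y] y x
        by (intro mult_nonneg_nonneg) (auto simp: field_simps)
      ultimately show "\<exists>d. ((\<lambda>y. R y * exp (- (real n * y))) has_real_derivative d) (at y) \<and> 0 \<le> d" by blast
    qed (use False x contR in \<open>auto intro!: continuous_intros\<close>)
  qed simp
  (* The exponent below is n y + c s exp (n y) / n, an antiderivative of n + c s exp (n y), which
     bounds n / F from above. *)
  define c where "c = 1 / (1 - r)"
  have c: "c > 0" using r by (simp add: c_def)
  let ?E = "\<lambda>y. real n * y + c * (s * exp (real n * y) / real n)"
  have upper: "R x * exp (- ?E x) \<le> R 0 * exp (- ?E 0)"
  proof (cases "x = 0")
    case False
    show ?thesis
    proof (rule DERIV_nonpos_imp_decreasing_open[of 0 x "\<lambda>y. R y * exp (- ?E y)"])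
      fix y assume y: "0 < y" "y < x"
      have yx: "y \<in> {0..x}" "y \<in> {0..1}" using y x by auto
      have "((\<lambda>y. R y * exp (- ?E y)) has_real_derivative
          exp (- ?E y) * (R y * (real n * (1 / F y - 1) - c * (s * exp (real n * y))))) (at y)"
        using n by (auto intro!: derivative_eq_intros derivR[OF y] simp: algebra_simps)
      moreover have "exp (- ?E y) * (R y * (real n * (1 / F y - 1) - c * (s * exp (real n * y)))) \<le> 0"
      proof -
        have "1 / F y - 1 = (1 - F y) * (1 / F y)" using F_pos(2)[OF yx(1)] by (simp add: field_simps)
        also have "\<dots> \<le> (s * exp (real n * y) / real n) * c"
          unfolding c_def using F_lower[OF yx(2)] F_pos[OF yx(1)] F_le_1[OF yx(2)] r s
          by (intro mult_mono divide_left_mono mult_pos_pos) auto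
        finally have "real n * (1 / F y - 1) \<le> c * (s * exp (real n * y))"
          using n by (simp add: field_simps)
        then show ?thesis using R_nonneg[OF yx(1)] by (intro mult_nonneg_nonpos) auto
      qed
      ultimately show "\<exists>d. ((\<lambda>y. R y * exp (- ?E y)) has_real_derivative d) (at y) \<and> d \<le> 0" by blast
    qed (use False x n contR in \<open>auto intro!: continuous_intros\<close>)
  qed simp
  have xx: "x \<in> {0..x}" using x by simp
  show "0 < \<Phi> x" by (rule pos[OF xx])
  have "s * exp (real n * x) \<le> (exp s - 1) * exp (real n * x)"
    by (rule mult_right_mono) (use exp_s in auto)
  also have "\<dots> \<le> R x * exp (- (real n * x)) * exp (real n * x)"
    using lower R0 by (intro mult_right_mono) auto
  also have "\<dots> = R x" by (simp add: mult.assoc flip: exp_add)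
  finally show "s * exp (real n * x) \<le> (1 - \<Phi> x) / \<Phi> x" using R_eq[OF xx] by simp
  have "R x = R x * exp (- ?E x) * exp (?E x)" by (simp add: mult.assoc flip: exp_add)
  also have "\<dots> \<le> R 0 * exp (- ?E 0) * exp (?E x)"
    by (rule mult_right_mono[OF upper]) simp
  also have "\<dots> \<le> R 0 * 1 * exp (?E x)"
    using R_nonneg[of 0] c s n x by (intro mult_right_mono mult_left_mono) auto
  also have "\<dots> \<le> (s * exp s) * exp (?E x)"
    using exp_s R0 by (intro mult_right_mono) auto
  also have "\<dots> = s * exp (real n * x) * exp (s + r / (1 - r))"
    by (simp add: exp_add c_def r_def mult_ac)
  finally show "(1 - \<Phi> x) / \<Phi> x \<le> s * exp (real n * x) * exp (s + r / (1 - r))"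
    using R_eq[OF xx] by simp
qed

lemma nn_integral_indicator_mean_weight:
  fixes n :: nat and s x :: real
  assumes s: "0 \<le> s" and x: "0 \<le> x" "x \<le> 1"
  defines "\<Phi> \<equiv> \<lambda>y. enn2real (mean_weight n s y)"
  shows "\<Phi> integrable_on {0..1}"
    "(\<integral>\<^sup>+y. (if y < x then mean_weight n s y else 1) \<partial>unif) = ennreal (1 - integral {0..x} (\<lambda>t. 1 - \<Phi> t))"
proof -
  have fin: "mean_weight n s y < \<top>" for y
    using mean_weight_le_1[OF s, of n y] by (simp add: le_less_trans)
  have \<Phi>: "0 \<le> \<Phi> y" "\<Phi> y \<le> 1" "ennreal (\<Phi> y) = mean_weight n s y" for y
    using mean_weight_le_1[OF s, of n y] fin[of y] unfolding \<Phi>_def by (auto simp: enn2real_leI)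
  have [measurable]: "\<Phi> \<in> borel_measurable borel" unfolding \<Phi>_def by measurable
  let ?f = "\<lambda>y. if y < x then \<Phi> y else 1"
  have int: "set_integrable lborel {a..b} g" if "g \<in> borel_measurable borel" "\<And>y. norm (g y) \<le> 1"
    for a b :: real and g :: "real \<Rightarrow> real"
    unfolding set_integrable_def
    by (rule integrableI_bounded_set_indicator[where B = 1]) (use that in \<open>auto simp: emeasure_lborel_Icc_eq\<close>)
  have intf: "set_integrable lborel {0..1} ?f"
    by (rule int) (use \<Phi> in \<open>auto simp: abs_le_iff\<close>)
  have int\<Phi>: "\<Phi> integrable_on {a..b}" for a b
    using set_borel_integral_eq_integral(1)[OF int[of \<Phi>]] \<Phi> by simp
  then show "\<Phi> integrable_on {0..1}" .
  have "(\<integral>\<^sup>+y. (if y < x then mean_weight n s y else 1) \<partial>unif) = (\<integral>\<^sup>+y. ennreal (?f y) \<partial>unif)"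
    by (intro nn_integral_cong) (simp add: \<Phi>)
  also have "\<dots> = (\<integral>\<^sup>+y. ennreal (?f y) * indicator {0..1} y \<partial>lborel)"
    by (rule nn_integral_unif) measurable
  also have "\<dots> = (\<integral>\<^sup>+y. ennreal (indicator {0..1} y *\<^sub>R ?f y) \<partial>lborel)"
    by (intro nn_integral_cong) (auto simp: indicator_def)
  also have "\<dots> = ennreal (LINT y:{0..1}|lborel. ?f y)"
    unfolding set_lebesgue_integral_def
    by (rule nn_integral_eq_integral) (use intf \<Phi> in \<open>auto simp: set_integrable_def\<close>)
  also have "(LINT y:{0..1}|lborel. ?f y) = integral {0..1} ?f"
    by (rule set_borel_integral_eq_integral(2)[OF intf])
  also have "integral {0..1} ?f = integral {0..x} ?f + integral {x..1} ?f"
    using set_borel_integral_eq_integral(1)[OF intf] x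
    by (intro Henstock_Kurzweil_Integration.integral_combine[symmetric]) auto
  also have "integral {0..x} ?f = integral {0..x} \<Phi>"
    by (rule integral_spike[of "{x}"]) auto
  also have "integral {x..1} ?f = integral {x..1} (\<lambda>_. 1)"
    by (rule Henstock_Kurzweil_Integration.integral_cong) auto
  also have "integral {0..x} \<Phi> + \<dots> = 1 - integral {0..x} (\<lambda>t. 1 - \<Phi> t)"
    using x int\<Phi> by (subst Henstock_Kurzweil_Integration.integral_diff) auto
  finally show "(\<integral>\<^sup>+y. (if y < x then mean_weight n s y else 1) \<partial>unif) =
      ennreal (1 - integral {0..x} (\<lambda>t. 1 - \<Phi> t))" .
qed

text \<open>
  The elementary inequality \<open>1 - exp (- s * \<sigma>) \<le> s * \<sigma>\<close>, averaged over the size \<open>\<sigma>\<close> of the tree,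
  whose mean is known.
\<close>

lemma mean_weight_defect:
  assumes n: "n \<ge> 1" and s: "0 \<le> s" and x: "0 \<le> x" "x \<le> 1"
  shows "1 - enn2real (mean_weight n s x) \<le> s * exp (real n * x)"
proof -
  let ?M = "edge_space n" and ?T = "\<lambda>u. temporal_tree n x u"
  interpret prob_space ?M by (rule prob_space_edge_space)
  note U = uniform_edge_variables_edge_space[OF n]
  have fin: "mean_weight n s x < \<top>"
    using mean_weight_le_1[OF s, of n x] by (simp add: le_less_trans)
  have "1 = (\<integral>\<^sup>+u. 1 \<partial>?M)" by (simp add: emeasure_space_1)
  also have "\<dots> \<le> (\<integral>\<^sup>+u. ennreal (tree_weight s (?T u)) + ennreal s * emeasure (count_space UNIV) (?T u) \<partial>?M)"
    using AE_finite_temporal_tree[OF U n x]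
  proof (intro nn_integral_mono_AE, eventually_elim)
    case (elim u)
    have "1 \<le> exp (- s * real (card (?T u))) + s * real (card (?T u))"
      using exp_ge_add_one_self[of "- s * real (card (?T u))"] by simp
    then have "ennreal 1 \<le> ennreal (exp (- s * real (card (?T u))) + s * real (card (?T u)))"
      by (rule ennreal_leI)
    also have "\<dots> = ennreal (tree_weight s (?T u)) + ennreal s * emeasure (count_space UNIV) (?T u)"
      using elim s by (simp add: tree_weight_def ennreal_mult ennreal_of_nat_eq_real_of_nat)
    finally show ?case by simp
  qed
  also have "\<dots> = mean_weight n s x + ennreal s * (\<integral>\<^sup>+u. emeasure (count_space UNIV) (?T u) \<partial>?M)"
  proof -
    have 1: "(\<lambda>u. ennreal (tree_weight s (?T u))) \<in> borel_measurable ?M"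
      by (rule measurable_compose[OF borel_measurable_tree_weight[OF pred_in_edge_tree] measurable_ennreal])
    have 2: "(\<lambda>u. emeasure (count_space UNIV) (?T u)) \<in> borel_measurable ?M"
      by (rule borel_measurable_size[OF pred_in_edge_tree])
    have 3: "(\<lambda>u. ennreal s * emeasure (count_space UNIV) (?T u)) \<in> borel_measurable ?M"
      by (rule borel_measurable_times_ennreal[OF borel_measurable_const 2])
    show ?thesis
      unfolding mean_weight_def nn_integral_add[OF 1 3] nn_integral_cmult[OF 2] ..
  qed
  also have "\<dots> = ennreal (enn2real (mean_weight n s x) + s * exp (real n * x))"
    using mean_size_temporal_tree[OF U n x] s fin by (simp add: ennreal_mult)
  finally have "ennreal 1 \<le> ennreal (enn2real (mean_weight n s x) + s * exp (real n * x))" by simp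
  then have "1 \<le> enn2real (mean_weight n s x) + s * exp (real n * x)"
    using s by (subst (asm) ennreal_le_iff) auto
  then show ?thesis by simp
qed

lemma mean_weight_odds:
  assumes n: "n \<ge> 1" and s: "0 \<le> s" and x: "0 \<le> x" "x \<le> 1" and q: "s * exp (real n * x) < real n"
  defines "r \<equiv> s * exp (real n * x) / real n" and "\<Phi> \<equiv> \<lambda>y. enn2real (mean_weight n s y)"
  shows "0 < \<Phi> x" "s * exp (real n * x) \<le> (1 - \<Phi> x) / \<Phi> x"
    "(1 - \<Phi> x) / \<Phi> x \<le> s * exp (real n * x) * exp (s + r / (1 - r))"
proof -
  have range: "0 \<le> \<Phi> y" "\<Phi> y \<le> 1" for y
    using mean_weight_le_1[OF s, of n y] unfolding \<Phi>_def by (auto simp: enn2real_leI)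
  have int: "\<Phi> integrable_on {0..1}"
    unfolding \<Phi>_def by (rule nn_integral_indicator_mean_weight(1)[OF s x])
  have fixpoint: "\<Phi> y = exp (- s) * (1 - integral {0..y} (\<lambda>t. 1 - \<Phi> t)) ^ n"
    if y: "0 \<le> y" "y \<le> 1" for y :: real
  proof -
    let ?I = "integral {0..y} (\<lambda>t. 1 - \<Phi> t)"
    have "(\<lambda>t. 1 - \<Phi> t) integrable_on {0..1}"
      using int by (intro integrable_diff) auto
    then have "(\<lambda>t. 1 - \<Phi> t) integrable_on {0..y}"
      by (rule integrable_on_subinterval) (use y in auto)
    then have "?I \<le> integral {0..y} (\<lambda>t. 1)"
      by (rule integral_le) (use range in auto)
    then have I: "0 \<le> 1 - ?I" using y by simp
    have "mean_weight n s y = ennreal (exp (- s)) * ennreal (1 - ?I) ^ n"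
      by (subst mean_weight_recursion[OF n])
        (simp only: nn_integral_indicator_mean_weight(2)[OF s y] \<Phi>_def)
    also have "\<dots> = ennreal (exp (- s) * (1 - ?I) ^ n)"
      using I by (simp add: ennreal_power ennreal_mult'')
    finally show ?thesis
      using I by (simp add: \<Phi>_def)
  qed
  have defect: "1 - \<Phi> y \<le> s * exp (real n * y)" if "0 \<le> y" "y \<le> 1" for y
    unfolding \<Phi>_def by (rule mean_weight_defect[OF n s that])
  note * = logistic_odds_bounds[OF n s x q int range fixpoint defect]
  show "0 < \<Phi> x" by (rule *(1))
  show "s * exp (real n * x) \<le> (1 - \<Phi> x) / \<Phi> x" by (rule *(2))
  show "(1 - \<Phi> x) / \<Phi> x \<le> s * exp (real n * x) * exp (s + r / (1 - r))"
    unfolding r_def by (rule *(3))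
qed

lemma scaled_defect_tendsto_1:
  fixes a :: "nat \<Rightarrow> real"
  assumes "(\<lambda>n. real n * (1 - a n)) \<longlonglongrightarrow> t"
  shows "a \<longlonglongrightarrow> 1"
proof -
  have "(\<lambda>n. 1 - real n * (1 - a n) * (1 / real n)) \<longlonglongrightarrow> 1 - t * 0"
    by (intro tendsto_diff tendsto_const tendsto_mult assms lim_1_over_n)
  then have "a \<longlonglongrightarrow> 1 - t * 0"
  proof (rule Lim_transform_eventually)
    show "eventually (\<lambda>n. 1 - real n * (1 - a n) * (1 / real n) = a n) sequentially"
      using eventually_gt_at_top[of 0] by eventually_elim simp
  qed
  then show ?thesis by simp
qed

text \<open>
  A start label \<open>p - t / n\<close> changes \<open>s * exp (n * x)\<close> from \<open>l\<close> to \<open>l * exp (- t)\<close>, so the normalised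
  size is asymptotically exponential with mean \<open>exp (- t)\<close>. The start label is written as
  \<open>a n - (1 - p)\<close> because \<open>a n\<close> is the label after rotation.
\<close>

lemma mean_weight_limit:
  fixes a :: "nat \<Rightarrow> real"
  assumes p: "0 < p" "p \<le> 1" and l: "0 \<le> l" and lim: "(\<lambda>n. real n * (1 - a n)) \<longlonglongrightarrow> t"
    and a: "\<And>n. a n \<le> 1"
  shows "(\<lambda>n. mean_weight n (l * exp (- (real n * p))) (a n - (1 - p))) \<longlonglongrightarrow> ennreal (1 / (1 + l * exp (- t)))"
proof -
  define s where "s n = l * exp (- (real n * p))" for n
  define x where "x n = a n - (1 - p)" for n
  define q where "q n = s n * exp (real n * x n)" for n
  define \<Phi> where "\<Phi> n = enn2real (mean_weight n (s n) (x n))" for n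
  have q_eq: "q n = l * exp (- (real n * (1 - a n)))" for n
    unfolding q_def s_def x_def by (simp add: algebra_simps flip: exp_add)
  have q: "q \<longlonglongrightarrow> l * exp (- t)"
    unfolding q_eq[abs_def] by (intro tendsto_intros lim)
  have "(\<lambda>n. 1 - a n) \<longlonglongrightarrow> 1 - 1"
    by (intro tendsto_intros scaled_defect_tendsto_1[OF lim])
  then have "eventually (\<lambda>n. 1 - a n < p) sequentially"
    by (rule order_tendstoD(2)) (use p in simp)
  then have x_ev: "eventually (\<lambda>n. 0 \<le> x n) sequentially"
    by eventually_elim (simp add: x_def)
  have r: "(\<lambda>n. q n / real n) \<longlonglongrightarrow> 0"
    using tendsto_mult[OF q lim_1_over_n] by simp
  have r_ev: "eventually (\<lambda>n. q n < real n) sequentially"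
    using order_tendstoD(2)[OF r zero_less_one] eventually_gt_at_top[of 0]
    by eventually_elim (simp add: field_simps)
  have "0 \<le> exp (- p)" "exp (- p) < 1" using p by simp_all
  then have "(\<lambda>n. exp (- p) ^ n) \<longlonglongrightarrow> 0" by (rule LIMSEQ_realpow_zero)
  then have "(\<lambda>n. l * exp (- p) ^ n) \<longlonglongrightarrow> l * 0" by (rule tendsto_mult_left)
  moreover have "l * exp (- p) ^ n = s n" for n
    by (simp add: s_def exp_of_nat_mult[symmetric])
  ultimately have s: "s \<longlonglongrightarrow> 0" by simp
  have s_nonneg: "0 \<le> s n" for n using l by (simp add: s_def)
  let ?R = "\<lambda>n. (1 - \<Phi> n) / \<Phi> n"
  have bounds: "eventually (\<lambda>n. 0 < \<Phi> n \<and> q n \<le> ?R n \<and>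
      ?R n \<le> q n * exp (s n + q n / real n / (1 - q n / real n))) sequentially"
    using x_ev r_ev eventually_ge_at_top[of 1]
  proof eventually_elim
    case (elim n)
    have "x n \<le> 1" using a[of n] p by (simp add: x_def)
    from mean_weight_odds[OF elim(3) s_nonneg elim(1) this] elim(2)
    show ?case by (simp add: q_def \<Phi>_def)
  qed
  have "?R \<longlonglongrightarrow> l * exp (- t)"
  proof (rule tendsto_sandwich[OF _ _ q])
    have "(\<lambda>n. q n * exp (s n + q n / real n / (1 - q n / real n))) \<longlonglongrightarrow> l * exp (- t) * exp (0 + 0 / (1 - 0))"
      by (intro tendsto_intros q s r) auto
    then show "(\<lambda>n. q n * exp (s n + q n / real n / (1 - q n / real n))) \<longlonglongrightarrow> l * exp (- t)" by simp
  qed (use bounds in \<open>auto elim: eventually_mono\<close>)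
  then have "(\<lambda>n. 1 / (1 + ?R n)) \<longlonglongrightarrow> 1 / (1 + l * exp (- t))"
    using l by (intro tendsto_intros) (auto simp: add_nonneg_eq_0_iff)
  then have "\<Phi> \<longlonglongrightarrow> 1 / (1 + l * exp (- t))"
  proof (rule Lim_transform_eventually)
    show "eventually (\<lambda>n. 1 / (1 + ?R n) = \<Phi> n) sequentially"
      using bounds by eventually_elim (auto simp: field_simps)
  qed
  then have "(\<lambda>n. ennreal (\<Phi> n)) \<longlonglongrightarrow> ennreal (1 / (1 + l * exp (- t)))"
    by (rule tendsto_ennrealI)
  moreover have "ennreal (\<Phi> n) = mean_weight n (s n) (x n)" for n
    unfolding \<Phi>_def
    by (intro ennreal_enn2real le_less_trans[OF mean_weight_le_1[OF s_nonneg]]) simp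
  ultimately show ?thesis by (simp add: s_def x_def)
qed

text \<open>
  For \<open>c = 0\<close> this is the derivative of \<open>h \<mapsto> v powr h\<close> at 0. The offset \<open>c\<close> counts the labels that
  have already been removed.
\<close>

lemma tendsto_root_defect:
  assumes v: "0 < v"
  shows "(\<lambda>n. real n * (1 - root (n - c) v)) \<longlonglongrightarrow> - ln v"
proof (rule LIMSEQ_offset[where k = c])
  have "((\<lambda>h. exp (h * ln v)) has_real_derivative exp (0 * ln v) * ln v) (at 0)"
    by (auto intro!: derivative_eq_intros)
  then have "((\<lambda>h. (exp (h * ln v) - 1) / h) \<longlongrightarrow> ln v) (at 0)"
    by (simp add: has_field_derivative_iff)
  moreover have "filterlim (\<lambda>n. 1 / real n) (at 0) sequentially"
    by (rule filterlim_atI[OF lim_1_over_n]) (auto intro: eventually_mono[OF eventually_gt_at_top[of 0]])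
  ultimately have "(\<lambda>n. (exp (1 / real n * ln v) - 1) / (1 / real n)) \<longlonglongrightarrow> ln v"
    by (rule filterlim_compose)
  then have 1: "(\<lambda>n. - ((exp (1 / real n * ln v) - 1) / (1 / real n))) \<longlonglongrightarrow> - ln v"
    by (rule tendsto_minus)
  have "(\<lambda>n. exp (1 / real n * ln v)) \<longlonglongrightarrow> exp (0 * ln v)"
    by (intro tendsto_intros lim_1_over_n)
  then have 2: "(\<lambda>n. real c * (1 - exp (1 / real n * ln v))) \<longlonglongrightarrow> real c * (1 - exp (0 * ln v))"
    by (intro tendsto_intros)
  have "(\<lambda>n. - ((exp (1 / real n * ln v) - 1) / (1 / real n)) + real c * (1 - exp (1 / real n * ln v)))
      \<longlonglongrightarrow> - ln v"
    using tendsto_add[OF 1 2] by simp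
  then show "(\<lambda>n. real (n + c) * (1 - root (n + c - c) v)) \<longlonglongrightarrow> - ln v"
  proof (rule Lim_transform_eventually)
    show "eventually (\<lambda>n. - ((exp (1 / real n * ln v) - 1) / (1 / real n)) + real c * (1 - exp (1 / real n * ln v))
        = real (n + c) * (1 - root (n + c - c) v)) sequentially"
      using eventually_gt_at_top[of 0]
    proof eventually_elim
      case (elim n)
      have "root n v = exp (1 / real n * ln v)"
        using elim v by (simp add: root_powr_inverse powr_def)
      then show ?case using elim by (simp add: algebra_simps)
    qed
  qed
qed

text \<open>
  The conditional Laplace transform of the normalised size of a branch given its rotated label \<open>a\<close>.
  Branches with \<open>a < 1 - p\<close> are cut and have size 0.
\<close>

definition branch_transform :: "real \<Rightarrow> nat \<Rightarrow> real \<Rightarrow> real \<Rightarrow> ennreal" where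
  "branch_transform p n l a =
     (if 1 - p \<le> a then mean_weight n (l * exp (- (real n * p))) (a - (1 - p)) else 1)"

lemma borel_measurable_branch_transform[measurable]: "branch_transform p n l \<in> borel_measurable borel"
  unfolding branch_transform_def[abs_def] by measurable

lemma branch_transform_le_1: "0 \<le> l \<Longrightarrow> branch_transform p n l a \<le> 1"
  by (simp add: branch_transform_def mean_weight_le_1)

lemma top_marks_le_1:
  assumes "\<And>l a. l \<in> set ls \<Longrightarrow> \<psi> l a \<le> 1"
  shows "top_marks \<psi> ls k a \<le> 1"
  using assms
proof (induction ls arbitrary: k a)
  case (Cons l ls)
  interpret prob_space unif by (rule prob_space_unif)
  have "top_marks \<psi> (l # ls) k a \<le> (\<integral>\<^sup>+v. 1 * 1 \<partial>unif)"
    unfolding top_marks.simps using Cons by (intro nn_integral_mono mult_mono) auto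
  then show ?case using emeasure_space_1 by simp
qed simp

text \<open>
  The limit of the recursion of \<open>top_marks\<close>: \<open>y\<close> is the product of the uniform factors chosen so far,
  and \<open>1 / (1 + l * (y * v))\<close> is the Laplace transform at \<open>l\<close> of an exponential variable with mean
  \<open>y * v\<close>.
\<close>

primrec limit_transform :: "real list \<Rightarrow> real \<Rightarrow> ennreal" where
  "limit_transform [] y = 1"
| "limit_transform (l # ls) y =
     (\<integral>\<^sup>+v. ennreal (1 / (1 + l * (y * v))) * limit_transform ls (y * v) \<partial>unif)"

lemma borel_measurable_limit_transform[measurable]: "limit_transform ls \<in> borel_measurable borel"
proof (induction ls)
  case (Cons l ls)
  interpret prob_space unif by (rule prob_space_unif)
  note Cons[measurable]
  have "(\<lambda>y. \<integral>\<^sup>+v. ennreal (1 / (1 + l * (y * v))) * limit_transform ls (y * v) \<partial>unif) \<in> borel_measurable borel"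
    by measurable
  moreover have "limit_transform (l # ls) =
      (\<lambda>y. \<integral>\<^sup>+v. ennreal (1 / (1 + l * (y * v))) * limit_transform ls (y * v) \<partial>unif)"
    by (rule ext) simp
  ultimately show ?case by simp
next
  case Nil
  have "limit_transform [] = (\<lambda>_. 1)" by (rule ext) simp
  then show ?case by simp
qed

lemma AE_unif_positive: "AE v in unif. 0 < v \<and> v \<le> 1"
proof (rule AE_uniform_measureI)
  show "AE v in lborel. v \<in> {0..1} \<longrightarrow> 0 < v \<and> v \<le> (1 :: real)"
    using AE_lborel_singleton[of "0 :: real"] by eventually_elim auto
qed simp

lemma limit_transform_le_1:
  assumes "\<And>l. l \<in> set ls \<Longrightarrow> 0 \<le> l" "0 \<le> y"
  shows "limit_transform ls y \<le> 1"
  using assms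
proof (induction ls arbitrary: y)
  case (Cons l ls)
  interpret prob_space unif by (rule prob_space_unif)
  have "limit_transform (l # ls) y \<le> (\<integral>\<^sup>+v. 1 * 1 \<partial>unif)"
    unfolding limit_transform.simps
  proof (rule nn_integral_mono_AE)
    show "AE v in unif. ennreal (1 / (1 + l * (y * v))) * limit_transform ls (y * v) \<le> 1 * 1"
      using AE_unif_positive
    proof eventually_elim
      case (elim v)
      have "0 \<le> l * (y * v)"
        using Cons.prems elim by (intro mult_nonneg_nonneg) auto
      then have "ennreal (1 / (1 + l * (y * v))) \<le> ennreal 1"
        by (intro ennreal_leI) simp
      moreover have "limit_transform ls (y * v) \<le> 1"
        by (rule Cons.IH) (use Cons.prems elim in auto)
      ultimately show ?case by (intro mult_mono) auto
    qed
  qed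
  then show ?case using emeasure_space_1 by simp
qed simp

text \<open>
  Labels at distance \<open>t / n\<close> from the top of the interval correspond to the accumulated factor
  \<open>exp (- t)\<close>. Passing from \<open>a n\<close> to the next label \<open>a n * root (n - c) v\<close> adds \<open>- ln v\<close> to \<open>t\<close>,
  that is, multiplies the factor by \<open>v\<close>. All transforms are at most 1, so the integrals converge by
  domination.
\<close>

theorem top_marks_limit:
  fixes a :: "nat \<Rightarrow> real"
  assumes p: "0 < p" "p \<le> 1" and ls: "\<And>l. l \<in> set ls \<Longrightarrow> 0 \<le> l"
    and lim: "(\<lambda>n. real n * (1 - a n)) \<longlonglongrightarrow> t" and a: "\<And>n. a n \<le> 1"
  shows "(\<lambda>n. top_marks (branch_transform p n) ls (n - c) (a n)) \<longlonglongrightarrow> limit_transform ls (exp (- t))"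
  using ls lim a
proof (induction ls arbitrary: a t c)
  case (Cons l ls)
  interpret prob_space unif by (rule prob_space_unif)
  let ?\<psi> = "branch_transform p"
  have l: "0 \<le> l" using Cons.prems by simp
  have "(\<lambda>n. \<integral>\<^sup>+v. ?\<psi> n l (a n * root (n - c) v) * top_marks (?\<psi> n) ls (n - c - 1) (a n * root (n - c) v) \<partial>unif)
    \<longlonglongrightarrow> (\<integral>\<^sup>+v. ennreal (1 / (1 + l * (exp (- t) * v))) * limit_transform ls (exp (- t) * v) \<partial>unif)"
  proof (rule nn_integral_dominated_convergence[where w = "\<lambda>_. 1"])
    show "AE v in unif. ?\<psi> n l (a n * root (n - c) v) * top_marks (?\<psi> n) ls (n - c - 1) (a n * root (n - c) v) \<le> 1" for n
    proof -
      have "?\<psi> n l x * top_marks (?\<psi> n) ls (n - c - 1) x \<le> 1 * 1" for x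
        by (intro mult_mono branch_transform_le_1 top_marks_le_1) (use Cons.prems in auto)
      then show ?thesis by simp
    qed
    show "AE v in unif. (\<lambda>n. ?\<psi> n l (a n * root (n - c) v) * top_marks (?\<psi> n) ls (n - c - 1) (a n * root (n - c) v))
        \<longlonglongrightarrow> ennreal (1 / (1 + l * (exp (- t) * v))) * limit_transform ls (exp (- t) * v)"
      using AE_unif_positive
    proof eventually_elim
      case (elim v)
      define b where "b n = a n * root (n - c) v" for n
      note a1 = scaled_defect_tendsto_1[OF Cons.prems(2)]
      have "(\<lambda>n. real n * (1 - a n) + a n * (real n * (1 - root (n - c) v))) \<longlonglongrightarrow> t + 1 * (- ln v)"
        by (intro tendsto_intros Cons.prems a1 tendsto_root_defect) (use elim in auto)
      then have b: "(\<lambda>n. real n * (1 - b n)) \<longlonglongrightarrow> t - ln v"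
        by (simp add: b_def algebra_simps)
      have b_le: "b n \<le> 1" for n
      proof -
        have "0 \<le> root (n - c) v" "root (n - c) v \<le> 1"
          using elim by (cases "n - c = 0"; simp)+
        then show ?thesis
          using Cons.prems(3)[of n] mult_mono[of "a n" 1 "root (n - c) v" 1] by (simp add: b_def)
      qed
      have "eventually (\<lambda>n. 1 - p < b n) sequentially"
        by (rule order_tendstoD(1)[OF scaled_defect_tendsto_1[OF b]]) (use p in simp)
      then have b_ev: "eventually (\<lambda>n. 1 - p \<le> b n) sequentially"
        by (rule eventually_mono) simp
      (* The next factor is exp (- t) v: this is where the uniform variables of the limit arise. *)
      have expv: "exp (- (t - ln v)) = exp (- t) * v"
        using elim by (simp add: exp_diff exp_minus field_simps)
      have "(\<lambda>n. mean_weight n (l * exp (- (real n * p))) (b n - (1 - p))) \<longlonglongrightarrow>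
          ennreal (1 / (1 + l * (exp (- t) * v)))"
        using mean_weight_limit[OF p l b b_le] unfolding expv by simp
      then have 1: "(\<lambda>n. ?\<psi> n l (b n)) \<longlonglongrightarrow> ennreal (1 / (1 + l * (exp (- t) * v)))"
      proof (rule Lim_transform_eventually)
        show "eventually (\<lambda>n. mean_weight n (l * exp (- (real n * p))) (b n - (1 - p)) = ?\<psi> n l (b n)) sequentially"
          using b_ev by eventually_elim (simp add: branch_transform_def)
      qed
      have 2: "(\<lambda>n. top_marks (?\<psi> n) ls (n - Suc c) (b n)) \<longlonglongrightarrow> limit_transform ls (exp (- t) * v)"
        using Cons.IH[OF _ b b_le, of "Suc c"] Cons.prems(1) unfolding expv by simp
      have "limit_transform ls (exp (- t) * v) \<le> 1"
        by (rule limit_transform_le_1) (use Cons.prems(1) elim in auto)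
      then have fin: "limit_transform ls (exp (- t) * v) \<noteq> \<top>" by (auto simp: top_unique)
      show ?case
        using tendsto_mult_ennreal[OF 1 2] fin by (simp add: b_def)
    qed
    show "(\<integral>\<^sup>+v. 1 \<partial>unif) < \<infinity>" using emeasure_space_1 by simp
  qed measurable
  then show ?case by simp
qed simp

section \<open>Laplace transform of the limit vector\<close>

text \<open>
  Coordinate \<open>Inl k\<close> stands for the exponential and \<open>Inr k\<close> for the uniform variable of index \<open>k\<close>.
  The start index \<open>c\<close> and the factor \<open>y\<close> make the first summand separable
  (\<open>weighted_sum_Cons\<close>), so that no re-indexing of the variables is needed in the induction.
\<close>

definition weighted_sum :: "real list \<Rightarrow> nat \<Rightarrow> real \<Rightarrow> (nat + nat \<Rightarrow> real) \<Rightarrow> real" where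
  "weighted_sum ls c y w = (\<Sum>i<length ls. ls ! i * (w (Inl (c + i)) * (y * (\<Prod>j\<le>i. w (Inr (c + j))))))"

lemma weighted_sum_Cons:
  "weighted_sum (l # ls) c y w =
     l * (w (Inl c) * (y * w (Inr c))) + weighted_sum ls (Suc c) (y * w (Inr c)) w"
  unfolding weighted_sum_def
  by (simp add: sum.lessThan_Suc_shift prod.atMost_Suc_shift mult.assoc del: sum.lessThan_Suc prod.atMost_Suc)

abbreviation unit_exponential :: "real measure" where
  "unit_exponential \<equiv> density lborel (exponential_density 1)"

definition exp_unif_law :: "nat + nat \<Rightarrow> real measure" where
  "exp_unif_law = case_sum (\<lambda>_. unit_exponential) (\<lambda>_. unif)"

lemma exp_unif_law_simps[simp]: "exp_unif_law (Inl k) = unit_exponential" "exp_unif_law (Inr k) = unif"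
  by (simp_all add: exp_unif_law_def)

lemma prob_space_exp_unif_law: "prob_space (exp_unif_law k)"
  using prob_space_exponential_density[of 1] prob_space_unif by (cases k) auto

lemma sets_exp_unif_law[measurable_cong]: "sets (exp_unif_law k) = sets borel"
  by (cases k) auto

lemma laplace_unit_exponential:
  assumes c: "0 \<le> c"
  shows "(\<integral>\<^sup>+e. ennreal (exp (- (c * e))) \<partial>unit_exponential) = ennreal (1 / (1 + c))"
proof -
  have "(\<integral>\<^sup>+e. ennreal (exp (- (c * e))) \<partial>unit_exponential) =
      (\<integral>\<^sup>+e. ennreal (exponential_density 1 e) * ennreal (exp (- (c * e))) \<partial>lborel)"
    by (rule nn_integral_density) auto
  also have "\<dots> = (\<integral>\<^sup>+e. ennreal (1 / (1 + c)) * ennreal (exponential_density (1 + c) e) \<partial>lborel)"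
  proof (intro nn_integral_cong)
    fix e :: real
    have "exponential_density 1 e * exp (- (c * e)) = 1 / (1 + c) * exponential_density (1 + c) e"
      using c by (simp add: exponential_density_def distrib_left mult.commute flip: exp_add)
    then show "ennreal (exponential_density 1 e) * ennreal (exp (- (c * e))) =
        ennreal (1 / (1 + c)) * ennreal (exponential_density (1 + c) e)"
      using c exponential_density_nonneg[of 1 e] exponential_density_nonneg[of "1 + c" e]
      by (simp only: ennreal_mult[symmetric] exp_ge_zero zero_le_divide_1_iff)
  qed
  also have "\<dots> = ennreal (1 / (1 + c)) * (\<integral>\<^sup>+e. ennreal (exponential_density (1 + c) e) \<partial>lborel)"
    by (rule nn_integral_cmult) auto
  also have "(\<integral>\<^sup>+e. ennreal (exponential_density (1 + c) e) \<partial>lborel) = 1"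
    using prob_space.emeasure_space_1[OF prob_space_exponential_density[of "1 + c"]] c
    by (simp add: emeasure_density)
  finally show ?thesis by simp
qed

lemma measurable_weighted_sum:
  assumes "\<And>i. i < length ls \<Longrightarrow> Inl (c + i) \<in> J \<and> Inr (c + i) \<in> J"
    "y \<in> borel_measurable (PiM J exp_unif_law)"
  shows "(\<lambda>w. weighted_sum ls c (y w) w) \<in> borel_measurable (PiM J exp_unif_law)"
proof -
  have "(\<lambda>w. w k) \<in> borel_measurable (PiM J exp_unif_law)" if "k \<in> J" for k
    using measurable_component_singleton[OF that, of exp_unif_law]
      measurable_cong_sets[OF refl sets_exp_unif_law[of k]] by blast
  then show ?thesis
    unfolding weighted_sum_def using assms
    by (intro borel_measurable_sum borel_measurable_times borel_measurable_prod borel_measurable_const) auto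
qed

text \<open>
  Integrating out the exponential variable of index \<open>c\<close> gives the factor \<open>1 / (1 + l * (y * v))\<close>,
  where \<open>v\<close> is the uniform variable of the same index; the remaining sum has \<open>y * v\<close> in place of \<open>y\<close>.
  This is the recursion that defines \<open>limit_transform\<close>.
\<close>

lemma laplace_weighted_sum:
  assumes "\<And>l. l \<in> set ls \<Longrightarrow> 0 \<le> l" "0 \<le> y"
  shows "(\<integral>\<^sup>+w. ennreal (exp (- weighted_sum ls c y w)) \<partial>PiM ({c..<c + length ls} <+> {c..<c + length ls}) exp_unif_law) =
    limit_transform ls y"
  using assms
proof (induction ls arbitrary: c y)
  case Nil
  interpret prob_space "PiM {} exp_unif_law" by (rule prob_space_PiM) simp
  have J: "{c..<c + length ([] :: real list)} <+> {c..<c + length ([] :: real list)} = {}" by auto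
  show ?case unfolding J using emeasure_space_1 by (simp add: weighted_sum_def)
next
  case (Cons l ls)
  interpret product_sigma_finite exp_unif_law
    by (intro product_sigma_finite.intro prob_space_imp_sigma_finite prob_space_exp_unif_law)
  let ?J = "{Suc c..<Suc c + length ls} <+> {Suc c..<Suc c + length ls}"
  let ?J1 = "insert (Inl c) ?J"
  have J: "{c..<c + length (l # ls)} <+> {c..<c + length (l # ls)} = insert (Inr c) ?J1"
  proof -
    have "{c..<c + length (l # ls)} = insert c {Suc c..<Suc c + length ls}" by auto
    then show ?thesis by (auto simp: Plus_def)
  qed
  have fin: "finite ?J" "finite ?J1" "Inr c \<notin> ?J1" "Inl c \<notin> ?J" by auto
  have meas: "(\<lambda>w. ennreal (exp (- weighted_sum (l # ls) c y w))) \<in> borel_measurable (PiM (insert (Inr c) ?J1) exp_unif_law)"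
  proof -
    have "(\<lambda>w. weighted_sum (l # ls) c y w) \<in> borel_measurable (PiM (insert (Inr c) ?J1) exp_unif_law)"
      unfolding J[symmetric] by (rule measurable_weighted_sum) (auto simp: Plus_def)
    then show ?thesis by measurable
  qed
  have inner: "(\<integral>\<^sup>+w. ennreal (exp (- weighted_sum (l # ls) c y (w(Inr c := v)))) \<partial>PiM ?J1 exp_unif_law) =
      ennreal (1 / (1 + l * (y * v))) * limit_transform ls (y * v)" if v: "0 \<le> v" for v
  proof -
    let ?f = "\<lambda>w. ennreal (exp (- (l * (w (Inl c) * (y * v))))) * ennreal (exp (- weighted_sum ls (Suc c) (y * v) w))"
    have measf: "?f \<in> borel_measurable (PiM ?J1 exp_unif_law)"
    proof -
      have "(\<lambda>w. weighted_sum ls (Suc c) (y * v) w) \<in> borel_measurable (PiM ?J1 exp_unif_law)"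
        by (rule measurable_weighted_sum) (auto simp: Plus_def)
      moreover have "(\<lambda>w. w (Inl c)) \<in> borel_measurable (PiM ?J1 exp_unif_law)"
        using measurable_component_singleton[of "Inl c" ?J1 exp_unif_law]
          measurable_cong_sets[OF refl sets_exp_unif_law[of "Inl c"]] by blast
      ultimately show ?thesis by measurable
    qed
    have measJ: "(\<lambda>w. ennreal (exp (- weighted_sum ls (Suc c) (y * v) w))) \<in> borel_measurable (PiM ?J exp_unif_law)"
    proof -
      have "(\<lambda>w. weighted_sum ls (Suc c) (y * v) w) \<in> borel_measurable (PiM ?J exp_unif_law)"
        by (rule measurable_weighted_sum) (auto simp: Plus_def)
      then show ?thesis by measurable
    qed
    have upd: "weighted_sum ls (Suc c) z (w(k := u)) = weighted_sum ls (Suc c) z w"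
      if "k = Inl c \<or> k = Inr c" for z w k u
      using that by (auto simp: weighted_sum_def)
    have "(\<integral>\<^sup>+w. ennreal (exp (- weighted_sum (l # ls) c y (w(Inr c := v)))) \<partial>PiM ?J1 exp_unif_law) =
        (\<integral>\<^sup>+w. ?f w \<partial>PiM ?J1 exp_unif_law)"
      by (intro nn_integral_cong) (simp add: weighted_sum_Cons upd exp_add[symmetric] ennreal_mult''[symmetric])
    also have "\<dots> = (\<integral>\<^sup>+e. \<integral>\<^sup>+w. ?f (w(Inl c := e)) \<partial>PiM ?J exp_unif_law \<partial>exp_unif_law (Inl c))"
      by (rule product_nn_integral_insert_rev[OF fin(1,4) measf])
    also have "\<dots> = (\<integral>\<^sup>+e. ennreal (exp (- (l * (e * (y * v))))) *
        (\<integral>\<^sup>+w. ennreal (exp (- weighted_sum ls (Suc c) (y * v) w)) \<partial>PiM ?J exp_unif_law) \<partial>unit_exponential)"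
      unfolding exp_unif_law_simps nn_integral_cmult[OF measJ, symmetric]
      by (intro nn_integral_cong) (simp add: upd)
    also have "\<dots> = (\<integral>\<^sup>+e. ennreal (exp (- (l * (y * v) * e))) * limit_transform ls (y * v) \<partial>unit_exponential)"
      using Cons.IH[of "y * v" "Suc c"] Cons.prems v by (simp add: mult_ac)
    also have "\<dots> = (\<integral>\<^sup>+e. ennreal (exp (- (l * (y * v) * e))) \<partial>unit_exponential) * limit_transform ls (y * v)"
      by (rule nn_integral_multc) auto
    also have "(\<integral>\<^sup>+e. ennreal (exp (- (l * (y * v) * e))) \<partial>unit_exponential) = ennreal (1 / (1 + l * (y * v)))"
      by (rule laplace_unit_exponential) (use Cons.prems v in auto)
    finally show ?thesis .
  qed
  have "(\<integral>\<^sup>+w. ennreal (exp (- weighted_sum (l # ls) c y w)) \<partial>PiM (insert (Inr c) ?J1) exp_unif_law) =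
     (\<integral>\<^sup>+v. \<integral>\<^sup>+w. ennreal (exp (- weighted_sum (l # ls) c y (w(Inr c := v)))) \<partial>PiM ?J1 exp_unif_law \<partial>exp_unif_law (Inr c))"
    by (rule product_nn_integral_insert_rev[OF fin(2,3) meas])
  also have "\<dots> = (\<integral>\<^sup>+v. ennreal (1 / (1 + l * (y * v))) * limit_transform ls (y * v) \<partial>unif)"
    unfolding exp_unif_law_simps using AE_unif_positive
    by (intro nn_integral_cong_AE, eventually_elim) (rule inner, simp)
  finally show ?case unfolding J by simp
qed

lemma exponential_uniform_family_measurable:
  assumes "exponential_uniform_family N E V" "k \<ge> 1"
  shows "E k \<in> borel_measurable N" "V k \<in> borel_measurable N"
proof -
  interpret prob_space N using assms(1) by (simp add: exponential_uniform_family_def)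
  have "\<forall>i\<in>{1..} <+> {1..}. random_variable borel (case_sum E V i)"
    using assms(1) by (auto simp: exponential_uniform_family_def indep_vars_def)
  then show "E k \<in> borel_measurable N" "V k \<in> borel_measurable N"
    using assms(2) by (auto simp: Plus_def dest: bspec[of _ _ "Inl k"] bspec[of _ _ "Inr k"])
qed

theorem laplace_limit_family:
  assumes fam: "exponential_uniform_family N E V" and m: "m \<ge> 1"
    and ls: "length ls = m" "\<And>l. l \<in> set ls \<Longrightarrow> 0 \<le> l"
  shows "(\<integral>\<^sup>+\<omega>. ennreal (exp (- (\<Sum>i=1..m. ls ! (i - 1) * (E i \<omega> * (\<Prod>j=1..i. V j \<omega>))))) \<partial>N) = limit_transform ls 1"
proof -
  interpret prob_space N using fam by (simp add: exponential_uniform_family_def)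
  let ?J = "{1..<1 + m} <+> {1..<1 + m}" and ?X = "case_sum E V"
  let ?R = "\<lambda>\<omega>. \<lambda>k\<in>?J. ?X k \<omega>"
  have law: "distr N borel (?X k) = exp_unif_law k" if "k \<in> ?J" for k
    using fam that by (auto simp: exponential_uniform_family_def)
  have rv: "random_variable borel (?X k)" if "k \<in> ?J" for k
    using that exponential_uniform_family_measurable[OF fam] by auto
  have "indep_vars (\<lambda>_. borel) ?X ({1..} <+> {1..})"
    using fam by (simp add: exponential_uniform_family_def)
  then have "indep_vars (\<lambda>_. borel) ?X ?J"
    by (rule indep_vars_subset) (auto simp: Plus_def)
  then have "distr N (PiM ?J (\<lambda>_. borel)) ?R = PiM ?J (\<lambda>k. distr N borel (?X k))"
    by (intro indep_vars_iff_distr_eq_PiM'[THEN iffD1] rv) (use m in \<open>auto simp: Plus_def\<close>)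
  also have "\<dots> = PiM ?J exp_unif_law" by (intro PiM_cong refl law)
  finally have distr: "distr N (PiM ?J (\<lambda>_. borel)) ?R = PiM ?J exp_unif_law" .
  have R: "?R \<in> measurable N (PiM ?J (\<lambda>_. borel))"
    by (rule measurable_restrict) (rule rv)
  have meas: "(\<lambda>w. weighted_sum ls 1 1 w) \<in> borel_measurable (PiM ?J exp_unif_law)"
    by (rule measurable_weighted_sum) (use ls in \<open>auto simp: Plus_def\<close>)
  have "limit_transform ls 1 = (\<integral>\<^sup>+w. ennreal (exp (- weighted_sum ls 1 1 w)) \<partial>PiM ?J exp_unif_law)"
    using laplace_weighted_sum[of ls 1 1] ls by simp
  also have "\<dots> = (\<integral>\<^sup>+w. ennreal (exp (- weighted_sum ls 1 1 w)) \<partial>distr N (PiM ?J (\<lambda>_. borel)) ?R)"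
    by (simp only: distr)
  also have "\<dots> = (\<integral>\<^sup>+\<omega>. ennreal (exp (- weighted_sum ls 1 1 (?R \<omega>))) \<partial>N)"
    by (rule nn_integral_distr[OF R]) (use meas in \<open>simp add: distr\<close>)
  also have "\<dots> = (\<integral>\<^sup>+\<omega>. ennreal (exp (- (\<Sum>i=1..m. ls ! (i - 1) * (E i \<omega> * (\<Prod>j=1..i. V j \<omega>))))) \<partial>N)"
  proof (intro nn_integral_cong)
    fix \<omega>
    have "weighted_sum ls 1 1 (?R \<omega>) = (\<Sum>i<m. ls ! i * (E (Suc i) \<omega> * (\<Prod>j\<le>i. V (Suc j) \<omega>)))"
      unfolding weighted_sum_def ls(1)
    proof (rule sum.cong[OF refl])
      fix i assume i: "i \<in> {..<m}"
      have "(\<Prod>j\<le>i. ?R \<omega> (Inr (1 + j))) = (\<Prod>j\<le>i. V (Suc j) \<omega>)"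
        by (rule prod.cong) (use i in \<open>auto simp: Plus_def\<close>)
      then show "ls ! i * (?R \<omega> (Inl (1 + i)) * (1 * (\<Prod>j\<le>i. ?R \<omega> (Inr (1 + j))))) =
          ls ! i * (E (Suc i) \<omega> * (\<Prod>j\<le>i. V (Suc j) \<omega>))"
        using i by (auto simp: Plus_def)
    qed
    also have "\<dots> = (\<Sum>i=1..m. ls ! (i - 1) * (E i \<omega> * (\<Prod>j=1..i. V j \<omega>)))"
      by (simp add: sum.atLeast1_atMost_eq prod.atLeast1_atMost_eq lessThan_Suc_atMost
          del: prod.atMost_Suc prod.lessThan_Suc prod.cl_ivl_Suc)
    finally show "ennreal (exp (- weighted_sum ls 1 1 (?R \<omega>))) =
      ennreal (exp (- (\<Sum>i=1..m. ls ! (i - 1) * (E i \<omega> * (\<Prod>j=1..i. V j \<omega>)))))" by simp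
  qed
  finally show ?thesis ..
qed

section \<open>The branches as marked uniform variables\<close>

text \<open>
  Translation of the label by \<open>1 - p\<close> modulo 1. Labels below \<open>p\<close> are moved, in order, to
  \<open>[1 - p, 1)\<close>, and the labels of the branches that are cut off are moved below \<open>1 - p\<close>.
\<close>

definition rotate_label :: "real \<Rightarrow> real \<Rightarrow> real" where
  "rotate_label p x = (if x < p then x + (1 - p) else x - p)"

lemma borel_measurable_rotate_label[measurable]: "rotate_label p \<in> borel_measurable borel"
  unfolding rotate_label_def[abs_def] by measurable

lemma nn_integral_rotate_label:
  assumes p: "0 < p" "p \<le> 1" and F[measurable]: "F \<in> borel_measurable borel"
  shows "(\<integral>\<^sup>+x. F (rotate_label p x) \<partial>unif) = (\<integral>\<^sup>+x. F x \<partial>unif)"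
proof -
  have "(\<integral>\<^sup>+x. F (rotate_label p x) \<partial>unif) = (\<integral>\<^sup>+x. F (rotate_label p x) * indicator {0..1} x \<partial>lborel)"
    by (rule nn_integral_unif) measurable
  also have "\<dots> = (\<integral>\<^sup>+x. F (x + (1 - p)) * indicator {0..<p} x + F (x - p) * indicator {p..1} x \<partial>lborel)"
    by (intro nn_integral_cong) (use p in \<open>auto simp: rotate_label_def indicator_def\<close>)
  also have "\<dots> = (\<integral>\<^sup>+x. F (x + (1 - p)) * indicator {0..<p} x \<partial>lborel) + (\<integral>\<^sup>+x. F (x - p) * indicator {p..1} x \<partial>lborel)"
    by (rule nn_integral_add) measurable
  also have "(\<integral>\<^sup>+x. F (x + (1 - p)) * indicator {0..<p} x \<partial>lborel) = (\<integral>\<^sup>+x. F x * indicator {1 - p..<1} x \<partial>lborel)"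
    by (subst nn_integral_real_affine[where c = 1 and t = "1 - p" and f = "\<lambda>x. F x * indicator {1 - p..<1} x"])
      (auto intro!: nn_integral_cong simp: indicator_def add.commute)
  also have "(\<integral>\<^sup>+x. F (x - p) * indicator {p..1} x \<partial>lborel) = (\<integral>\<^sup>+x. F x * indicator {0..1 - p} x \<partial>lborel)"
    by (subst nn_integral_real_affine[where c = 1 and t = "- p" and f = "\<lambda>x. F x * indicator {0..1 - p} x"])
      (auto intro!: nn_integral_cong simp: indicator_def)
  also have "(\<integral>\<^sup>+x. F x * indicator {1 - p..<1} x \<partial>lborel) + \<dots> =
      (\<integral>\<^sup>+x. F x * indicator {1 - p..<1} x + F x * indicator {0..1 - p} x \<partial>lborel)"
    by (rule nn_integral_add[symmetric]) measurable
  also have "\<dots> = (\<integral>\<^sup>+x. F x * indicator {0..1} x \<partial>lborel)"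
  proof (rule nn_integral_cong_AE)
    show "AE x in lborel. F x * indicator {1 - p..<1} x + F x * indicator {0..1 - p} x = F x * indicator {0..1} x"
      using AE_lborel_singleton[of 1] AE_lborel_singleton[of "1 - p"]
      by eventually_elim (use p in \<open>auto simp: indicator_def\<close>)
  qed
  also have "\<dots> = (\<integral>\<^sup>+x. F x \<partial>unif)" by (rule nn_integral_unif[symmetric]) measurable
  finally show ?thesis .
qed

definition branch_mark :: "real \<Rightarrow> nat \<Rightarrow> real \<Rightarrow> (nat list \<Rightarrow> real) \<Rightarrow> ennreal" where
  "branch_mark p n l w =
     ennreal (if w [] < p then tree_weight (l * exp (- (real n * p))) (vertex_tree n w) else 1)"

text \<open>
  The conditional mean is \<open>nn_integral_marked_vertex_tree\<close>, expressed in the rotated label.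
\<close>

lemma marked_uniforms_vertex_space:
  assumes p: "0 < p" "p \<le> 1"
  shows "marked_uniforms (vertex_space n) (\<lambda>w. rotate_label p (w [])) (branch_mark p n) (branch_transform p n)"
proof -
  interpret prob_space "vertex_space n" by (rule prob_space_vertex_space)
  interpret E: prob_space "edge_space n" by (rule prob_space_edge_space)
  have X[measurable]: "(\<lambda>w. rotate_label p (w [])) \<in> borel_measurable (vertex_space n)"
    by (rule measurable_compose[OF measurable_root_label borel_measurable_rotate_label])
  have root: "(\<integral>\<^sup>+w. h (w []) \<partial>vertex_space n) = (\<integral>\<^sup>+x. h x \<partial>unif)" if "h \<in> borel_measurable borel" for h
  proof -
    have "(\<integral>\<^sup>+w. h (w []) * 1 \<partial>vertex_space n) = (\<integral>\<^sup>+x. h x * (\<integral>\<^sup>+u. 1 \<partial>edge_space n) \<partial>unif)"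
      by (rule nn_integral_vertex_tree[OF that, of "\<lambda>_. 1"]) auto
    then show ?thesis by (simp add: E.emeasure_space_1)
  qed
  show ?thesis
  proof
    show "(\<lambda>w. rotate_label p (w [])) \<in> borel_measurable (vertex_space n)" by measurable
    show "branch_mark p n l \<in> borel_measurable (vertex_space n)" for l
    proof -
      note [measurable] = borel_measurable_tree_weight[OF pred_in_vertex_tree] measurable_root_label
      show ?thesis unfolding branch_mark_def[abs_def] by measurable
    qed
    show "branch_transform p n l \<in> borel_measurable borel" for l by measurable
    show "distr (vertex_space n) borel (\<lambda>w. rotate_label p (w [])) = unif"
    proof (rule measure_eqI)
      fix A assume "A \<in> sets (distr (vertex_space n) borel (\<lambda>w. rotate_label p (w [])))"
      then have A[measurable]: "A \<in> sets borel" by simp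
      have "emeasure (distr (vertex_space n) borel (\<lambda>w. rotate_label p (w []))) A =
          (\<integral>\<^sup>+x. indicator A x \<partial>distr (vertex_space n) borel (\<lambda>w. rotate_label p (w [])))"
        by simp
      also have "\<dots> = (\<integral>\<^sup>+w. indicator A (rotate_label p (w [])) \<partial>vertex_space n)"
        by (rule nn_integral_distr) auto
      also have "\<dots> = (\<integral>\<^sup>+x. indicator A (rotate_label p x) \<partial>unif)"
        by (rule root) measurable
      also have "\<dots> = (\<integral>\<^sup>+x. indicator A x \<partial>unif)"
        by (rule nn_integral_rotate_label[OF p]) measurable
      also have "\<dots> = emeasure unif A" by simp
      finally show "emeasure (distr (vertex_space n) borel (\<lambda>w. rotate_label p (w []))) A = emeasure unif A" .
    qed simp
    show "(\<integral>\<^sup>+w. h (rotate_label p (w [])) * branch_mark p n l w \<partial>vertex_space n) =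
        (\<integral>\<^sup>+x. h x * branch_transform p n l x \<partial>unif)"
      if h[measurable]: "h \<in> borel_measurable borel" for h l
    proof -
      have "(\<integral>\<^sup>+w. h (rotate_label p (w [])) * branch_mark p n l w \<partial>vertex_space n) =
          (\<integral>\<^sup>+y. h (rotate_label p y) * (if y < p then mean_weight n (l * exp (- (real n * p))) y else 1) \<partial>unif)"
        unfolding branch_mark_def by (rule nn_integral_marked_vertex_tree) measurable
      also have "\<dots> = (\<integral>\<^sup>+y. h (rotate_label p y) * branch_transform p n l (rotate_label p y) \<partial>unif)"
      proof (rule nn_integral_cong_AE)
        have "AE y in unif. y \<in> {0..<1}"
        proof (rule AE_uniform_measureI)
          show "AE y in lborel. y \<in> {0..1} \<longrightarrow> y \<in> {0..<1 :: real}"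
            using AE_lborel_singleton[of "1 :: real"] by eventually_elim auto
        qed simp
        then show "AE y in unif. h (rotate_label p y) * (if y < p then mean_weight n (l * exp (- (real n * p))) y else 1) =
            h (rotate_label p y) * branch_transform p n l (rotate_label p y)"
          by eventually_elim (auto simp: rotate_label_def branch_transform_def)
      qed
      also have "\<dots> = (\<integral>\<^sup>+x. h x * branch_transform p n l x \<partial>unif)"
        by (rule nn_integral_rotate_label[OF p]) measurable
      finally show ?thesis .
    qed
  qed
qed

section \<open>Ranked subtrees\<close>

lemma root_children_temporal_tree:
  "root_children (temporal_tree n p u) = (\<lambda>j. [j]) ` {j. j < n \<and> u [j] < p}"
  by (auto simp: root_children_def length_Suc_conv temporal_tree_Cons)

lemma card_subtree_at_child:
  assumes "j < n" "u [j] < p"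
  shows "card (subtree_at (temporal_tree n p u) [j]) = card (vertex_tree n (branch n u j))"
proof -
  have "subtree_at (temporal_tree n p u) [j] = (#) j ` temporal_tree n (u [j]) (\<lambda>w. u (j # w))"
    using assms by (auto simp: subtree_at_def temporal_tree_Cons prefix_def)
  then show ?thesis by (simp add: card_image vertex_tree_branch)
qed

text \<open>
  After rotation every kept child is ranked above every child that is cut off. Hence the ranks up to
  the number of kept children agree with the ranks within the tree, and all later ranks belong to
  children that are cut off, whose subtree is empty.
\<close>

lemma card_ranked_subtree:
  fixes u :: "nat list \<Rightarrow> real" and n i :: nat and p :: real
  defines "x \<equiv> \<lambda>j. rotate_label p (u [j])"
  assumes range: "\<And>j. j < n \<Longrightarrow> 0 \<le> u [j] \<and> u [j] \<le> 1" and inj: "inj_on x {..<n}" and i: "1 \<le> i" "i \<le> n"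
  defines "j0 \<equiv> ranked {..<n} x i"
  shows "j0 < n" "card (ranked_subtree (temporal_tree n p u) u i) =
    (if u [j0] < p then card (vertex_tree n (branch n u j0)) else 0)"
proof -
  let ?A = "{j. j < n \<and> u [j] < p}" and ?C = "root_children (temporal_tree n p u)"
  let ?above = "{w \<in> {..<n}. x j0 \<le> x w}"
  have C: "?C = (\<lambda>j. [j]) ` ?A" by (rule root_children_temporal_tree)
  have cardC: "card ?C = card ?A" unfolding C by (rule card_image) (simp add: inj_on_def)
  have j0: "j0 < n" "card ?above = i"
    using ranked_properties[of "{..<n}" x i] inj i by (auto simp: j0_def)
  then show "j0 < n" by simp
  (* A tie is possible on the level of the bounds, between a label 0 and a label 1, and is excluded by
     injectivity. *)
  have kept_above: "x w < x v" if "v \<in> ?A" "w < n" "w \<notin> ?A" for v w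
  proof -
    have "x w \<le> x v" using that range[of v] range[of w] by (auto simp: x_def rotate_label_def)
    moreover have "x w \<noteq> x v" using inj that by (auto simp: inj_on_def)
    ultimately show ?thesis by simp
  qed
  have order: "x v \<le> x w \<longleftrightarrow> u [v] \<le> u [w]" if "v \<in> ?A" "w \<in> ?A" for v w
    using that by (auto simp: x_def rotate_label_def)
  show "card (ranked_subtree (temporal_tree n p u) u i) =
    (if u [j0] < p then card (vertex_tree n (branch n u j0)) else 0)"
  proof (cases "u [j0] < p")
    case True
    then have A: "j0 \<in> ?A" using j0 by simp
    have above: "?above = {w \<in> ?A. u [j0] \<le> u [w]}"
      using kept_above[OF A] order[OF A] by (auto simp: not_le[symmetric])
    have "{w \<in> ?C. u [j0] \<le> u w} = (\<lambda>j. [j]) ` {w \<in> ?A. u [j0] \<le> u [w]}"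
      unfolding C by auto
    then have card: "card {w \<in> ?C. u [j0] \<le> u w} = i"
      using j0(2) above by (simp add: card_image inj_on_def)
    have finC: "finite ?C" unfolding C by simp
    have "i \<le> card ?C"
      unfolding card[symmetric] by (rule card_mono[OF finC]) auto
    moreover have "inj_on u ?C"
      unfolding C
    proof (rule inj_onI)
      fix v w assume v: "v \<in> (\<lambda>j. [j]) ` ?A" and w: "w \<in> (\<lambda>j. [j]) ` ?A" and uvw: "u v = u w"
      then obtain a b where ab: "v = [a]" "w = [b]" "a < n" "b < n" by auto
      have "x a = x b" using uvw ab by (simp add: x_def)
      then show "v = w" using ab inj by (simp add: inj_on_def)
    qed
    ultimately have "\<exists>!v. v \<in> ?C \<and> card {w \<in> ?C. u v \<le> u w} = i"
      by (intro ranked_exists1 finC i)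
    then have "ranked_child (temporal_tree n p u) u i = [j0]"
      unfolding ranked_child_def by (rule the1_equality) (use A card C in auto)
    then show ?thesis
      using True \<open>i \<le> card ?C\<close> j0(1) by (simp add: ranked_subtree_def card_subtree_at_child)
  next
    case False
    have "insert j0 ?A \<subseteq> ?above"
      using kept_above[of _ j0] False j0(1) by (auto simp: less_imp_le)
    then have "card (insert j0 ?A) \<le> i"
      unfolding j0(2)[symmetric] by (intro card_mono) auto
    then have "card ?C < i" using False cardC by simp
    then show ?thesis using False by (simp add: ranked_subtree_def)
  qed
qed

text \<open>
  The child of rank \<open>i\<close> is defined by a definite description, whose value in case of ties is
  unspecified. It is nevertheless a function of the finite random relation that records the kept
  children and the comparisons between their labels.
\<close>

lemma pred_in_ranked_subtree:
  assumes "\<And>e. e \<in> tree_edges n \<Longrightarrow> (\<lambda>\<omega>. u \<omega> e) \<in> borel_measurable M"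
  shows "Measurable.pred M (\<lambda>\<omega>. v \<in> ranked_subtree (temporal_tree n p (u \<omega>)) (u \<omega>) i)"
proof -
  let ?T = "\<lambda>\<omega>. temporal_tree n p (u \<omega>)" and ?C = "(\<lambda>j. [j]) ` {..<n}"
  let ?P = "\<lambda>r \<omega>. fst r \<in> ?T \<omega> \<and> snd r \<in> ?T \<omega> \<and> u \<omega> (fst r) \<le> u \<omega> (snd r)"
  let ?R = "\<lambda>\<omega>. {r \<in> ?C \<times> ?C. ?P r \<omega>}"
  have T: "Measurable.pred M (\<lambda>\<omega>. v \<in> ?T \<omega>)" for v
    by (rule pred_in_temporal_tree) (use assms in auto)
  have label: "(\<lambda>\<omega>. u \<omega> v) \<in> borel_measurable M" if "v \<in> ?C" for v
    using that assms Cons_in_tree_edges Nil_in_tree_vertices by auto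
  have P: "Measurable.pred M (?P r)" if "r \<in> ?C \<times> ?C" for r
  proof -
    note [measurable] = T label[of "fst r"] label[of "snd r"]
    have "fst r \<in> ?C" "snd r \<in> ?C" using that by auto
    then show ?thesis by measurable
  qed
  (* The diagonal of the recorded relation is the set of kept children. *)
  have children: "root_children (?T \<omega>) = {v. (v, v) \<in> ?R \<omega>}" for \<omega>
    by (auto simp: root_children_temporal_tree temporal_tree_Cons)
  have child: "ranked_child (?T \<omega>) (u \<omega>) i =
      (THE v. (v, v) \<in> ?R \<omega> \<and> card {w. (w, w) \<in> ?R \<omega> \<and> (v, w) \<in> ?R \<omega>} = i)" for \<omega>
    unfolding ranked_child_def children
    by (rule arg_cong[where f = The], rule ext, rule conj_cong[OF _ arg_cong[where f = "\<lambda>A. card A = i"]])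
       auto
  let ?F = "\<lambda>R. (card {v. (v, v) \<in> R}, THE v. (v, v) \<in> R \<and> card {w. (w, w) \<in> R \<and> (v, w) \<in> R} = i)"
  have "(\<lambda>\<omega>. ?F (?R \<omega>)) \<in> measurable M (count_space UNIV)"
    by (rule measurable_finite_pattern) (use P in auto)
  moreover have "?F (?R \<omega>) = (card (root_children (?T \<omega>)), ranked_child (?T \<omega>) (u \<omega>) i)" for \<omega>
    by (simp only: children child)
  ultimately have "(\<lambda>\<omega>. (card (root_children (?T \<omega>)), ranked_child (?T \<omega>) (u \<omega>) i))
      \<in> measurable M (count_space UNIV)" by (simp only:)
  then have F: "Measurable.pred M (\<lambda>\<omega>. i \<le> fst (card (root_children (?T \<omega>)), ranked_child (?T \<omega>) (u \<omega>) i) \<and>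
      prefix (snd (card (root_children (?T \<omega>)), ranked_child (?T \<omega>) (u \<omega>) i)) v)"
    by (rule measurable_compose) simp
  have "v \<in> ranked_subtree (?T \<omega>) (u \<omega>) i \<longleftrightarrow>
      (i \<le> card (root_children (?T \<omega>)) \<and> prefix (ranked_child (?T \<omega>) (u \<omega>) i) v) \<and> v \<in> ?T \<omega>" for \<omega>
    by (auto simp: ranked_subtree_def subtree_at_def)
  then show ?thesis using F T[of v] unfolding fst_conv snd_conv by (simp only:) (rule pred_intros_logic)
qed

lemma ranked_subtree_subset: "ranked_subtree T u i \<subseteq> T"
  by (auto simp: ranked_subtree_def subtree_at_def)

lemma card_ranked_subtree_le:
  "ennreal (real (card (ranked_subtree T u i))) \<le> emeasure (count_space UNIV) T"
proof (cases "finite T")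
  case True
  then show ?thesis
    using card_mono[OF True ranked_subtree_subset, of u i] by (simp add: ennreal_of_nat_eq_real_of_nat)
qed simp

section \<open>Laplace transforms of the normalised sizes\<close>

text \<open>
  Almost surely the tree is finite, no two rotated labels agree and all are below 1. Then the exponential
  is the product of the marks of the \<open>m\<close> branches with the largest rotated labels, and
  \<open>nn_integral_top_product\<close> applies with \<open>a = 1\<close>.
\<close>

lemma laplace_ranked_subtrees:
  assumes p: "0 < p" "p \<le> 1" and U: "uniform_edge_variables M n U" and m: "1 \<le> m" "m \<le> n"
    and ls: "length ls = m"
  shows "(\<integral>\<^sup>+\<omega>. ennreal (exp (- (\<Sum>i=1..m. ls ! (i - 1) *
      (real (card (ranked_subtree (temporal_tree n p (\<lambda>e. U e \<omega>)) (\<lambda>e. U e \<omega>) i)) / exp (real n * p))))) \<partial>M) =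
    top_marks (branch_transform p n) ls n 1"
proof -
  have n: "n \<ge> 1" using m by simp
  let ?V = "vertex_space n" and ?X = "\<lambda>w. rotate_label p (w [])"
  let ?P = "PiM {..<n} (\<lambda>_. ?V)"
  interpret marked_uniforms ?V ?X "branch_mark p n" "branch_transform p n"
    by (rule marked_uniforms_vertex_space[OF p])
  let ?u = "\<lambda>\<omega> e. U e \<omega>" and ?T = "\<lambda>\<omega>. temporal_tree n p (\<lambda>e. U e \<omega>)"
  let ?w = "\<lambda>\<omega>. \<lambda>j\<in>{..<n}. branch n (?u \<omega>) j"
  have "AE w in ?V. w [] \<in> {0..1}"
  proof -
    have "AE x in unif. x \<in> {0..1}" by (rule AE_uniform_measureI) simp_all
    then show ?thesis
      unfolding vertex_space_def
      by (intro AE_PiM_component) (use prob_space_unif Nil_in_tree_vertices in auto)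
  qed
  then have "AE w in ?V. w [] \<in> {0..1} \<and> ?X w < 1"
    using AE_label_unit_interval AE_label_neq[of 1] by eventually_elim auto
  then have "AE w in ?P. w j [] \<in> {0..1} \<and> ?X (w j) < 1" if "j \<in> {..<n}" for j
    using that by (intro AE_PiM_component prob_space_vertex_space)
  then have "AE w in ?P. \<forall>j\<in>{..<n}. w j [] \<in> {0..1} \<and> ?X (w j) < 1"
    by (intro AE_finite_allI) auto
  then have "AE w in ?P. (\<forall>j\<in>{..<n}. w j [] \<in> {0..1} \<and> ?X (w j) < 1) \<and> inj_on (\<lambda>j. ?X (w j)) {..<n}"
    using AE_labels_distinct[OF finite_lessThan] by eventually_elim simp
  then have "AE w in distr M ?P ?w. (\<forall>j\<in>{..<n}. w j [] \<in> {0..1} \<and> ?X (w j) < 1) \<and> inj_on (\<lambda>j. ?X (w j)) {..<n}"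
    unfolding distr_branches[OF U n] .
  then have "AE \<omega> in M. (\<forall>j\<in>{..<n}. ?w \<omega> j [] \<in> {0..1} \<and> ?X (?w \<omega> j) < 1) \<and>
      inj_on (\<lambda>j. ?X (?w \<omega> j)) {..<n}"
    by (rule AE_distrD[OF measurable_branches[OF U]])
  moreover have "AE \<omega> in M. finite (?T \<omega>)"
    by (rule AE_finite_temporal_tree[OF U n]) (use p in auto)
  ultimately have "AE \<omega> in M. ennreal (exp (- (\<Sum>i=1..m. ls ! (i - 1) *
      (real (card (ranked_subtree (?T \<omega>) (?u \<omega>) i)) / exp (real n * p))))) = top_product {..<n} ls 1 (?w \<omega>)"
  proof eventually_elim
    case (elim \<omega>)
    let ?x = "\<lambda>j. rotate_label p (U [j] \<omega>)"
    have range: "0 \<le> U [j] \<omega> \<and> U [j] \<omega> \<le> 1" if "j < n" for j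
      using elim that by (auto simp: branch_Nil)
    have inj: "inj_on ?x {..<n}"
      using elim by (auto simp: inj_on_def branch_Nil)
    define c where "c i = real (card (ranked_subtree (?T \<omega>) (?u \<omega>) i)) / exp (real n * p)" for i
    define r where "r i = ranked {..<n} ?x i" for i
    have ranks: "ranked {..<n} (\<lambda>j. ?X (?w \<omega> j)) i = r i" for i
      unfolding r_def by (rule ranked_cong) (simp add: branch_Nil)
    have mark: "branch_mark p n l (?w \<omega> (r i)) = ennreal (exp (- (l * c i)))" if "1 \<le> i" "i \<le> n" for i l
    proof -
      note r = card_ranked_subtree[of n "?u \<omega>" p i, OF range inj that, folded r_def]
      show ?thesis
      proof (cases "U [r i] \<omega> < p")
        case True
        have "(#) (r i) ` vertex_tree n (branch n (?u \<omega>) (r i)) \<subseteq> ?T \<omega>"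
          unfolding vertex_tree_branch[of n "?u \<omega>" "r i", symmetric]
          using True r(1) by (auto simp: temporal_tree_Cons)
        then have "finite ((#) (r i) ` vertex_tree n (branch n (?u \<omega>) (r i)))"
          by (rule finite_subset) (use elim in simp)
        then have "finite (vertex_tree n (branch n (?u \<omega>) (r i)))"
          by (rule finite_imageD) simp
        then show ?thesis
          using True r by (simp add: branch_mark_def branch_Nil tree_weight_def c_def exp_minus divide_inverse mult_ac)
      next
        case False
        then show ?thesis using r by (simp add: branch_mark_def branch_Nil c_def)
      qed
    qed
    have ones: "(\<Prod>j\<in>{..<n}. indicator {..<1} (?X (?w \<omega> j)) :: ennreal) = 1"
      using elim by (intro prod.neutral) auto
    have "top_product {..<n} ls 1 (?w \<omega>) = (\<Prod>i<m. branch_mark p n (ls ! i) (?w \<omega> (r (Suc i))))"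
      unfolding top_product_def ranks ls ones by (rule mult_1_left)
    also have "\<dots> = (\<Prod>i<m. ennreal (exp (- (ls ! i * c (Suc i)))))"
      using m by (intro prod.cong refl mark) auto
    also have "\<dots> = ennreal (exp (- (\<Sum>i<m. ls ! i * c (Suc i))))"
      by (simp add: prod_ennreal sum_negf flip: exp_sum)
    also have "(\<Sum>i<m. ls ! i * c (Suc i)) = (\<Sum>i=1..m. ls ! (i - 1) * c i)"
      by (simp add: sum.atLeast1_atMost_eq)
    finally show ?case unfolding c_def by (rule sym)
  qed
  then have "(\<integral>\<^sup>+\<omega>. ennreal (exp (- (\<Sum>i=1..m. ls ! (i - 1) *
      (real (card (ranked_subtree (?T \<omega>) (?u \<omega>) i)) / exp (real n * p))))) \<partial>M) =
      (\<integral>\<^sup>+\<omega>. top_product {..<n} ls 1 (?w \<omega>) \<partial>M)"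
    by (rule nn_integral_cong_AE)
  also have "\<dots> = (\<integral>\<^sup>+w. top_product {..<n} ls 1 w \<partial>?P)"
    by (rule nn_integral_branches[OF U n]) (rule measurable_top_product, auto)
  also have "\<dots> = ennreal (1 ^ card {..<n}) * top_marks (branch_transform p n) ls (card {..<n}) 1"
    by (rule nn_integral_top_product) (use m ls in auto)
  finally show ?thesis by simp
qed

lemma real_laplace_eq:
  assumes "Z \<in> borel_measurable M"
  shows "(\<integral>\<omega>. exp (- Z \<omega>) \<partial>M) = enn2real (\<integral>\<^sup>+\<omega>. ennreal (exp (- Z \<omega>)) \<partial>M)"
  by (rule integral_eq_nn_integral) (use assms in auto)

lemma mean_unit_exponential: "(\<integral>\<^sup>+e. ennreal e \<partial>unit_exponential) = 1"
proof -
  have "(\<integral>\<^sup>+e. ennreal e \<partial>unit_exponential) = (\<integral>\<^sup>+e. ennreal (exponential_density 1 e) * ennreal e \<partial>lborel)"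
    by (rule nn_integral_density) auto
  also have "\<dots> = (\<integral>\<^sup>+e. ennreal (e ^ 1 * exp (- e)) * indicator {0..} e \<partial>lborel)"
    by (intro nn_integral_cong)
       (auto simp: exponential_density_def indicator_def ennreal_mult[symmetric] mult.commute)
  finally show ?thesis by (simp only: nn_intergal_power_times_exp_Ici) simp
qed

lemma AE_unit_exponential_nonneg: "AE e in unit_exponential. 0 \<le> e"
  by (subst AE_density) (auto simp: exponential_density_def)

lemma laplace_temporal_tree:
  assumes p: "0 < p" "p \<le> 1" and U: "uniform_edge_variables M n U" and n: "n \<ge> 1"
  shows "(\<integral>\<^sup>+\<omega>. ennreal (exp (- (l * (real (card (temporal_tree n p (\<lambda>e. U e \<omega>))) / exp (real n * p))))) \<partial>M) =
    mean_weight n (l * exp (- (real n * p))) p"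
  unfolding mean_weight_eq_integral[OF U n, symmetric]
proof (rule nn_integral_cong_AE)
  have "AE \<omega> in M. finite (temporal_tree n p (\<lambda>e. U e \<omega>))"
    by (rule AE_finite_temporal_tree[OF U n]) (use p in auto)
  then show "AE \<omega> in M. ennreal (exp (- (l * (real (card (temporal_tree n p (\<lambda>e. U e \<omega>))) / exp (real n * p))))) =
      ennreal (tree_weight (l * exp (- (real n * p))) (temporal_tree n p (\<lambda>e. U e \<omega>)))"
    by eventually_elim (simp add: tree_weight_def exp_minus divide_inverse mult_ac)
qed

lemma mean_normalised_card_le_1:
  assumes U: "uniform_edge_variables M n U" and n: "n \<ge> 1" and p: "0 < p" "p \<le> 1"
    and le: "\<And>\<omega>. ennreal (Z \<omega>) \<le> emeasure (count_space UNIV) (temporal_tree n p (\<lambda>e. U e \<omega>))" "\<And>\<omega>. 0 \<le> Z \<omega>"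
  shows "(\<integral>\<^sup>+\<omega>. ennreal (Z \<omega> / exp (real n * p)) \<partial>M) \<le> ennreal 1"
proof -
  have meas: "(\<lambda>\<omega>. emeasure (count_space UNIV) (temporal_tree n p (\<lambda>e. U e \<omega>))) \<in> borel_measurable M"
    by (intro borel_measurable_size pred_in_temporal_tree uniform_edge_variables_measurable[OF U]) auto
  have "(\<integral>\<^sup>+\<omega>. ennreal (Z \<omega> / exp (real n * p)) \<partial>M) \<le>
      (\<integral>\<^sup>+\<omega>. ennreal (1 / exp (real n * p)) * emeasure (count_space UNIV) (temporal_tree n p (\<lambda>e. U e \<omega>)) \<partial>M)"
  proof (rule nn_integral_mono)
    fix \<omega>
    have "ennreal (Z \<omega> / exp (real n * p)) = ennreal (1 / exp (real n * p)) * ennreal (Z \<omega>)"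
      using le(2) by (subst ennreal_mult[symmetric]) auto
    then show "ennreal (Z \<omega> / exp (real n * p)) \<le>
        ennreal (1 / exp (real n * p)) * emeasure (count_space UNIV) (temporal_tree n p (\<lambda>e. U e \<omega>))"
      using le(1) by (simp add: mult_left_mono)
  qed
  also have "\<dots> = ennreal (1 / exp (real n * p)) * ennreal (exp (real n * p))"
    using p by (simp add: nn_integral_cmult[OF meas] mean_size_temporal_tree[OF U n])
  also have "\<dots> = ennreal 1" by (subst ennreal_mult[symmetric]) auto
  finally show ?thesis .
qed

text \<open>
  Continuity on the finite power of the line carries over to the type of all functions, because
  restriction of the arguments is continuous for the product topologies.
\<close>

lemma continuous_on_restrict_arguments:
  fixes f :: "('i \<Rightarrow> real) \<Rightarrow> real"
  assumes "continuous_map (powertop_real I) euclideanreal f"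
  shows "continuous_on UNIV (\<lambda>x. f (restrict x I))"
proof -
  have "continuous_map (powertop_real UNIV) (powertop_real I) (\<lambda>x. restrict x I)"
    by (subst continuous_map_componentwise) (auto intro: continuous_map_product_projection)
  then have "continuous_map (powertop_real UNIV) euclideanreal (f \<circ> (\<lambda>x. restrict x I))"
    by (rule continuous_map_compose) (rule assms)
  then show ?thesis
    by (simp add: euclidean_product_topology comp_def)
qed

section \<open>Convergence in distribution\<close>

lemma weak_conv_temporal_tree:
  fixes M :: "nat \<Rightarrow> 'a measure"
  assumes p: "0 < p" "p \<le> 1" and U: "\<And>n. n \<ge> 1 \<Longrightarrow> uniform_edge_variables (M n) n (U n)"
  shows "weak_conv_m
     (\<lambda>n. distr (M n) borel (\<lambda>\<omega>. real (card (temporal_tree n p (\<lambda>e. U n e \<omega>))) / exp (real n * p)))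
     unit_exponential"
proof -
  let ?Z = "\<lambda>n \<omega>. real (card (temporal_tree n p (\<lambda>e. U n e \<omega>))) / exp (real n * p)"
  let ?D = "\<lambda>n. distr (M n) borel (?Z n)"
  have meas: "?Z n \<in> borel_measurable (M n)" if "n \<ge> 1" for n
  proof -
    have "(\<lambda>\<omega>. real (card (temporal_tree n p (\<lambda>e. U n e \<omega>)))) \<in> borel_measurable (M n)"
      by (intro borel_measurable_card pred_in_temporal_tree uniform_edge_variables_measurable[OF U[OF that]]) auto
    then show ?thesis by (rule borel_measurable_divide) simp
  qed
  have prob: "prob_space (M n)" if "n \<ge> 1" for n
    using U[OF that] by (simp add: uniform_edge_variables_def)
  have prob_exp: "prob_space unit_exponential" by (rule prob_space_exponential_density) simp
  have laplace: "(\<lambda>n. \<integral>\<omega>. exp (- (real k * ?Z (Suc n) \<omega>)) \<partial>M (Suc n))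
      \<longlonglongrightarrow> (\<integral>e. exp (- (real k * e)) \<partial>unit_exponential)" for k :: nat
  proof -
    have "(\<lambda>n. mean_weight n (real k * exp (- (real n * p))) (1 - (1 - p))) \<longlonglongrightarrow> ennreal (1 / (1 + real k * exp (- 0)))"
      by (rule mean_weight_limit[OF p]) simp_all
    then have "(\<lambda>n. mean_weight (Suc n) (real k * exp (- (real (Suc n) * p))) p) \<longlonglongrightarrow> ennreal (1 / (1 + real k))"
      using LIMSEQ_Suc by fastforce
    then have "(\<lambda>n. enn2real (mean_weight (Suc n) (real k * exp (- (real (Suc n) * p))) p)) \<longlonglongrightarrow> 1 / (1 + real k)"
      by (rule tendsto_enn2real) simp
    moreover have "(\<integral>\<omega>. exp (- (real k * ?Z (Suc n) \<omega>)) \<partial>M (Suc n)) =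
        enn2real (mean_weight (Suc n) (real k * exp (- (real (Suc n) * p))) p)" for n
      using laplace_temporal_tree[OF p U, of "Suc n" "real k"]
        real_laplace_eq[OF borel_measurable_times[OF borel_measurable_const meas], of "Suc n" "real k"] by simp
    moreover have "(\<integral>e. exp (- (real k * e)) \<partial>unit_exponential) = 1 / (1 + real k)"
      using laplace_unit_exponential[of "real k"] real_laplace_eq[of "\<lambda>e. real k * e" unit_exponential] by simp
    ultimately show ?thesis by simp
  qed
  have conv: "(\<lambda>n. \<integral>\<omega>. f (?Z (Suc n) \<omega>) \<partial>M (Suc n)) \<longlonglongrightarrow> (\<integral>e. f e \<partial>unit_exponential)"
    if f: "continuous_on UNIV f" "bounded (range f)" for f :: "real \<Rightarrow> real"
  proof -
    have "(\<lambda>n. \<integral>\<omega>. f (zero_extend {1 :: nat} (\<lambda>i. ?Z (Suc n) \<omega>) 1) \<partial>M (Suc n))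
        \<longlonglongrightarrow> (\<integral>e. f (zero_extend {1 :: nat} (\<lambda>i. e) 1) \<partial>unit_exponential)"
    proof (rule laplace_transforms_imp_weak_convergence[where C = 1 and f = "\<lambda>x. f (x 1)"
        and Y = "\<lambda>n \<omega> i. ?Z (Suc n) \<omega>" and Y' = "\<lambda>e i. e"])
      show "(\<integral>\<^sup>+\<omega>. ennreal (?Z (Suc n) \<omega>) \<partial>M (Suc n)) \<le> ennreal 1" for n
        by (rule mean_normalised_card_le_1[OF U _ p])
          (auto simp: ennreal_of_nat_eq_real_of_nat emeasure_count_space)
      show "(\<integral>\<^sup>+e. ennreal e \<partial>unit_exponential) \<le> ennreal 1"
        by (simp add: mean_unit_exponential)
      show "continuous_on UNIV (\<lambda>x :: nat \<Rightarrow> real. f (x 1))"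
        by (rule continuous_on_compose2[OF f(1) continuous_on_product_coordinates]) simp
      show "bounded (range (\<lambda>x :: nat \<Rightarrow> real. f (x 1)))"
        by (rule bounded_subset[OF f(2)]) auto
      show "(\<lambda>n. \<integral>\<omega>. exp (- (\<Sum>i\<in>{1}. real (k i) * ?Z (Suc n) \<omega>)) \<partial>M (Suc n))
        \<longlonglongrightarrow> (\<integral>e. exp (- (\<Sum>i\<in>{1}. real (k i) * e)) \<partial>unit_exponential)" for k :: "nat \<Rightarrow> nat"
        using laplace[of "k 1"] by simp
      show "?Z (Suc n) \<in> borel_measurable (M (Suc n))" for n by (rule meas) simp
      show "prob_space (M (Suc n))" for n by (rule prob) simp
    qed (use prob_exp AE_unit_exponential_nonneg in auto)
    then show ?thesis by (simp add: zero_extend_def)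
  qed
  (* Nothing is known about M 0, which need not be a probability space; convergence is shown for the
     shifted sequence and transferred to distribution functions at the end. *)
  have "weak_conv_m (\<lambda>n. ?D (Suc n)) unit_exponential"
  proof (rule integral_bdd_continuous_conv_imp_weak_conv)
    show "real_distribution (?D (Suc n))" for n
      by (intro prob_space.real_distribution_distr prob meas) auto
    show "real_distribution unit_exponential"
      using prob_exp by (simp add: real_distribution_def real_distribution_axioms_def)
    fix f :: "real \<Rightarrow> real" assume f: "\<And>x. isCont f x" "\<And>x. \<bar>f x\<bar> \<le> 1"
    have cont: "continuous_on UNIV f" using f(1) by (simp add: continuous_on_eq_continuous_at)
    have "integral\<^sup>L (?D (Suc n)) f = (\<integral>\<omega>. f (?Z (Suc n) \<omega>) \<partial>M (Suc n))" for n
      by (rule integral_distr[OF meas borel_measurable_continuous_onI[OF cont]]) simp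
    moreover have "bounded (range f)" using f(2) by (auto simp: bounded_iff)
    ultimately show "(\<lambda>n. integral\<^sup>L (?D (Suc n)) f) \<longlonglongrightarrow> integral\<^sup>L unit_exponential f"
      using conv[OF cont] by (simp only:)
  qed
  then have shifted: "(\<lambda>n. cdf (?D (Suc n)) x) \<longlonglongrightarrow> cdf unit_exponential x"
    if "isCont (cdf unit_exponential) x" for x
    using that by (simp only: weak_conv_m_def weak_conv_def)
  have "(\<lambda>n. cdf (?D n) x) \<longlonglongrightarrow> cdf unit_exponential x"
    if "isCont (cdf unit_exponential) x" for x
    by (rule LIMSEQ_imp_Suc[where f = "\<lambda>n. cdf (?D n) x", OF shifted[OF that]])
  then show ?thesis unfolding weak_conv_m_def weak_conv_def by blast
qed

lemma weak_conv_ranked_subtrees: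
  fixes M :: "nat \<Rightarrow> 'a measure" and N :: "'b measure"
  assumes p: "0 < p" "p \<le> 1" and U: "\<And>n. n \<ge> 1 \<Longrightarrow> uniform_edge_variables (M n) n (U n)"
    and fam: "exponential_uniform_family N E V" and m: "m \<ge> 1"
  shows "weak_conv_in (powertop_real {1..m})
     (\<lambda>n. distr (M n) (PiM {1..m} (\<lambda>_. borel))
        (\<lambda>\<omega>. \<lambda>i\<in>{1..m}.
           real (card (ranked_subtree (temporal_tree n p (\<lambda>e. U n e \<omega>)) (\<lambda>e. U n e \<omega>) i)) / exp (real n * p)))
     (distr N (PiM {1..m} (\<lambda>_. borel)) (\<lambda>\<omega>. \<lambda>i\<in>{1..m}. E i \<omega> * (\<Prod>j=1..i. V j \<omega>)))"
  unfolding weak_conv_in_def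
proof (intro allI impI, elim conjE)
  fix f :: "(nat \<Rightarrow> real) \<Rightarrow> real"
  assume f: "continuous_map (powertop_real {1..m}) euclideanreal f" "bounded (f ` topspace (powertop_real {1..m}))"
  let ?I = "{1..m}"
  let ?Y = "\<lambda>n \<omega> i. real (card (ranked_subtree (temporal_tree n p (\<lambda>e. U n e \<omega>)) (\<lambda>e. U n e \<omega>) i)) / exp (real n * p)"
  let ?L = "\<lambda>\<omega> i. E i \<omega> * (\<Prod>j=1..i. V j \<omega>)"
  let ?F = "\<lambda>x. f (restrict x ?I)"
  have contF: "continuous_on UNIV ?F" by (rule continuous_on_restrict_arguments[OF f(1)])
  have boundF: "bounded (range ?F)" by (rule bounded_subset[OF f(2)]) auto
  have restrict_extend: "restrict (zero_extend ?I y) ?I = restrict y ?I" for y :: "nat \<Rightarrow> real"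
    by (auto simp: zero_extend_def)
  have measf: "f \<in> borel_measurable (PiM ?I (\<lambda>_. borel))"
  proof -
    have "(\<lambda>x. ?F (zero_extend ?I x)) \<in> borel_measurable (PiM ?I (\<lambda>_. borel))"
      by (rule borel_measurable_zero_extend[OF contF]) auto
    moreover have "?F (zero_extend ?I x) = f x" if "x \<in> space (PiM ?I (\<lambda>_. borel :: real measure))" for x
    proof -
      have "restrict x ?I = x" using that by (simp add: space_PiM PiE_restrict)
      then show ?thesis unfolding restrict_extend by simp
    qed
    ultimately show ?thesis by (subst measurable_cong[symmetric]) auto
  qed
  interpret N: prob_space N using fam by (simp add: exponential_uniform_family_def)
  have prob: "prob_space (M n)" if "n \<ge> 1" for n
    using U[OF that] by (simp add: uniform_edge_variables_def)
  have measY: "(\<lambda>\<omega>. ?Y n \<omega> i) \<in> borel_measurable (M n)" if "n \<ge> 1" for n i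
  proof -
    have "(\<lambda>\<omega>. real (card (ranked_subtree (temporal_tree n p (\<lambda>e. U n e \<omega>)) (\<lambda>e. U n e \<omega>) i))) \<in> borel_measurable (M n)"
      by (intro borel_measurable_card pred_in_ranked_subtree uniform_edge_variables_measurable[OF U[OF that]])
    then show ?thesis by (rule borel_measurable_divide) simp
  qed
  have measL: "(\<lambda>\<omega>. ?L \<omega> i) \<in> borel_measurable N" if "i \<in> ?I" for i
    using that exponential_uniform_family_measurable[OF fam]
    by (intro borel_measurable_times borel_measurable_prod) auto
  have E_nonneg: "AE \<omega> in N. 0 \<le> E i \<omega>" and V_range: "AE \<omega> in N. V i \<omega> \<in> {0..1}"
    and E_mean: "(\<integral>\<^sup>+\<omega>. ennreal (E i \<omega>) \<partial>N) = 1" if "i \<ge> 1" for i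
  proof -
    note meas = exponential_uniform_family_measurable[OF fam that]
    have laws: "distr N borel (E i) = unit_exponential" "distr N borel (V i) = unif"
      using fam that by (auto simp: exponential_uniform_family_def)
    show "AE \<omega> in N. 0 \<le> E i \<omega>"
      by (rule AE_distrD[OF meas(1)]) (simp only: laws AE_unit_exponential_nonneg)
    have "AE v in unif. v \<in> {0..1}" by (rule AE_uniform_measureI) simp_all
    then show "AE \<omega> in N. V i \<omega> \<in> {0..1}"
      by (intro AE_distrD[OF meas(2)]) (simp only: laws)
    show "(\<integral>\<^sup>+\<omega>. ennreal (E i \<omega>) \<partial>N) = 1"
      using nn_integral_distr[OF meas(1), of ennreal] by (simp add: laws mean_unit_exponential)
  qed
  have range: "AE \<omega> in N. 0 \<le> ?L \<omega> i \<and> ?L \<omega> i \<le> E i \<omega>" if "i \<in> ?I" for i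
  proof -
    have "AE \<omega> in N. \<forall>j\<in>{1..i}. V j \<omega> \<in> {0..1}"
      using V_range by (intro AE_finite_allI) auto
    moreover have "AE \<omega> in N. 0 \<le> E i \<omega>" using E_nonneg that by simp
    ultimately show ?thesis
    proof eventually_elim
      case (elim \<omega>)
      have "0 \<le> (\<Prod>j=1..i. V j \<omega>)" "(\<Prod>j=1..i. V j \<omega>) \<le> 1"
        using elim by (auto intro!: prod_nonneg prod_le_1)
      then show ?case using elim by (auto intro: mult_left_le)
    qed
  qed
  (* The sequence is shifted by m, since the m-th rank makes sense among n branches only for n \<ge> m. *)
  have laplace: "(\<lambda>n. \<integral>\<omega>. exp (- (\<Sum>i\<in>?I. real (k i) * ?Y (n + m) \<omega> i)) \<partial>M (n + m))
      \<longlonglongrightarrow> (\<integral>\<omega>. exp (- (\<Sum>i\<in>?I. real (k i) * ?L \<omega> i)) \<partial>N)" for k :: "nat \<Rightarrow> nat"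
  proof -
    define ls where "ls = map (\<lambda>i. real (k (Suc i))) [0..<m]"
    have ls: "length ls = m" "\<And>l. l \<in> set ls \<Longrightarrow> 0 \<le> l" "\<And>i. i \<in> ?I \<Longrightarrow> ls ! (i - 1) = real (k i)"
      by (auto simp: ls_def)
    have weights: "(\<Sum>i=1..m. ls ! (i - 1) * y i) = (\<Sum>i\<in>?I. real (k i) * y i)" for y :: "nat \<Rightarrow> real"
      by (intro sum.cong refl) (simp only: ls(3))
    have fin: "limit_transform ls 1 = ennreal (enn2real (limit_transform ls 1))"
      using limit_transform_le_1[of ls 1] ls by (simp add: order_le_less_trans)
    have "(\<lambda>n. top_marks (branch_transform p n) ls (n - 0) 1) \<longlonglongrightarrow> limit_transform ls (exp (- 0))"
      by (rule top_marks_limit[OF p]) (use ls in auto)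
    then have "(\<lambda>n. top_marks (branch_transform p n) ls n 1) \<longlonglongrightarrow> ennreal (enn2real (limit_transform ls 1))"
      by (subst fin[symmetric]) simp
    then have "(\<lambda>n. enn2real (top_marks (branch_transform p n) ls n 1)) \<longlonglongrightarrow> enn2real (limit_transform ls 1)"
      by (rule tendsto_enn2real) simp
    then have "(\<lambda>n. enn2real (top_marks (branch_transform p (n + m)) ls (n + m) 1)) \<longlonglongrightarrow> enn2real (limit_transform ls 1)"
      by (rule LIMSEQ_ignore_initial_segment)
    moreover have "(\<integral>\<omega>. exp (- (\<Sum>i\<in>?I. real (k i) * ?Y (n + m) \<omega> i)) \<partial>M (n + m)) =
        enn2real (top_marks (branch_transform p (n + m)) ls (n + m) 1)" for n
    proof -
      have nm: "n + m \<ge> 1" using m by simp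
      have "(\<integral>\<^sup>+\<omega>. ennreal (exp (- (\<Sum>i\<in>?I. real (k i) * ?Y (n + m) \<omega> i))) \<partial>M (n + m)) =
          top_marks (branch_transform p (n + m)) ls (n + m) 1"
        using laplace_ranked_subtrees[OF p U[OF nm] m _ ls(1)] unfolding weights by simp
      moreover have "(\<lambda>\<omega>. \<Sum>i\<in>?I. real (k i) * ?Y (n + m) \<omega> i) \<in> borel_measurable (M (n + m))"
        by (intro borel_measurable_sum borel_measurable_times borel_measurable_const measY nm)
      ultimately show ?thesis by (simp only: real_laplace_eq)
    qed
    moreover have "(\<integral>\<omega>. exp (- (\<Sum>i\<in>?I. real (k i) * ?L \<omega> i)) \<partial>N) = enn2real (limit_transform ls 1)"
    proof -
      have "(\<integral>\<^sup>+\<omega>. ennreal (exp (- (\<Sum>i\<in>?I. real (k i) * ?L \<omega> i))) \<partial>N) = limit_transform ls 1"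
        using laplace_limit_family[OF fam m ls(1,2)] unfolding weights by simp
      moreover have "(\<lambda>\<omega>. \<Sum>i\<in>?I. real (k i) * ?L \<omega> i) \<in> borel_measurable N"
        by (intro borel_measurable_sum borel_measurable_times[OF borel_measurable_const] measL)
      ultimately show ?thesis by (simp only: real_laplace_eq)
    qed
    ultimately show ?thesis by simp
  qed
  have "(\<lambda>n. \<integral>\<omega>. ?F (zero_extend ?I (?Y (n + m) \<omega>)) \<partial>M (n + m)) \<longlonglongrightarrow> (\<integral>\<omega>. ?F (zero_extend ?I (?L \<omega>)) \<partial>N)"
  proof (rule laplace_transforms_imp_weak_convergence[where C = 1 and f = ?F
      and Y = "\<lambda>n. ?Y (n + m)" and Y' = ?L])
    show "finite ?I" by simp
    show "prob_space (M (n + m))" for n using prob[of "n + m"] m by simp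
    show "prob_space N" by (rule N.prob_space_axioms)
    show "(\<lambda>\<omega>. ?Y (n + m) \<omega> i) \<in> borel_measurable (M (n + m))" for n i using measY[of "n + m" i] m by simp
    show "(\<lambda>\<omega>. ?L \<omega> i) \<in> borel_measurable N" if "i \<in> ?I" for i by (rule measL[OF that])
    show "AE \<omega> in M (n + m). 0 \<le> ?Y (n + m) \<omega> i" for n i by simp
    show "AE \<omega> in N. 0 \<le> ?L \<omega> i" if "i \<in> ?I" for i using range[OF that] by eventually_elim simp
    show "(\<integral>\<^sup>+\<omega>. ennreal (?Y (n + m) \<omega> i) \<partial>M (n + m)) \<le> ennreal 1" for n i
      by (rule mean_normalised_card_le_1[OF U _ p]) (use m card_ranked_subtree_le in auto)
    show "(\<integral>\<^sup>+\<omega>. ennreal (?L \<omega> i) \<partial>N) \<le> ennreal 1" if "i \<in> ?I" for i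
    proof -
      have "(\<integral>\<^sup>+\<omega>. ennreal (?L \<omega> i) \<partial>N) \<le> (\<integral>\<^sup>+\<omega>. ennreal (E i \<omega>) \<partial>N)"
        using range[OF that] by (intro nn_integral_mono_AE, eventually_elim) (simp add: ennreal_leI)
      then show ?thesis using E_mean[of i] that by simp
    qed
    show "(\<lambda>n. \<integral>\<omega>. exp (- (\<Sum>i\<in>?I. real (k i) * ?Y (n + m) \<omega> i)) \<partial>M (n + m))
      \<longlonglongrightarrow> (\<integral>\<omega>. exp (- (\<Sum>i\<in>?I. real (k i) * ?L \<omega> i)) \<partial>N)" for k by (rule laplace)
  qed (use contF boundF in auto)
  then have "(\<lambda>n. \<integral>\<omega>. f (restrict (?Y (n + m) \<omega>) ?I) \<partial>M (n + m)) \<longlonglongrightarrow> (\<integral>\<omega>. f (restrict (?L \<omega>) ?I) \<partial>N)"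
    unfolding restrict_extend .
  moreover have "(\<integral>x. f x \<partial>distr (M (n + m)) (PiM ?I (\<lambda>_. borel)) (\<lambda>\<omega>. restrict (?Y (n + m) \<omega>) ?I)) =
      (\<integral>\<omega>. f (restrict (?Y (n + m) \<omega>) ?I) \<partial>M (n + m))" for n
    by (rule integral_distr[OF measurable_restrict measf]) (use measY[of "n + m"] m in simp)
  moreover have "(\<integral>x. f x \<partial>distr N (PiM ?I (\<lambda>_. borel)) (\<lambda>\<omega>. restrict (?L \<omega>) ?I)) =
      (\<integral>\<omega>. f (restrict (?L \<omega>) ?I) \<partial>N)"
    by (rule integral_distr[OF measurable_restrict measf]) (rule measL)
  ultimately have "(\<lambda>n. \<integral>x. f x \<partial>distr (M (n + m)) (PiM ?I (\<lambda>_. borel)) (\<lambda>\<omega>. restrict (?Y (n + m) \<omega>) ?I))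
      \<longlonglongrightarrow> (\<integral>x. f x \<partial>distr N (PiM ?I (\<lambda>_. borel)) (\<lambda>\<omega>. restrict (?L \<omega>) ?I))"
    by simp
  then show "(\<lambda>n. \<integral>x. f x \<partial>distr (M n) (PiM ?I (\<lambda>_. borel)) (\<lambda>\<omega>. restrict (?Y n \<omega>) ?I))
      \<longlonglongrightarrow> (\<integral>x. f x \<partial>distr N (PiM ?I (\<lambda>_. borel)) (\<lambda>\<omega>. restrict (?L \<omega>) ?I))"
    by (rule LIMSEQ_offset)
qed

theorem theorem2p1:
  fixes p :: real
    and M :: "nat \<Rightarrow> 'a measure"
    and U :: "nat \<Rightarrow> nat list \<Rightarrow> 'a \<Rightarrow> real"
    and T :: "nat \<Rightarrow> 'a \<Rightarrow> nat list set"
  assumes "0 < p" and "p \<le> 1"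
    and "\<And>n. n \<ge> 1 \<Longrightarrow> uniform_edge_variables (M n) n (U n)"
    and "\<And>n \<omega>. T n \<omega> = temporal_tree n p (\<lambda>e. U n e \<omega>)"
  shows
    "(\<forall>n\<ge>1. (\<integral>\<^sup>+\<omega>. emeasure (count_space UNIV) (T n \<omega>) \<partial>M n) = ennreal (exp (real n * p)))
     \<and> weak_conv_m
         (\<lambda>n. distr (M n) borel (\<lambda>\<omega>. real (card (T n \<omega>)) / exp (real n * p)))
         (density lborel (exponential_density 1))
     \<and> (\<forall>(N :: 'b measure) E V. exponential_uniform_family N E V \<longrightarrow>
         (\<forall>m::nat. m \<ge> 1 \<longrightarrow>
           weak_conv_in (powertop_real {1..m})
             (\<lambda>n. distr (M n) (PiM {1..m} (\<lambda>_. borel))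
                (\<lambda>\<omega>. \<lambda>i\<in>{1..m}.
                   real (card (ranked_subtree (T n \<omega>) (\<lambda>e. U n e \<omega>) i)) / exp (real n * p)))
             (distr N (PiM {1..m} (\<lambda>_. borel))
                (\<lambda>\<omega>. \<lambda>i\<in>{1..m}. E i \<omega> * (\<Prod>j=1..i. V j \<omega>)))))"
  unfolding assms(4)
proof (intro conjI allI impI)
  show "(\<integral>\<^sup>+\<omega>. emeasure (count_space UNIV) (temporal_tree n p (\<lambda>e. U n e \<omega>)) \<partial>M n) = ennreal (exp (real n * p))"
    if "1 \<le> n" for n
    by (rule mean_size_temporal_tree) (use assms that in auto)
qed (use weak_conv_temporal_tree[OF assms(1-3)] weak_conv_ranked_subtrees[OF assms(1-3)] in auto)

end
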